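(* Let $n\ge1$ be an integer, $0<p\le1$, $\alpha>-1$, $\lambda=\frac{\alpha+n+1}{p}$, $m\in\mathbb N_0$ and $m>\max(\lambda-1,\frac{\alpha}{p})$. For $f\in A^\infty_\lambda$ set $$d_1(f)={\rm dist}_{A^\infty_\lambda}(f,A^p_\alpha)=\inf_{g\in A^p_\alpha}\|f-g\|_{A^\infty_\lambda},$$ $$d_2(f)=\inf\left\{\epsilon>0:\int_{\mathbb R^{n+1}_+}\left(\int_{V_{\epsilon,\lambda}(f)}|Q_m(z,w)|\,s^{m-\lambda}\,dy\,ds\right)^pt^\alpha\,dx\,dt<\infty\right\},$$ where $z=(x,t)$, $w=(y,s)$. Then $d_1(f)\asymp d_2(f)$, i.e. there are constants $c,C>0$ independent of $f$ such that $c\,d_1(f)\le d_2(f)\le C\,d_1(f)$ for all $f\in A^\infty_\lambda$.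
   Context: $\mathbb R^{n+1}_+=\{(x,t):x\in\mathbb R^n,\ t>0\}$; $h(\mathbb R^{n+1}_+)$ is the space of harmonic functions on it. $A^p_\alpha=\{f\in h(\mathbb R^{n+1}_+):\int_{\mathbb R^{n+1}_+}|f(x,t)|^pt^\alpha\,dx\,dt<\infty\}$. For $\lambda>0$, $A^\infty_\lambda=\{f\in h(\mathbb R^{n+1}_+):\|f\|_{A^\infty_\lambda}=\sup_{(x,t)\in\mathbb R^{n+1}_+}|f(x,t)|\,t^\lambda<\infty\}$. It is known that $A^p_\alpha$ is continuously embedded into $A^\infty_{(\alpha+n+1)/p}$. For $\epsilon>0$, $\lambda>0$ and $f\in h(\mathbb R^{n+1}_+)$: $V_{\epsilon,\lambda}(f)=\{(x,t)\in\mathbb R^{n+1}_+:|f(x,t)|\,t^\lambda\ge\epsilon\}$. The Poisson kernel is $P(x,t)=c_n\frac{t}{(|x|^2+t^2)^{(n+1)/2}}$, $x\in\mathbb R^n$, $t>0$, where $c_n$ is the usual normalizing constant ($\int_{\mathbb R^n}P(x,t)\,dx=1$). For $l\in\mathbb N_0$ the Bergman kernel is $$Q_l(z,w)=\frac{(-2)^{l+1}}{l!}\frac{\partial^{l+1}}{\partial t^{l+1}}P(x-y,t+s),\qquad z=(x,t),\ w=(y,s)\in\mathbb R^{n+1}_+.$$ *)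

theory Defs
  imports "HOL-Analysis.Analysis"
begin

text \<open>
  The upper half-space over \<open>\<real>\<^sup>n\<close>, with \<open>n = CARD('n) \<ge> 1\<close>. Points are pairs \<open>(x, t)\<close>; functions on
  the half-space are total functions whose values outside it are irrelevant.
\<close>

definition upper_half_space :: "((real ^ 'n) \<times> real) set" where
  "upper_half_space = {z. snd z > 0}"

text \<open>
  Harmonicity on an open set: \<open>f\<close> is twice continuously differentiable, \<open>f'\<close> and \<open>f''\<close> being its first
  and second Frechet derivatives, and the Laplacian, i.e. the trace of \<open>f''\<close> over the standard
  orthonormal basis, vanishes.
\<close>

definition harmonic_on :: "('a::euclidean_space \<Rightarrow> real) \<Rightarrow> 'a set \<Rightarrow> bool" where
  "harmonic_on f S \<longleftrightarrow>
     (\<exists>(f' :: 'a \<Rightarrow> 'a \<Rightarrow>\<^sub>L real) (f'' :: 'a \<Rightarrow> 'a \<Rightarrow>\<^sub>L ('a \<Rightarrow>\<^sub>L real)).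
        (\<forall>z\<in>S. (f has_derivative blinfun_apply (f' z)) (at z)) \<and>
        (\<forall>z\<in>S. (f' has_derivative blinfun_apply (f'' z)) (at z)) \<and>
        continuous_on S f'' \<and>
        (\<forall>z\<in>S. (\<Sum>b\<in>Basis. blinfun_apply (blinfun_apply (f'' z) b) b) = 0))"

definition bergman_space :: "real \<Rightarrow> real \<Rightarrow> ((real ^ 'n) \<times> real \<Rightarrow> real) set" where
  "bergman_space p \<alpha> =
     {f. harmonic_on f upper_half_space \<and>
         (\<integral>\<^sup>+z\<in>upper_half_space. ennreal (\<bar>f z\<bar> powr p * snd z powr \<alpha>) \<partial>lborel) < \<infinity>}"

text \<open>The weighted supremum norm; it takes the value \<open>\<infinity>\<close> exactly when the supremum is infinite.\<close>

definition growth_norm :: "real \<Rightarrow> ((real ^ 'n) \<times> real \<Rightarrow> real) \<Rightarrow> ennreal" where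
  "growth_norm l f = (SUP z\<in>upper_half_space. ennreal (\<bar>f z\<bar> * snd z powr l))"

definition growth_space :: "real \<Rightarrow> ((real ^ 'n) \<times> real \<Rightarrow> real) set" where
  "growth_space l = {f. harmonic_on f upper_half_space \<and> growth_norm l f < \<infinity>}"

definition level_set :: "real \<Rightarrow> real \<Rightarrow> ((real ^ 'n) \<times> real \<Rightarrow> real) \<Rightarrow> ((real ^ 'n) \<times> real) set" where
  "level_set \<epsilon> l f = {z \<in> upper_half_space. \<bar>f z\<bar> * snd z powr l \<ge> \<epsilon>}"

text \<open>
  The normalizing constant is determined by \<open>\<integral> P(x, 1) dx = 1\<close>; by scaling,
  \<open>\<integral> P(x, t) dx = 1\<close> then holds for every \<open>t > 0\<close>. The integrand decays like \<open>|x|\<^sup>-\<^sup>(\<^sup>n\<^sup>+\<^sup>1\<^sup>)\<close>, hence is integrable.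
\<close>

definition poisson_const :: "'n::finite itself \<Rightarrow> real" where
  "poisson_const _ =
     1 / (\<integral>x. 1 / ((norm (x :: real ^ 'n))\<^sup>2 + 1) powr ((real CARD('n) + 1) / 2) \<partial>lborel)"

definition poisson_kernel :: "real ^ 'n \<Rightarrow> real \<Rightarrow> real" where
  "poisson_kernel x t =
     poisson_const TYPE('n) * (t / ((norm x)\<^sup>2 + t\<^sup>2) powr ((real CARD('n) + 1) / 2))"

definition bergman_kernel :: "nat \<Rightarrow> (real ^ 'n) \<times> real \<Rightarrow> (real ^ 'n) \<times> real \<Rightarrow> real" where
  "bergman_kernel l z w =
     (-2) ^ (l + 1) / fact l *
     (deriv ^^ (l + 1)) (\<lambda>t. poisson_kernel (fst z - fst w) (t + snd w)) (snd z)"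

definition ennreal_powr :: "ennreal \<Rightarrow> real \<Rightarrow> ennreal" where
  "ennreal_powr x p = (if x = \<infinity> then \<infinity> else ennreal (enn2real x powr p))"

definition bergman_dist :: "real \<Rightarrow> real \<Rightarrow> real \<Rightarrow> ((real ^ 'n) \<times> real \<Rightarrow> real) \<Rightarrow> ennreal" where
  "bergman_dist p \<alpha> l f = (INF g\<in>bergman_space p \<alpha>. growth_norm l (\<lambda>z. f z - g z))"

definition level_dist :: "real \<Rightarrow> real \<Rightarrow> real \<Rightarrow> nat \<Rightarrow> ((real ^ 'n) \<times> real \<Rightarrow> real) \<Rightarrow> ennreal" where
  "level_dist p \<alpha> l m f =
     (INF \<epsilon> \<in> {\<epsilon>. \<epsilon> > 0 \<and>
        (\<integral>\<^sup>+z\<in>upper_half_space.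
           (ennreal_powr
              (\<integral>\<^sup>+w\<in>level_set \<epsilon> l f. ennreal (\<bar>bergman_kernel m z w\<bar> * snd w powr (real m - l)) \<partial>lborel) p
            * ennreal (snd z powr \<alpha>)) \<partial>lborel) < \<infinity>}. ennreal \<epsilon>)"

end

theory Submission
  imports Defs
begin

text \<open>
  Write \<open>z = (x, t)\<close>, \<open>w = (y, s)\<close>, and let \<open>r\<close> be the distance from \<open>z\<close> to the mirror image of \<open>w\<close> in the
  boundary. Two estimates carry both inequalities: \<open>\<bar>Q\<^sub>m(z, w)\<bar>\<close> is at most a constant times \<open>r\<close> to the power
  \<open>-(n + m + 1)\<close>, because the Poisson kernel is homogeneous and each derivative lowers the degree by one
  (\<open>homogeneous_kernel_bound\<close>); and the integral over the half-space of \<open>r powr (-q) * s powr \<beta>\<close> in \<open>w\<close> is at most a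
  constant times \<open>t powr (n + 1 + \<beta> - q)\<close> (\<open>half_space_kernel_estimate\<close>).

  \<^bold>\<open>The Bergman distance is at most a multiple of the level distance.\<close> A function \<open>f\<close> of the growth space is
  reproduced by the Bergman kernel: \<open>f(z)\<close> is the integral of \<open>f(w) Q\<^sub>m(z, w) s\<^sup>m\<close> (\<open>bergman_reproducing\<close>). If \<open>\<epsilon>\<close> is admissible in
  the definition of the level distance, let \<open>g\<close> be the same integral restricted to the level set of \<open>\<epsilon>\<close>. It is
  harmonic, and bounded by a multiple of the inner integral in the definition of the level distance; hence it lies in the Bergman space.
  On the complement of the level set \<open>\<bar>f\<bar> < \<epsilon> s powr (-l)\<close>, so \<open>\<bar>f - g\<bar>\<close> is at most \<open>\<epsilon>\<close> times the integral of
  \<open>\<bar>Q\<^sub>m(z, w)\<bar> s powr (m - l)\<close>, which is of order \<open>t powr (-l)\<close>. This is \<open>bergman_dist_le_level\<close>.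

  The reproducing formula rests on the Poisson formula \<open>f(x, \<sigma> + \<tau>) = \<integral> P(x - y, \<tau>) f(y, \<sigma>) dy\<close>
  (\<open>poisson_formula\<close>), which follows from the uniqueness of bounded harmonic functions with given boundary
  values. Differentiating it in \<open>\<tau>\<close> shows that integration in \<open>y\<close> turns \<open>Q\<^sub>m\<close> into the vertical derivative of order
  \<open>m + 1\<close> of \<open>f\<close> at height \<open>t + 2 s\<close>; the remaining integral over \<open>s\<close> is done by parts.

  \<^bold>\<open>The level distance is at most the Bergman distance.\<close> If \<open>f - g\<close> has norm \<open>d\<close>, then the level set of \<open>f\<close> for
  \<open>d + \<epsilon>\<close> is contained in that of \<open>g\<close> for \<open>\<epsilon>\<close>. So it suffices that for \<open>g\<close> in the Bergman space every positive \<open>\<epsilon>\<close> is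
  admissible (\<open>bergman_space_level_integral_finite\<close>). On the level set \<open>1 \<le> \<bar>g\<bar> s powr l / \<epsilon>\<close>, which leads to the \<open>p\<close>-th power of an
  integral operator with positive kernel applied to \<open>\<bar>g\<bar>\<close>, where \<open>p \<le> 1\<close>. The mean value inequality
  for \<open>\<bar>g\<bar> powr p\<close> (\<open>harmonic_power_mean_value_inequality\<close>) bounds the integrand pointwise by its own integral with
  exponent \<open>p\<close>, and this suffices to carry the power \<open>p\<close> inside (\<open>small_exponent_integral_bound\<close>). Tonelli's theorem
  and the second estimate above finish the proof.
\<close>

type_synonym 'n point = "(real ^ 'n) \<times> real"

notation upper_half_space ("\<H>")

section \<open>Gradients and differentiation under the integral sign\<close>

text \<open>
  Derivatives are recorded by their components along the standard basis. In this form second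
  derivatives, and derivatives of integrals depending on a parameter, remain real valued, so that
  they can be integrated without recourse to spaces of operators.
\<close>

definition has_gradient :: "('a::euclidean_space \<Rightarrow> real) \<Rightarrow> ('a \<Rightarrow> 'a \<Rightarrow> real) \<Rightarrow> 'a set \<Rightarrow> bool" where
  "has_gradient f D S \<longleftrightarrow> (\<forall>z\<in>S. (f has_derivative (\<lambda>v. \<Sum>b\<in>Basis. (v \<bullet> b) * D b z)) (at z))"

lemma has_gradientD:
  "has_gradient f D S \<Longrightarrow> z \<in> S \<Longrightarrow> (f has_derivative (\<lambda>v. \<Sum>b\<in>Basis. (v \<bullet> b) * D b z)) (at z)"
  by (simp add: has_gradient_def)

lemma has_gradient_imp_continuous_on: "has_gradient f D S \<Longrightarrow> continuous_on S f"
  by (intro continuous_at_imp_continuous_on ballI has_derivative_continuous) (erule (1) has_gradientD)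

lemma has_gradient_cong:
  assumes "has_gradient f D S" "open S" "\<And>z. z \<in> S \<Longrightarrow> f z = g z"
    and "\<And>b z. b \<in> Basis \<Longrightarrow> z \<in> S \<Longrightarrow> D b z = E b z"
  shows "has_gradient g E S"
  unfolding has_gradient_def
proof
  fix z assume z: "z \<in> S"
  have "(\<lambda>v. \<Sum>b\<in>Basis. (v \<bullet> b) * D b z) = (\<lambda>v. \<Sum>b\<in>Basis. (v \<bullet> b) * E b z)"
    using assms(4) z by (intro ext sum.cong) auto
  then have "(f has_derivative (\<lambda>v. \<Sum>b\<in>Basis. (v \<bullet> b) * E b z)) (at z)"
    using has_gradientD[OF assms(1) z] by simp
  then show "(g has_derivative (\<lambda>v. \<Sum>b\<in>Basis. (v \<bullet> b) * E b z)) (at z)"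
    by (rule has_derivative_transform_within_open[OF _ assms(2) z]) (use assms(3) in auto)
qed

lemma has_gradient_add:
  "has_gradient f D S \<Longrightarrow> has_gradient g E S \<Longrightarrow> has_gradient (\<lambda>z. f z + g z) (\<lambda>b z. D b z + E b z) S"
  unfolding has_gradient_def
  by (auto simp: distrib_left sum.distrib intro!: has_derivative_add)

lemma has_gradient_cmult:
  assumes "has_gradient f D S" shows "has_gradient (\<lambda>z. c * f z) (\<lambda>b z. c * D b z) S"
  unfolding has_gradient_def
  using has_derivative_mult_right[OF has_gradientD[OF assms], of _ c] by (simp add: sum_distrib_left mult_ac)

lemma has_gradient_line:
  assumes "has_gradient f D S" "z + s *\<^sub>R b \<in> S" "b \<in> Basis"
  shows "((\<lambda>s. f (z + s *\<^sub>R b)) has_real_derivative D b (z + s *\<^sub>R b)) (at s)"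
proof -
  have "((\<lambda>s. f (z + s *\<^sub>R b)) has_derivative
     (\<lambda>h. \<Sum>c\<in>Basis. ((h *\<^sub>R b) \<bullet> c) * D c (z + s *\<^sub>R b))) (at s)"
    by (rule has_derivative_compose[of "\<lambda>s. z + s *\<^sub>R b" "\<lambda>h. h *\<^sub>R b" s UNIV f, OF _ has_gradientD[OF assms(1,2)]])
       (auto intro!: derivative_eq_intros)
  moreover have "(\<Sum>c\<in>Basis. ((h *\<^sub>R b) \<bullet> c) * D c (z + s *\<^sub>R b)) = D b (z + s *\<^sub>R b) * h" for h
  proof -
    have "(\<Sum>c\<in>Basis. ((h *\<^sub>R b) \<bullet> c) * D c (z + s *\<^sub>R b)) =
       (\<Sum>c\<in>Basis. if c = b then D b (z + s *\<^sub>R b) * h else 0)"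
      by (rule sum.cong) (use assms(3) in \<open>auto simp: inner_Basis\<close>)
    then show ?thesis using assms(3) by simp
  qed
  ultimately show ?thesis by (simp add: has_field_derivative_def)
qed

lemma has_gradient_unique:
  assumes "has_gradient f D S" "has_gradient f E S" "z \<in> S" "b \<in> Basis"
  shows "D b z = E b z"
proof -
  have "z + 0 *\<^sub>R b \<in> S" using assms(3) by simp
  from DERIV_unique[OF has_gradient_line[OF assms(1) this assms(4)] has_gradient_line[OF assms(2) this assms(4)]]
  show ?thesis by simp
qed

text \<open>
  Dominated convergence for the difference quotients. The mean value inequality on a ball inside
  \<open>U\<close> bounds the increment of the integrand, which makes twice the dimension times
  \<open>B\<close> a dominating function.
\<close>

lemma has_gradient_integral:
  fixes k :: "'a::euclidean_space \<Rightarrow> 'w \<Rightarrow> real"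
  assumes U: "open U"
    and int: "\<And>z. z \<in> U \<Longrightarrow> integrable M (k z)"
    and der: "\<And>w. w \<in> space M \<Longrightarrow> has_gradient (\<lambda>z. k z w) (\<lambda>b z. k' b z w) U"
    and meas: "\<And>b z. b \<in> Basis \<Longrightarrow> z \<in> U \<Longrightarrow> k' b z \<in> borel_measurable M"
    and dom: "\<And>b z w. b \<in> Basis \<Longrightarrow> z \<in> U \<Longrightarrow> w \<in> space M \<Longrightarrow> \<bar>k' b z w\<bar> \<le> B w"
    and B: "integrable M B"
  shows "has_gradient (\<lambda>z. \<integral>w. k z w \<partial>M) (\<lambda>b z. \<integral>w. k' b z w \<partial>M) U"
  unfolding has_gradient_def
proof
  fix z assume z: "z \<in> U"
  obtain e where e: "e > 0" "ball z e \<subseteq> U" using U z openE by blast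
  have int': "integrable M (k' b z)" if "b \<in> Basis" for b
    by (rule Bochner_Integration.integrable_bound[OF B meas[OF that z]]) (use dom[OF that z] in force)
  have sum_bound: "\<bar>\<Sum>b\<in>Basis. (v \<bullet> b) * k' b y w\<bar> \<le> (real DIM('a) * B w) * norm v"
    if "y \<in> U" "w \<in> space M" for y w and v :: 'a
  proof -
    have "\<bar>\<Sum>b\<in>Basis. (v \<bullet> b) * k' b y w\<bar> \<le> (\<Sum>b\<in>(Basis::'a set). norm v * B w)"
      by (rule order_trans[OF sum_abs sum_mono])
         (use dom that in \<open>auto simp: abs_mult intro!: mult_mono Basis_le_norm\<close>)
    then show ?thesis by (simp add: mult_ac)
  qed
  have incr: "\<bar>k y w - k z w\<bar> \<le> (real DIM('a) * B w) * norm (y - z)"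
    if "y \<in> ball z e" "w \<in> space M" for y w
  proof -
    have "norm (k y w - k z w) \<le> (real DIM('a) * B w) * norm (y - z)"
    proof (rule differentiable_bound[OF convex_ball, of z e "\<lambda>z. k z w" "\<lambda>y v. \<Sum>b\<in>Basis. (v \<bullet> b) * k' b y w"])
      fix x assume "x \<in> ball z e"
      then have x: "x \<in> U" using e by auto
      show "((\<lambda>z. k z w) has_derivative (\<lambda>v. \<Sum>b\<in>Basis. (v \<bullet> b) * k' b x w)) (at x within ball z e)"
        using has_gradientD[OF der[OF that(2)] x] has_derivative_at_withinI by blast
      show "onorm (\<lambda>v. \<Sum>b\<in>Basis. (v \<bullet> b) * k' b x w) \<le> real DIM('a) * B w"
        by (rule onorm_le) (use sum_bound[OF x that(2)] in auto)
    qed (use that e in auto)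
    then show ?thesis by simp
  qed
  let ?D = "\<lambda>v. \<Sum>b\<in>Basis. (v \<bullet> b) * (\<integral>w. k' b z w \<partial>M)"
  let ?q = "\<lambda>y w. (1 / norm (y - z)) * (k y w - (k z w + (\<Sum>b\<in>Basis. ((y - z) \<bullet> b) * k' b z w)))"
  have intS: "integrable M (\<lambda>w. \<Sum>b\<in>Basis. (v \<bullet> b) * k' b z w)" for v
    using int' by (intro Bochner_Integration.integrable_sum integrable_mult_right) auto
  have D_eq: "?D v = (\<integral>w. (\<Sum>b\<in>Basis. (v \<bullet> b) * k' b z w) \<partial>M)" for v
    using int' by (subst Bochner_Integration.integral_sum) (auto intro!: integrable_mult_right)
  have "((\<lambda>z. \<integral>w. k z w \<partial>M) has_derivative ?D) (at z within ball z e)"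
    unfolding has_derivative_within
  proof
    show "bounded_linear ?D"
      by (intro bounded_linear_sum bounded_linear_mult_left[THEN bounded_linear_compose] bounded_linear_inner_left) 
    show "((\<lambda>y. (1 / norm (y - z)) *\<^sub>R ((\<integral>w. k y w \<partial>M) - ((\<integral>w. k z w \<partial>M) + ?D (y - z)))) \<longlongrightarrow> 0)
       (at z within ball z e)"
      unfolding tendsto_at_iff_sequentially
    proof (intro allI impI)
      fix X :: "nat \<Rightarrow> 'a" assume X: "\<forall>i. X i \<in> ball z e - {z}" "X \<longlonglongrightarrow> z"
      have XU: "X i \<in> U" "X i \<in> ball z e" "X i \<noteq> z" for i using X e by auto
      have "(\<lambda>i. \<integral>w. ?q (X i) w \<partial>M) \<longlonglongrightarrow> (\<integral>w. 0 \<partial>M)"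
      proof (rule integral_dominated_convergence[where w="\<lambda>w. 2 * (real DIM('a) * B w)"])
        show "AE w in M. (\<lambda>i. ?q (X i) w) \<longlonglongrightarrow> 0"
        proof (rule AE_I2)
          fix w assume w: "w \<in> space M"
          have "((\<lambda>z. k z w) has_derivative (\<lambda>v. \<Sum>b\<in>Basis. (v \<bullet> b) * k' b z w)) (at z within ball z e)"
            using has_gradientD[OF der[OF w] z] has_derivative_at_withinI by blast
          then have "((\<lambda>y. (1 / norm (y - z)) *\<^sub>R (k y w - (k z w + (\<Sum>b\<in>Basis. ((y - z) \<bullet> b) * k' b z w)))) \<longlongrightarrow> 0)
             (at z within ball z e)" by (simp add: has_derivative_within)
          then show "(\<lambda>i. ?q (X i) w) \<longlonglongrightarrow> 0"
            using X unfolding tendsto_at_iff_sequentially comp_def by simp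
        qed
        show "AE w in M. norm (?q (X i) w) \<le> 2 * (real DIM('a) * B w)" for i
        proof (rule AE_I2)
          fix w assume w: "w \<in> space M"
          have "\<bar>k (X i) w - (k z w + (\<Sum>b\<in>Basis. ((X i - z) \<bullet> b) * k' b z w))\<bar> \<le>
             2 * (real DIM('a) * B w) * norm (X i - z)"
            using incr[OF XU(2)[of i] w] sum_bound[OF z w, of "X i - z"] by linarith
          then show "norm (?q (X i) w) \<le> 2 * (real DIM('a) * B w)"
            using XU(3)[of i] by (simp add: abs_mult field_simps)
        qed
        show "(\<lambda>w. ?q (X i) w) \<in> borel_measurable M" for i
          by (intro borel_measurable_times borel_measurable_const borel_measurable_diff borel_measurable_add
               borel_measurable_integrable[OF int[OF XU(1)]] borel_measurable_integrable[OF int[OF z]]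
               borel_measurable_integrable[OF intS])
        show "integrable M (\<lambda>w. 2 * (real DIM('a) * B w))" using B by simp
      qed simp
      moreover have "(\<integral>w. ?q (X i) w \<partial>M) = (1 / norm (X i - z)) *\<^sub>R ((\<integral>w. k (X i) w \<partial>M) - ((\<integral>w. k z w \<partial>M) + ?D (X i - z)))" for i
        unfolding D_eq using int[OF XU(1)[of i]] int[OF z] intS
        by simp
      ultimately show "((\<lambda>y. (1 / norm (y - z)) *\<^sub>R ((\<integral>w. k y w \<partial>M) - ((\<integral>w. k z w \<partial>M) + ?D (y - z)))) \<circ> X) \<longlonglongrightarrow> 0"
        by (simp only: comp_def Bochner_Integration.integral_zero)
    qed
  qed
  then show "((\<lambda>z. \<integral>w. k z w \<partial>M) has_derivative ?D) (at z)"
    using at_within_open[of z "ball z e"] e by auto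
qed

text \<open>
  The operator valued derivatives in the definition of harmonicity are assembled here from their
  components, and taken apart again in the next lemma. Afterwards only components are used.
\<close>

lemma harmonic_onI:
  fixes f :: "'a::euclidean_space \<Rightarrow> real"
  assumes 1: "has_gradient f D S"
    and 2: "\<And>b. b \<in> Basis \<Longrightarrow> has_gradient (D b) (E b) S"
    and 3: "\<And>b c. b \<in> Basis \<Longrightarrow> c \<in> Basis \<Longrightarrow> continuous_on S (E b c)"
    and 4: "\<And>z. z \<in> S \<Longrightarrow> (\<Sum>b\<in>Basis. E b b z) = 0"
  shows "harmonic_on f S"
proof -
  let ?i = "\<lambda>b::'a. blinfun_inner_left b :: 'a \<Rightarrow>\<^sub>L real"
  define f' where "f' z = (\<Sum>b\<in>Basis. D b z *\<^sub>R ?i b)" for z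
  define f'' where "f'' z = (\<Sum>b\<in>Basis. \<Sum>c\<in>Basis. E b c z *\<^sub>R (blinfun_scaleR_left (?i b) o\<^sub>L ?i c))" for z
  have f': "blinfun_apply (f' z) v = (\<Sum>b\<in>Basis. (v \<bullet> b) * D b z)" for z v
    by (simp add: f'_def blinfun.sum_left blinfun.scaleR_left inner_commute mult_ac)
  have f'': "blinfun_apply (f'' z) v = (\<Sum>b\<in>Basis. (\<Sum>c\<in>Basis. (v \<bullet> c) * E b c z) *\<^sub>R ?i b)" for z v
    by (simp add: f''_def blinfun.sum_left blinfun.scaleR_left inner_commute mult_ac scaleR_sum_left)
  show ?thesis unfolding harmonic_on_def
  proof (intro exI[of _ f'] exI[of _ f''] conjI ballI)
    fix z assume z: "z \<in> S"
    show "(f has_derivative blinfun_apply (f' z)) (at z)"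
      using has_gradientD[OF 1 z] f' by presburger
    have "((\<lambda>z. \<Sum>b\<in>Basis. D b z *\<^sub>R ?i b) has_derivative
        (\<lambda>v. \<Sum>b\<in>Basis. (\<Sum>c\<in>Basis. (v \<bullet> c) * E b c z) *\<^sub>R ?i b)) (at z)"
      by (intro has_derivative_sum has_derivative_scaleR_left has_gradientD[OF 2 z])
    then show "(f' has_derivative blinfun_apply (f'' z)) (at z)"
      unfolding f'_def[abs_def] f''[abs_def] .
    show "(\<Sum>b\<in>Basis. blinfun_apply (blinfun_apply (f'' z) b) b) = 0"
    proof -
      have "blinfun_apply (blinfun_apply (f'' z) b) b = E b b z" if b: "b \<in> Basis" for b
      proof -
        have "blinfun_apply (blinfun_apply (f'' z) b) b =
           (\<Sum>b'\<in>Basis. (\<Sum>c\<in>Basis. (b \<bullet> c) * E b' c z) * (b' \<bullet> b))"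
          by (simp add: f'' blinfun.sum_left blinfun.scaleR_left inner_commute)
        also have "\<dots> = (\<Sum>b'\<in>Basis. if b' = b then E b b z else 0)"
        proof (rule sum.cong)
          fix b' :: 'a assume b': "b' \<in> Basis"
          have "(\<Sum>c\<in>Basis. (b \<bullet> c) * E b' c z) = (\<Sum>c\<in>Basis. if c = b then E b' b z else 0)"
            using b by (intro sum.cong) (auto simp: inner_Basis)
          then have "(\<Sum>c\<in>Basis. (b \<bullet> c) * E b' c z) = E b' b z" using b by simp
          then show "(\<Sum>c\<in>Basis. (b \<bullet> c) * E b' c z) * (b' \<bullet> b) = (if b' = b then E b b z else 0)"
            using b b' by (auto simp: inner_Basis)
        qed simp
        finally show ?thesis using b by simp
      qed
      then show ?thesis using 4[OF z] by simp
    qed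
  next
    show "continuous_on S f''" unfolding f''_def by (intro continuous_intros 3)
  qed
qed

lemma harmonic_onE:
  fixes f :: "'a::euclidean_space \<Rightarrow> real"
  assumes "harmonic_on f S"
  obtains D E where "has_gradient f D S" "\<And>b. b \<in> Basis \<Longrightarrow> has_gradient (D b) (E b) S"
    "\<And>b c. b \<in> Basis \<Longrightarrow> c \<in> Basis \<Longrightarrow> continuous_on S (E b c)"
    "\<And>z. z \<in> S \<Longrightarrow> (\<Sum>b\<in>Basis. E b b z) = 0"
proof -
  obtain f' :: "'a \<Rightarrow> 'a \<Rightarrow>\<^sub>L real" and f'' :: "'a \<Rightarrow> 'a \<Rightarrow>\<^sub>L ('a \<Rightarrow>\<^sub>L real)" where
    1: "\<And>z. z\<in>S \<Longrightarrow> (f has_derivative blinfun_apply (f' z)) (at z)" and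
    2: "\<And>z. z\<in>S \<Longrightarrow> (f' has_derivative blinfun_apply (f'' z)) (at z)" and
    3: "continuous_on S f''" and
    4: "\<And>z. z\<in>S \<Longrightarrow> (\<Sum>b\<in>Basis. blinfun_apply (blinfun_apply (f'' z) b) b) = 0"
    using assms unfolding harmonic_on_def by blast
  have lin: "L v = (\<Sum>b\<in>Basis. (v \<bullet> b) * L b)" if "linear L" for L :: "'a \<Rightarrow> real" and v
  proof -
    have "L v = L (\<Sum>b\<in>Basis. (v \<bullet> b) *\<^sub>R b)" by (simp add: euclidean_representation)
    also have "\<dots> = (\<Sum>b\<in>Basis. (v \<bullet> b) * L b)"
      by (simp only: linear_sum[OF that] linear_scale[OF that] real_scaleR_def)
    finally show ?thesis .
  qed
  show ?thesis
  proof (rule that[of "\<lambda>b z. blinfun_apply (f' z) b" "\<lambda>b c z. blinfun_apply (blinfun_apply (f'' z) c) b"])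
    show "has_gradient f (\<lambda>b z. blinfun_apply (f' z) b) S"
      unfolding has_gradient_def
    proof
      fix z assume z: "z \<in> S"
      have "blinfun_apply (f' z) = (\<lambda>v. \<Sum>b\<in>Basis. (v \<bullet> b) * blinfun_apply (f' z) b)"
        by (rule ext, rule lin, rule bounded_linear.linear, rule blinfun.bounded_linear_right)
      then show "(f has_derivative (\<lambda>v. \<Sum>b\<in>Basis. (v \<bullet> b) * blinfun_apply (f' z) b)) (at z)"
        by (rule back_subst[of "\<lambda>g. (f has_derivative g) (at z)", OF 1[OF z]])
    qed
    fix b :: 'a assume b: "b \<in> Basis"
    show "has_gradient (\<lambda>z. blinfun_apply (f' z) b) (\<lambda>c z. blinfun_apply (blinfun_apply (f'' z) c) b) S"
      unfolding has_gradient_def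
    proof
      fix z assume z: "z \<in> S"
      have l: "linear (\<lambda>v. blinfun_apply (blinfun_apply (f'' z) v) b)"
        by (rule linearI) (simp_all only: blinfun.add_left blinfun.add_right blinfun.scaleR_left blinfun.scaleR_right)
      have "((\<lambda>z. blinfun_apply (f' z) b) has_derivative (\<lambda>v. blinfun_apply (blinfun_apply (f'' z) v) b)) (at z)"
        by (rule bounded_linear.has_derivative[of "\<lambda>L. blinfun_apply L b", OF blinfun.bounded_linear_left 2[OF z]])
      moreover have "(\<lambda>v. blinfun_apply (blinfun_apply (f'' z) v) b) =
         (\<lambda>v. \<Sum>c\<in>Basis. (v \<bullet> c) * blinfun_apply (blinfun_apply (f'' z) c) b)"
        by (rule ext, rule lin[OF l])
      ultimately show "((\<lambda>z. blinfun_apply (f' z) b) has_derivative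
          (\<lambda>v. \<Sum>c\<in>Basis. (v \<bullet> c) * blinfun_apply (blinfun_apply (f'' z) c) b)) (at z)"
        by (rule back_subst[of "\<lambda>g. ((\<lambda>z. blinfun_apply (f' z) b) has_derivative g) (at z)"])
    qed
    fix c :: 'a
    show "continuous_on S (\<lambda>z. blinfun_apply (blinfun_apply (f'' z) c) b)"
      by (intro continuous_intros 3)
  qed (rule 4)
qed

lemma harmonic_on_imp_continuous_on: "harmonic_on f S \<Longrightarrow> continuous_on S f"
  by (erule harmonic_onE) (rule has_gradient_imp_continuous_on)

lemma harmonic_on_cmult:
  assumes "harmonic_on f S" shows "harmonic_on (\<lambda>z. c * f z) S"
  using assms
  by (elim harmonic_onE) (rule harmonic_onI, (rule has_gradient_cmult, assumption)+,
      auto intro!: continuous_intros has_gradient_cmult simp: sum_distrib_left[symmetric])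

lemma harmonic_on_add:
  assumes "harmonic_on f S" "harmonic_on g S" shows "harmonic_on (\<lambda>z. f z + g z) S"
  using assms
  by (elim harmonic_onE) (rule harmonic_onI, (rule has_gradient_add, assumption, assumption)+,
      auto intro!: continuous_intros has_gradient_add simp: sum.distrib)

lemma harmonic_on_diff:
  assumes "harmonic_on f S" "harmonic_on g S" shows "harmonic_on (\<lambda>z. f z - g z) S"
  using harmonic_on_add[OF assms(1) harmonic_on_cmult[OF assms(2), of "-1"]] by simp

lemma harmonic_on_translate:
  fixes f :: "'a::euclidean_space \<Rightarrow> real"
  assumes "harmonic_on f S" and sub: "\<And>z. z \<in> T \<Longrightarrow> z + a \<in> S"
  shows "harmonic_on (\<lambda>z. f (z + a)) T"
proof -
  obtain D E where 1: "has_gradient f D S" and 2: "\<And>b. b \<in> Basis \<Longrightarrow> has_gradient (D b) (E b) S"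
    and 3: "\<And>b c. b \<in> Basis \<Longrightarrow> c \<in> Basis \<Longrightarrow> continuous_on S (E b c)"
    and 4: "\<And>z. z \<in> S \<Longrightarrow> (\<Sum>b\<in>Basis. E b b z) = 0"
    by (rule harmonic_onE[OF assms(1)]) blast
  have *: "has_gradient (\<lambda>z. g (z + a)) (\<lambda>b z. G b (z + a)) T" if "has_gradient g G S" for g G
    unfolding has_gradient_def
  proof
    fix z assume z: "z \<in> T"
    show "((\<lambda>z. g (z + a)) has_derivative (\<lambda>v. \<Sum>b\<in>Basis. (v \<bullet> b) * G b (z + a))) (at z)"
      by (intro has_derivative_compose[of "\<lambda>z. z + a" "\<lambda>v. v" z UNIV g, OF _ has_gradientD[OF that sub[OF z]]])
         (auto intro!: derivative_eq_intros)
  qed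
  show ?thesis
  proof (rule harmonic_onI[OF *[OF 1] *[OF 2]])
    fix b c :: 'a assume bc: "b \<in> Basis" "c \<in> Basis"
    show "continuous_on T (\<lambda>z. E b c (z + a))"
      by (rule continuous_on_compose2[OF 3[OF bc]]) (use sub in \<open>auto intro!: continuous_intros\<close>)
  qed (use 4 sub in auto)
qed

section \<open>Mean value inequalities for powers of harmonic functions\<close>

lemma has_gradient_real_iff:
  "has_gradient f D S \<longleftrightarrow> (\<forall>x\<in>S. (f has_real_derivative D 1 x) (at x))" for f :: "real \<Rightarrow> real"
  by (simp add: has_gradient_def has_field_derivative_def mult.commute[of _ "D 1 _"])

lemma integrable_continuous_supported:
  fixes f :: "'a::euclidean_space \<Rightarrow> real"
  assumes "compact K" "continuous_on K f" "\<And>v. v \<notin> K \<Longrightarrow> f v = 0"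
  shows "integrable lborel f"
proof -
  have "(\<lambda>x. indicator K x *\<^sub>R f x) = f" using assms(3) by (auto simp: indicator_def fun_eq_iff)
  then show ?thesis using borel_integrable_compact[OF assms(1,2)] by simp
qed

lemma integral_lborel_translate:
  fixes f :: "'a::euclidean_space \<Rightarrow> real"
  assumes "integrable lborel f"
  shows "integrable lborel (\<lambda>v. f (v + c))" "(\<integral>v. f (v + c) \<partial>lborel) = (\<integral>v. f v \<partial>lborel)"
proof -
  have f: "f \<in> borel_measurable borel" using assms by auto
  have m: "(+) c \<in> measurable lborel borel" by measurable
  have e: "(\<lambda>v. f (v + c)) = (\<lambda>v. f ((+) c v))" by (simp add: add.commute)
  show "integrable lborel (\<lambda>v. f (v + c))"
    unfolding e using integrable_distr_eq[OF m f] assms by (simp add: lborel_distr_plus)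
  show "(\<integral>v. f (v + c) \<partial>lborel) = (\<integral>v. f v \<partial>lborel)"
    unfolding e using integral_distr[OF m f] by (simp add: lborel_distr_plus)
qed

text \<open>
  The integral of \<open>F (v + h b)\<close> over \<open>v\<close> does not depend on
  \<open>h\<close>; its derivative at \<open>h = 0\<close> is the integral of the partial
  derivative.
\<close>

lemma integral_partial_derivative_zero:
  fixes F :: "'a::euclidean_space \<Rightarrow> real"
  assumes grad: "has_gradient F F' UNIV" and b: "b \<in> Basis"
    and cont: "continuous_on (cball 0 R) (F' b)"
    and supp: "\<And>v. v \<notin> cball 0 R \<Longrightarrow> F v = 0 \<and> F' b v = 0"
  shows "(\<integral>v. F' b v \<partial>lborel) = 0"
proof -
  have intF: "integrable lborel F"
    by (rule integrable_continuous_supported[OF compact_cball[of 0 R]])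
       (use supp in \<open>auto intro: continuous_on_subset[OF has_gradient_imp_continuous_on[OF grad]]\<close>)
  have intF': "integrable lborel (F' b)"
    by (rule integrable_continuous_supported[OF compact_cball[of 0 R] cont]) (use supp in auto)
  have "compact (F' b ` cball 0 R)" by (intro compact_continuous_image cont compact_cball)
  then obtain B where B: "\<And>v. v \<in> cball 0 R \<Longrightarrow> \<bar>F' b v\<bar> \<le> B"
    by (metis compact_imp_bounded bounded_iff imageI real_norm_def)
  have "has_gradient (\<lambda>h. \<integral>v. F (v + h *\<^sub>R b) \<partial>lborel) (\<lambda>_ h. \<integral>v. F' b (v + h *\<^sub>R b) \<partial>lborel) {-1<..<1}"
  proof (rule has_gradient_integral[where B="\<lambda>v. indicator (cball 0 (R + 1)) v *\<^sub>R \<bar>B\<bar>"])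
    fix h :: real and v :: 'a and c :: real assume h: "h \<in> {-1<..<1}"
    show "integrable lborel (\<lambda>v. F (v + h *\<^sub>R b))" by (rule integral_lborel_translate[OF intF])
    show "(\<lambda>v. F' b (v + h *\<^sub>R b)) \<in> borel_measurable lborel"
      using integral_lborel_translate[OF intF'] by blast
    show "\<bar>F' b (v + h *\<^sub>R b)\<bar> \<le> indicator (cball 0 (R + 1)) v *\<^sub>R \<bar>B\<bar>"
    proof (cases "v \<in> cball 0 (R + 1)")
      case True
      then show ?thesis using B[of "v + h *\<^sub>R b"] supp[of "v + h *\<^sub>R b"] 
        by (cases "v + h *\<^sub>R b \<in> cball 0 R") auto
    next
      case False
      have "norm v - norm (h *\<^sub>R b) \<le> norm (v + h *\<^sub>R b)"
        using norm_triangle_ineq4[of "v + h *\<^sub>R b" "h *\<^sub>R b"] by simp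
      then have "v + h *\<^sub>R b \<notin> cball 0 R" using False h b by (auto simp: norm_Basis)
      then show ?thesis using supp by simp
    qed
  next
    fix v :: 'a
    show "has_gradient (\<lambda>h. F (v + h *\<^sub>R b)) (\<lambda>_ h. F' b (v + h *\<^sub>R b)) {-1<..<1}"
      unfolding has_gradient_real_iff using has_gradient_line[OF grad] b by simp
  qed (simp, rule borel_integrable_compact, simp_all)
  then have "((\<lambda>h. \<integral>v. F v \<partial>lborel) has_real_derivative (\<integral>v. F' b v \<partial>lborel)) (at 0)"
    unfolding has_gradient_real_iff integral_lborel_translate(2)[OF intF] 
    by (auto dest: bspec[of _ _ 0])
  then show ?thesis using DERIV_const DERIV_unique by blast
qed

lemma DERIV_square_pos_part:
  "((\<lambda>x::real. (max 0 x)\<^sup>2) has_real_derivative 2 * max 0 x) (at x)"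
proof (cases "x = 0")
  case False
  show ?thesis
  proof (cases "x > 0")
    case True
    have "((\<lambda>x. x\<^sup>2) has_real_derivative 2 * max 0 x) (at x)"
      using True by (auto intro!: derivative_eq_intros)
    then show ?thesis
      by (rule has_field_derivative_transform_within_open[where S="{0<..}"]) (use True in auto)
  next
    case f: False
    have "((\<lambda>x. 0) has_real_derivative 2 * max 0 x) (at x)"
      using False f by (auto intro!: derivative_eq_intros)
    then show ?thesis
      by (rule has_field_derivative_transform_within_open[where S="{..<0}"]) (use False f in auto)
  qed
next
  case True
  have "((\<lambda>h::real. (max 0 h)\<^sup>2 / h) \<longlongrightarrow> 0) (at 0)"
  proof (rule Lim_null_comparison[where g="\<lambda>h. \<bar>h\<bar>"])
    show "\<forall>\<^sub>F h in at 0. norm ((max 0 h)\<^sup>2 / h) \<le> \<bar>h\<bar>"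
      by (rule always_eventually) (auto simp: max_def power2_eq_square)
  qed (auto intro!: tendsto_eq_intros)
  then show ?thesis using True by (simp add: DERIV_def)
qed

text \<open>
  This exhibits the field \<open>v bump v\<close> as the gradient of a \<open>C\<^sup>1\<close>
  function of compact support, which is what turns the radial derivative of a weighted mean into a
  divergence.
\<close>

lemma has_gradient_bump:
  "has_gradient (\<lambda>v::'a::euclidean_space. (max 0 (1 - (norm v)\<^sup>2))\<^sup>2)
     (\<lambda>b v. - 4 * (v \<bullet> b) * max 0 (1 - (norm v)\<^sup>2)) UNIV"
  unfolding has_gradient_def
proof
  fix v :: 'a
  have "((\<lambda>v. 1 - v \<bullet> v) has_derivative (\<lambda>h. - 2 * (v \<bullet> h))) (at v)"
    by (auto intro!: derivative_eq_intros simp: inner_commute)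
  from has_derivative_compose[OF this, of "\<lambda>x. (max 0 x)\<^sup>2" "(*) (2 * max 0 (1 - v \<bullet> v))"]
  have "((\<lambda>v. (max 0 (1 - v \<bullet> v))\<^sup>2) has_derivative (\<lambda>h. 2 * max 0 (1 - v \<bullet> v) * (- 2 * (v \<bullet> h)))) (at v)"
    using DERIV_square_pos_part[of "1 - v \<bullet> v"] by (simp add: has_field_derivative_def)
  moreover have "2 * max 0 (1 - v \<bullet> v) * (- 2 * (v \<bullet> h)) =
      (\<Sum>b\<in>Basis. (h \<bullet> b) * (- 4 * (v \<bullet> b) * max 0 (1 - v \<bullet> v)))" for h
    by (subst euclidean_inner[of v h]) (simp add: sum_distrib_left mult_ac)
  ultimately show "((\<lambda>v. (max 0 (1 - (norm v)\<^sup>2))\<^sup>2) has_derivative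
     (\<lambda>h. \<Sum>b\<in>Basis. (h \<bullet> b) * (- 4 * (v \<bullet> b) * max 0 (1 - (norm v)\<^sup>2)))) (at v)"
    by (simp only: power2_norm_eq_inner)
qed

abbreviation bump :: "'a::euclidean_space \<Rightarrow> real" where
  "bump v \<equiv> max 0 (1 - (norm v)\<^sup>2)"

lemma bump_outside: "v \<notin> cball 0 1 \<Longrightarrow> bump v = 0"
proof -
  assume "v \<notin> cball 0 1"
  then have "1 < norm v" by simp
  then have "1 \<le> (norm v)\<^sup>2" by (metis less_imp_le one_le_power)
  then show ?thesis by simp
qed

text \<open>
  The divergence of \<open>(bump v)\<^sup>2 \<nabla>g (w + \<rho> v)\<close>, where \<open>D\<close>
  is the gradient of \<open>g\<close>, has integral zero. Its second order part is a multiple of the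
  Laplacian of \<open>g\<close> and vanishes; the first order part is \<open>-4\<close> times the
  integrand below.
\<close>

lemma integral_radial_derivative_zero:
  fixes D :: "'a::euclidean_space \<Rightarrow> 'a \<Rightarrow> real"
  assumes D: "\<And>b. b \<in> Basis \<Longrightarrow> has_gradient (D b) (E b) S"
    and E: "\<And>b c. b \<in> Basis \<Longrightarrow> c \<in> Basis \<Longrightarrow> continuous_on S (E b c)"
    and lap: "\<And>z. z \<in> S \<Longrightarrow> (\<Sum>b\<in>Basis. E b b z) = 0"
    and S: "cball w r \<subseteq> S" and \<rho>: "\<bar>\<rho>\<bar> < r"
  shows "(\<integral>v. bump v * (\<Sum>b\<in>Basis. (v \<bullet> b) * D b (w + \<rho> *\<^sub>R v)) \<partial>lborel) = 0"
proof -
  have in_S: "w + \<rho> *\<^sub>R v \<in> S" if "v \<in> cball 0 1" for v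
  proof -
    have "\<bar>\<rho>\<bar> * norm v \<le> r * 1" by (rule mult_mono) (use that \<rho> in auto)
    then show ?thesis using S by (auto simp: dist_norm subset_iff)
  qed
  have cD: "continuous_on (cball 0 1) (\<lambda>v. D b (w + \<rho> *\<^sub>R v))" if "b \<in> Basis" for b
    by (rule continuous_on_compose2[OF has_gradient_imp_continuous_on[OF D[OF that]]])
       (use in_S in \<open>auto intro!: continuous_intros\<close>)
  have cE: "continuous_on (cball 0 1) (\<lambda>v. E b c (w + \<rho> *\<^sub>R v))" if "b \<in> Basis" "c \<in> Basis" for b c
    by (rule continuous_on_compose2[OF E[OF that]])
       (use in_S in \<open>auto intro!: continuous_intros\<close>)
  \<comment> \<open>The partial derivative in direction \<open>c\<close> of component \<open>b\<close> of the field.\<close>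
  define F' where "F' b c v = \<rho> * E b c (w + \<rho> *\<^sub>R v) * (bump v)\<^sup>2 + D b (w + \<rho> *\<^sub>R v) * (- 4 * (v \<bullet> c) * bump v)" for b c v
  have F'0: "F' b c v = 0" if "v \<notin> cball 0 1" for b c v
    using bump_outside[OF that] by (simp add: F'_def)
  have cF': "continuous_on (cball 0 1) (F' b c)" if "b \<in> Basis" "c \<in> Basis" for b c
    unfolding F'_def using cD cE that by (intro continuous_intros) auto
  have grad: "has_gradient (\<lambda>v. D b (w + \<rho> *\<^sub>R v) * (bump v)\<^sup>2) (F' b) UNIV" if b: "b \<in> Basis" for b
    unfolding has_gradient_def
  proof
    fix v :: 'a
    show "((\<lambda>v. D b (w + \<rho> *\<^sub>R v) * (bump v)\<^sup>2) has_derivative (\<lambda>h. \<Sum>c\<in>Basis. (h \<bullet> c) * F' b c v)) (at v)"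
    proof (cases "v \<in> cball 0 1")
      case True
      have "((\<lambda>v. D b (w + \<rho> *\<^sub>R v)) has_derivative (\<lambda>h. \<Sum>c\<in>Basis. ((\<rho> *\<^sub>R h) \<bullet> c) * E b c (w + \<rho> *\<^sub>R v))) (at v)"
        by (rule has_derivative_compose[of "\<lambda>v. w + \<rho> *\<^sub>R v" "\<lambda>h. \<rho> *\<^sub>R h" v UNIV "D b", OF _ has_gradientD[OF D[OF b] in_S[OF True]]])
           (auto intro!: derivative_eq_intros)
      from has_derivative_mult[OF this has_gradientD[OF has_gradient_bump UNIV_I]]
      show ?thesis
        by (rule back_subst[of "\<lambda>g. (_ has_derivative g) (at v)"])
           (auto simp: F'_def fun_eq_iff sum_distrib_left sum_distrib_right sum.distrib[symmetric] algebra_simps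
             intro!: sum.cong)
    next
      case False
      have "((\<lambda>v. 0) has_derivative (\<lambda>h. \<Sum>c\<in>Basis. (h \<bullet> c) * F' b c v)) (at v)"
        using F'0[OF False] by simp
      then show ?thesis
        by (rule has_derivative_transform_within_open[of _ _ _ UNIV "- cball 0 1"])
           (use False bump_outside in \<open>auto simp: bump_outside\<close>)
    qed
  qed
  have zero: "(\<integral>v. F' b b v \<partial>lborel) = 0" if "b \<in> Basis" for b
    by (rule integral_partial_derivative_zero[OF grad[OF that] that, where R=1])
       (use cF' F'0 bump_outside that in auto)
  have int: "integrable lborel (F' b b)" if "b \<in> Basis" for b
    by (rule integrable_continuous_supported[OF compact_cball cF']) (use F'0 that in auto)
  have "(\<Sum>b\<in>Basis. F' b b v) = - 4 * (bump v * (\<Sum>b\<in>Basis. (v \<bullet> b) * D b (w + \<rho> *\<^sub>R v)))" for v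
  proof (cases "v \<in> cball 0 1")
    case True
    have "(\<Sum>b\<in>Basis. F' b b v) = (\<rho> * (bump v)\<^sup>2) * (\<Sum>b\<in>Basis. E b b (w + \<rho> *\<^sub>R v))
        + - 4 * (bump v * (\<Sum>b\<in>Basis. (v \<bullet> b) * D b (w + \<rho> *\<^sub>R v)))"
      unfolding F'_def sum.distrib sum_distrib_left by (intro arg_cong2[where f="(+)"] sum.cong) (simp_all only: mult_ac)
    then show ?thesis using lap[OF in_S[OF True]] by simp
  next
    case False
    then show ?thesis using F'0 bump_outside[OF False] by simp
  qed
  then have "(\<integral>v. - 4 * (bump v * (\<Sum>b\<in>Basis. (v \<bullet> b) * D b (w + \<rho> *\<^sub>R v))) \<partial>lborel) = (\<integral>v. (\<Sum>b\<in>Basis. F' b b v) \<partial>lborel)"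
    by presburger
  also have "\<dots> = 0" using int zero by (subst Bochner_Integration.integral_sum) auto
  finally show ?thesis by (simp only: integral_mult_right_zero)
qed

text \<open>
  The weighted mean over the ball of radius \<open>\<rho>\<close> has derivative zero in
  \<open>\<rho>\<close> by the preceding lemma. Admitting negative \<open>\<rho>\<close> makes
  \<open>\<rho> = 0\<close> an interior point of the parameter interval, and there the mean is
  \<open>g w\<close> times the total weight.
\<close>

lemma harmonic_mean_value:
  fixes g :: "'a::euclidean_space \<Rightarrow> real"
  assumes harm: "harmonic_on g S" and S: "cball w r \<subseteq> S" and \<rho>: "\<bar>\<rho>\<bar> < r"
  shows "(\<integral>v. bump v * g (w + \<rho> *\<^sub>R v) \<partial>lborel) = g w * integral\<^sup>L lborel (bump :: 'a \<Rightarrow> real)"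
proof -
  obtain D E where D: "has_gradient g D S" and E: "\<And>b. b \<in> Basis \<Longrightarrow> has_gradient (D b) (E b) S"
    "\<And>b c. b \<in> Basis \<Longrightarrow> c \<in> Basis \<Longrightarrow> continuous_on S (E b c)"
    "\<And>z. z \<in> S \<Longrightarrow> (\<Sum>b\<in>Basis. E b b z) = 0"
    by (rule harmonic_onE[OF harm]) blast
  have in_S: "w + \<rho> *\<^sub>R v \<in> cball w r" if "v \<in> cball 0 1" "\<bar>\<rho>\<bar> < r" for v \<rho>
  proof -
    have "\<bar>\<rho>\<bar> * norm v \<le> r * 1" by (rule mult_mono) (use that in auto)
    then show ?thesis using S by (auto simp: dist_norm subset_iff)
  qed
  have "\<exists>B. \<forall>z\<in>cball w r. \<bar>D b z\<bar> \<le> B" if "b \<in> Basis" for b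
  proof -
    have "compact (D b ` cball w r)"
      by (intro compact_continuous_image continuous_on_subset[OF has_gradient_imp_continuous_on[OF E(1)[OF that]] S] compact_cball)
    then show ?thesis by (metis compact_imp_bounded bounded_iff imageI real_norm_def)
  qed
  then obtain B where B: "\<And>b z. b \<in> Basis \<Longrightarrow> z \<in> cball w r \<Longrightarrow> \<bar>D b z\<bar> \<le> B b" by metis
  have cg: "continuous_on (cball 0 1) (\<lambda>v. bump v * g (w + \<rho> *\<^sub>R v))" if "\<bar>\<rho>\<bar> < r" for \<rho>
    by (intro continuous_intros continuous_on_compose2[OF has_gradient_imp_continuous_on[OF D]])
       (use in_S[OF _ that] S in auto)
  have cD: "continuous_on (cball 0 1) (\<lambda>v. bump v * (\<Sum>b\<in>Basis. (v \<bullet> b) * D b (w + \<rho> *\<^sub>R v)))" if "\<bar>\<rho>\<bar> < r" for \<rho>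
    by (intro continuous_intros continuous_on_compose2[OF has_gradient_imp_continuous_on[OF E(1)]])
       (use in_S[OF _ that] S in auto)
  have "has_gradient (\<lambda>\<rho>. \<integral>v. bump v * g (w + \<rho> *\<^sub>R v) \<partial>lborel)
      (\<lambda>_ \<rho>. \<integral>v. bump v * (\<Sum>b\<in>Basis. (v \<bullet> b) * D b (w + \<rho> *\<^sub>R v)) \<partial>lborel) {-r<..<r}"
  proof (rule has_gradient_integral[where B="\<lambda>v. indicator (cball 0 1) v *\<^sub>R (\<Sum>b\<in>(Basis::'a set). \<bar>B b\<bar>)"])
    fix \<rho> v assume "\<rho> \<in> {-r<..<r}"
    then have \<rho>: "\<bar>\<rho>\<bar> < r" by auto
    show "integrable lborel (\<lambda>v. bump v * g (w + \<rho> *\<^sub>R v))"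
      by (rule integrable_continuous_supported[OF compact_cball cg[OF \<rho>]]) (simp add: bump_outside)
    show "(\<lambda>v. bump v * (\<Sum>b\<in>Basis. (v \<bullet> b) * D b (w + \<rho> *\<^sub>R v))) \<in> borel_measurable lborel"
      by (rule borel_measurable_integrable,
          rule integrable_continuous_supported[OF compact_cball cD[OF \<rho>]]) (simp add: bump_outside)
    show "\<bar>bump v * (\<Sum>b\<in>Basis. (v \<bullet> b) * D b (w + \<rho> *\<^sub>R v))\<bar> \<le> indicator (cball 0 1) v *\<^sub>R (\<Sum>b\<in>Basis. \<bar>B b\<bar>)"
    proof (cases "v \<in> cball 0 1")
      case True
      have "\<bar>\<Sum>b\<in>Basis. (v \<bullet> b) * D b (w + \<rho> *\<^sub>R v)\<bar> \<le> (\<Sum>b\<in>Basis. \<bar>B b\<bar>)"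
      proof (rule order_trans[OF sum_abs sum_mono])
        fix b :: 'a assume b: "b \<in> Basis"
        have "\<bar>v \<bullet> b\<bar> * \<bar>D b (w + \<rho> *\<^sub>R v)\<bar> \<le> 1 * \<bar>B b\<bar>"
        proof (rule mult_mono)
          show "\<bar>v \<bullet> b\<bar> \<le> 1" using Basis_le_norm[OF b, of v] True by simp
          show "\<bar>D b (w + \<rho> *\<^sub>R v)\<bar> \<le> \<bar>B b\<bar>" using B[OF b in_S[OF True \<rho>]] by linarith
        qed auto
        then show "\<bar>(v \<bullet> b) * D b (w + \<rho> *\<^sub>R v)\<bar> \<le> \<bar>B b\<bar>" by (simp add: abs_mult)
      qed
      moreover have "\<bar>bump v\<bar> \<le> 1" by simp
      ultimately have "\<bar>bump v\<bar> * \<bar>\<Sum>b\<in>Basis. (v \<bullet> b) * D b (w + \<rho> *\<^sub>R v)\<bar> \<le> 1 * (\<Sum>b\<in>Basis. \<bar>B b\<bar>)"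
        by (intro mult_mono) auto
      then show ?thesis using True by (simp add: abs_mult)
    next
      case False
      then show ?thesis using bump_outside[OF False] by simp
    qed
  next
    fix v :: 'a
    show "has_gradient (\<lambda>\<rho>. bump v * g (w + \<rho> *\<^sub>R v)) (\<lambda>_ \<rho>. bump v * (\<Sum>b\<in>Basis. (v \<bullet> b) * D b (w + \<rho> *\<^sub>R v))) {-r<..<r}"
      unfolding has_gradient_real_iff
    proof
      fix \<rho> assume "\<rho> \<in> {-r<..<r}"
      then have \<rho>: "\<bar>\<rho>\<bar> < r" by auto
      show "((\<lambda>\<rho>. bump v * g (w + \<rho> *\<^sub>R v)) has_real_derivative bump v * (\<Sum>b\<in>Basis. (v \<bullet> b) * D b (w + \<rho> *\<^sub>R v))) (at \<rho>)"
      proof (cases "v \<in> cball 0 1")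
        case True
        then have "w + \<rho> *\<^sub>R v \<in> S" using in_S[OF True \<rho>] S by auto
        then have "((\<lambda>\<rho>. g (w + \<rho> *\<^sub>R v)) has_derivative (\<lambda>h. \<Sum>b\<in>Basis. ((h *\<^sub>R v) \<bullet> b) * D b (w + \<rho> *\<^sub>R v))) (at \<rho>)"
          by (intro has_derivative_compose[of "\<lambda>\<rho>. w + \<rho> *\<^sub>R v" "\<lambda>h. h *\<^sub>R v" \<rho> UNIV g, OF _ has_gradientD[OF D]])
             (auto intro!: derivative_eq_intros)
        then have "((\<lambda>\<rho>. g (w + \<rho> *\<^sub>R v)) has_real_derivative (\<Sum>b\<in>Basis. (v \<bullet> b) * D b (w + \<rho> *\<^sub>R v))) (at \<rho>)"
          unfolding has_field_derivative_def
          by (rule back_subst[of "\<lambda>g. (_ has_derivative g) (at \<rho>)"]) (simp add: fun_eq_iff sum_distrib_left mult_ac)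
        then show ?thesis by (rule DERIV_cmult)
      next
        case False
        then show ?thesis using bump_outside[OF False] by simp
      qed
    qed
  qed (simp, rule borel_integrable_compact, simp_all)
  then have deriv: "((\<lambda>\<rho>. \<integral>v. bump v * g (w + \<rho> *\<^sub>R v) \<partial>lborel) has_real_derivative 0) (at \<rho>)"
    if "\<rho> \<in> {-r<..<r}" for \<rho>
    using integral_radial_derivative_zero[OF E S, of \<rho>] that unfolding has_gradient_real_iff by force
  have "(\<integral>v. bump v * g (w + \<rho> *\<^sub>R v) \<partial>lborel) = (\<integral>v. bump v * g (w + 0 *\<^sub>R v) \<partial>lborel)"
    by (rule DERIV_isconst3[of "-r" r \<rho> 0, OF _ _ _ deriv]) (use \<rho> in auto)
  then show ?thesis by (simp add: mult.commute)
qed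

lemma bump_integrable: "integrable lborel (bump :: 'a::euclidean_space \<Rightarrow> real)"
  by (rule integrable_continuous_supported[OF compact_cball[of 0 1]]) (auto intro!: continuous_intros bump_outside)

lemma bump_integral_pos: "0 < integral\<^sup>L lborel (bump :: 'a::euclidean_space \<Rightarrow> real)"
proof -
  have "3/4 * indicator (ball 0 (1/2)) v \<le> bump v" for v :: 'a
  proof (cases "v \<in> ball 0 (1/2)")
    case True
    then have "(norm v)\<^sup>2 \<le> (1/2)\<^sup>2" by (intro power_mono) auto
    then show ?thesis using True by (simp add: power2_eq_square)
  qed simp
  then have "(\<integral>v. 3/4 * indicator (ball 0 (1/2)) (v::'a) \<partial>lborel) \<le> integral\<^sup>L lborel (bump :: 'a \<Rightarrow> real)"
    by (intro integral_mono bump_integrable integrable_mult_right integrable_real_indicator)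
       (auto simp: emeasure_ball)
  moreover have "(\<integral>v. 3/4 * indicator (ball 0 (1/2)) (v::'a) \<partial>lborel) = 3/4 * measure lborel (ball (0::'a) (1/2))"
    by simp
  moreover have "0 < 3/4 * measure lborel (ball (0::'a) (1/2))" by simp
  ultimately show ?thesis by linarith
qed

text \<open>
  The weight is at most \<open>1\<close>; averaging over half the radius keeps the parameter
  strictly inside the range allowed by the mean value identity.
\<close>

lemma harmonic_mean_value_inequality:
  obtains C :: real where "C > 0"
    "\<And>(g :: 'a::euclidean_space \<Rightarrow> real) S w r. harmonic_on g S \<Longrightarrow> cball w r \<subseteq> S \<Longrightarrow> 0 < r \<Longrightarrow>
       ennreal \<bar>g w\<bar> \<le> ennreal (C / r ^ DIM('a)) * (\<integral>\<^sup>+u\<in>ball w r. ennreal \<bar>g u\<bar> \<partial>lborel)"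
proof -
  define I where "I = integral\<^sup>L lborel (bump :: 'a \<Rightarrow> real)"
  have I: "I > 0" unfolding I_def by (rule bump_integral_pos)
  show thesis
  proof (rule that[of "2 ^ DIM('a) / I"])
    fix g :: "'a \<Rightarrow> real" and S w and r :: real assume harm: "harmonic_on g S" and S: "cball w r \<subseteq> S" and r: "0 < r"
    define \<rho> where "\<rho> = r / 2"
    have \<rho>: "0 < \<rho>" "\<bar>\<rho>\<bar> < r" using r by (auto simp: \<rho>_def)
    define G where "G u = ennreal (indicator (cball w \<rho>) u *\<^sub>R \<bar>g u\<bar>)" for u
    have cont: "continuous_on (cball w \<rho>) g"
      using S \<rho> by (intro continuous_on_subset[OF harmonic_on_imp_continuous_on[OF harm]]) auto
    have G: "G \<in> borel_measurable borel" unfolding G_def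
      by (intro measurable_ennreal measurable_compose[OF borel_measurable_continuous_on_indicator measurable_ennreal] continuous_intros cont) auto
    have in_ball: "w + \<rho> *\<^sub>R v \<in> cball w \<rho> \<longleftrightarrow> v \<in> cball 0 1" for v
      using \<rho> by (auto simp: dist_norm)
    have "integrable lborel (\<lambda>v. bump v * g (w + \<rho> *\<^sub>R v))"
      by (rule integrable_continuous_supported[OF compact_cball[of 0 1]])
         (use bump_outside in_ball in \<open>auto intro!: continuous_intros continuous_on_compose2[OF cont] simp del: mem_cball\<close>)
    then have "ennreal (norm (\<integral>v. bump v * g (w + \<rho> *\<^sub>R v) \<partial>lborel)) \<le> (\<integral>\<^sup>+v. norm (bump v * g (w + \<rho> *\<^sub>R v)) \<partial>lborel)"
      by (rule integral_norm_bound_ennreal)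
    also have "\<dots> \<le> (\<integral>\<^sup>+v. G (w + \<rho> *\<^sub>R v) \<partial>lborel)"
    proof (rule nn_integral_mono)
      fix v :: 'a
      have b: "\<bar>bump v\<bar> \<le> 1" by simp
      show "ennreal (norm (bump v * g (w + \<rho> *\<^sub>R v))) \<le> G (w + \<rho> *\<^sub>R v)"
      proof (cases "v \<in> cball 0 1")
        case True
        have "\<bar>bump v\<bar> * \<bar>g (w + \<rho> *\<^sub>R v)\<bar> \<le> 1 * \<bar>g (w + \<rho> *\<^sub>R v)\<bar>"
          by (intro mult_right_mono b) auto
        then show ?thesis using True in_ball[of v] unfolding G_def by (simp add: abs_mult del: mem_cball)
      next
        case False
        show ?thesis using bump_outside[OF False] by simp
      qed
    qed
    finally have 1: "ennreal (\<bar>g w\<bar> * I) \<le> (\<integral>\<^sup>+v. G (w + \<rho> *\<^sub>R v) \<partial>lborel)"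
      unfolding harmonic_mean_value[OF harm S \<rho>(2)] I_def[symmetric] using I by (simp add: abs_mult)
    have "(\<integral>\<^sup>+u. G u \<partial>lborel) = (\<integral>\<^sup>+u. G u \<partial>density (distr lborel borel (\<lambda>x. w + \<rho> *\<^sub>R x)) (\<lambda>_. ennreal (\<bar>\<rho>\<bar> ^ DIM('a))))"
      using lborel_affine[of \<rho> w] \<rho> by simp
    also have "\<dots> = (\<integral>\<^sup>+v. ennreal (\<rho> ^ DIM('a)) * G (w + \<rho> *\<^sub>R v) \<partial>lborel)"
      using G \<rho> by (simp add: nn_integral_density nn_integral_distr)
    also have "\<dots> = ennreal (\<rho> ^ DIM('a)) * (\<integral>\<^sup>+v. G (w + \<rho> *\<^sub>R v) \<partial>lborel)"
      by (rule nn_integral_cmult) (use G in measurable)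
    finally have 2: "(\<integral>\<^sup>+u. G u \<partial>lborel) = ennreal (\<rho> ^ DIM('a)) * (\<integral>\<^sup>+v. G (w + \<rho> *\<^sub>R v) \<partial>lborel)" .
    have "ennreal (\<rho> ^ DIM('a) * (\<bar>g w\<bar> * I)) \<le> (\<integral>\<^sup>+u. G u \<partial>lborel)"
      unfolding 2 using mult_left_mono[OF 1, of "ennreal (\<rho> ^ DIM('a))"] \<rho> I by (simp add: ennreal_mult)
    also have "\<dots> \<le> (\<integral>\<^sup>+u\<in>ball w r. ennreal \<bar>g u\<bar> \<partial>lborel)"
      by (rule nn_integral_mono) (use \<rho> in \<open>auto simp: G_def indicator_def\<close>)
    finally have 3: "ennreal (\<rho> ^ DIM('a) * (\<bar>g w\<bar> * I)) \<le> (\<integral>\<^sup>+u\<in>ball w r. ennreal \<bar>g u\<bar> \<partial>lborel)" .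
    have "ennreal \<bar>g w\<bar> = ennreal (2 ^ DIM('a) / I / r ^ DIM('a)) * ennreal (\<rho> ^ DIM('a) * (\<bar>g w\<bar> * I))"
      using I r by (subst ennreal_mult[symmetric]) (auto simp: \<rho>_def power_divide)
    also have "\<dots> \<le> ennreal (2 ^ DIM('a) / I / r ^ DIM('a)) * (\<integral>\<^sup>+u\<in>ball w r. ennreal \<bar>g u\<bar> \<partial>lborel)"
      by (rule mult_left_mono[OF 3]) simp
    finally show "ennreal \<bar>g w\<bar> \<le> \<dots>" .
  qed (use I in simp)
qed

lemma ennreal_mult3:
  "0 \<le> a \<Longrightarrow> 0 \<le> b \<Longrightarrow> 0 \<le> c \<Longrightarrow> ennreal a * (ennreal b * (ennreal c * J)) = ennreal (a * b * c) * J"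
  by (simp add: ennreal_mult mult.assoc)

text \<open>
  For \<open>p < 1\<close> the power \<open>p\<close> is not convex, so the case \<open>p =
  1\<close> does not give the others by Jensen's inequality; an argument of Hardy and Littlewood
  takes its place. Let \<open>z\<close> maximise \<open>\<bar>g\<bar> powr p\<close> times the
  \<open>N\<close>-th power of the distance to the boundary sphere, with \<open>N\<close> the
  dimension. On the ball about \<open>z\<close> of half that distance \<open>\<bar>g\<bar>\<close>
  is at most a constant times its value at \<open>z\<close>, so that \<open>\<bar>g\<bar> =
  \<bar>g\<bar> powr (1 - p) * \<bar>g\<bar> powr p\<close> is at most a constant times
  \<open>\<bar>g z\<bar> powr (1 - p) * \<bar>g\<bar> powr p\<close>. Inserted in the mean value
  inequality at \<open>z\<close>, the power of \<open>\<bar>g z\<bar>\<close> moves to the left-hand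
  side; maximality of \<open>z\<close> transfers the result to the centre \<open>w\<close>.
\<close>

lemma harmonic_power_mean_value_inequality:
  assumes p: "0 < p" "p \<le> 1"
  obtains C :: real where "C > 0"
    "\<And>(g :: 'a::euclidean_space \<Rightarrow> real) S w r. harmonic_on g S \<Longrightarrow> cball w r \<subseteq> S \<Longrightarrow> 0 < r \<Longrightarrow>
       ennreal (\<bar>g w\<bar> powr p) \<le> ennreal (C / r ^ DIM('a)) * (\<integral>\<^sup>+u\<in>ball w r. ennreal (\<bar>g u\<bar> powr p) \<partial>lborel)"
proof -
  obtain C0 where C0: "C0 > 0" and mv:
    "\<And>(g :: 'a \<Rightarrow> real) S w r. harmonic_on g S \<Longrightarrow> cball w r \<subseteq> S \<Longrightarrow> 0 < r \<Longrightarrow>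
       ennreal \<bar>g w\<bar> \<le> ennreal (C0 / r ^ DIM('a)) * (\<integral>\<^sup>+u\<in>ball w r. ennreal \<bar>g u\<bar> \<partial>lborel)"
    by (rule harmonic_mean_value_inequality) blast
  let ?N = "DIM('a)"
  \<comment> \<open>\<open>\<kappa>\<close> bounds the quotient of \<open>\<bar>g\<bar>\<close> by \<open>\<bar>g z\<bar>\<close> on the ball of half the distance to the sphere.\<close>
  define \<kappa> where "\<kappa> = (2 ^ ?N) powr (1 / p)"
  have \<kappa>: "\<kappa> > 0" by (simp add: \<kappa>_def)
  define C where "C = C0 * 2 ^ ?N * \<kappa> powr (1 - p)"
  show thesis
  proof (rule that[of C])
    show "C > 0" using C0 \<kappa> by (simp add: C_def)
    fix g :: "'a \<Rightarrow> real" and S w and r :: real assume harm: "harmonic_on g S" and S: "cball w r \<subseteq> S" and r: "0 < r"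
    have cont: "continuous_on (cball w r) g"
      using S by (intro continuous_on_subset[OF harmonic_on_imp_continuous_on[OF harm]]) auto
    define h where "h z = \<bar>g z\<bar> powr p * (r - dist w z) ^ ?N" for z
    have "continuous_on (cball w r) h" unfolding h_def
      using p by (intro continuous_intros continuous_on_powr' cont) auto
    then obtain z where z: "z \<in> cball w r" and hmax: "\<And>u. u \<in> cball w r \<Longrightarrow> h u \<le> h z"
      using continuous_attains_sup[of "cball w r" h] r by auto
    have hw: "\<bar>g w\<bar> powr p * r ^ ?N \<le> h z" using hmax[of w] r by (simp add: h_def)
    define J where "J = (\<integral>\<^sup>+u\<in>ball w r. ennreal (\<bar>g u\<bar> powr p) \<partial>lborel)"
    have main: "ennreal (h z) \<le> ennreal C * J"
    proof (cases "h z > 0")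
      case True
      define d where "d = r - dist w z"
      define G where "G = \<bar>g z\<bar>"
      have d: "d > 0" and G: "G > 0"
        using True z unfolding h_def d_def G_def by (auto simp: zero_less_mult_iff less_le)
      have sub: "ball z (d/2) \<subseteq> ball w r" "cball z (d/2) \<subseteq> S"
      proof -
        have "dist w u < r" if "dist z u \<le> d/2" for u
          using dist_triangle[of w u z] that d unfolding d_def by simp
        then show "ball z (d/2) \<subseteq> ball w r" "cball z (d/2) \<subseteq> S" using S by (auto simp: subset_iff less_imp_le)
      qed
      have bound: "\<bar>g u\<bar> \<le> (\<kappa> * G) powr (1 - p) * \<bar>g u\<bar> powr p" if u: "u \<in> ball z (d/2)" for u
      proof (cases "g u = 0")
        case False
        have uw: "u \<in> cball w r" using sub(1) u by (auto simp: subset_iff less_imp_le)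
        have du: "d / 2 \<le> r - dist w u" using dist_triangle[of w u z] u unfolding d_def by (auto simp: dist_commute)
        have "\<bar>g u\<bar> powr p * (d/2) ^ ?N \<le> h u" unfolding h_def
          using du d by (intro mult_left_mono power_mono) auto
        also have "\<dots> \<le> G powr p * d ^ ?N" using hmax[OF uw] by (simp add: h_def G_def d_def)
        finally have "\<bar>g u\<bar> powr p \<le> 2 ^ ?N * G powr p"
          using d by (simp add: power_divide field_simps)
        then have "(\<bar>g u\<bar> powr p) powr (1/p) \<le> (2 ^ ?N * G powr p) powr (1/p)"
          using p by (intro powr_mono2) auto
        then have "\<bar>g u\<bar> \<le> \<kappa> * G" using p G by (simp add: powr_powr powr_mult \<kappa>_def)
        then have "\<bar>g u\<bar> powr (1 - p) \<le> (\<kappa> * G) powr (1 - p)" using p by (intro powr_mono2) auto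
        then have "\<bar>g u\<bar> powr (1 - p) * \<bar>g u\<bar> powr p \<le> (\<kappa> * G) powr (1 - p) * \<bar>g u\<bar> powr p"
          by (intro mult_right_mono) auto
        then show ?thesis using False by (simp add: powr_add[symmetric])
      qed (use p in simp)
      have meas: "(\<lambda>u. ennreal (\<bar>g u\<bar> powr p) * indicator (ball z (d/2)) u) \<in> borel_measurable lborel"
      proof -
        have "(\<lambda>u. indicator (ball z (d/2)) u *\<^sub>R (\<bar>g u\<bar> powr p)) \<in> borel_measurable borel"
          using p sub(1) by (intro borel_measurable_continuous_on_indicator continuous_on_powr' continuous_intros
             continuous_on_subset[OF cont]) (auto simp: subset_iff less_imp_le)
        then have "(\<lambda>u. ennreal (indicator (ball z (d/2)) u *\<^sub>R (\<bar>g u\<bar> powr p))) \<in> borel_measurable borel" by measurable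
        moreover have "(\<lambda>u. ennreal (indicator (ball z (d/2)) u *\<^sub>R (\<bar>g u\<bar> powr p))) = (\<lambda>u. ennreal (\<bar>g u\<bar> powr p) * indicator (ball z (d/2)) u)"
          by (auto simp: fun_eq_iff indicator_def)
        ultimately show ?thesis by (simp del: real_scaleR_def)
      qed
      have "ennreal G \<le> ennreal (C0 / (d/2) ^ ?N) * (\<integral>\<^sup>+u\<in>ball z (d/2). ennreal \<bar>g u\<bar> \<partial>lborel)"
        unfolding G_def using d by (intro mv[OF harm sub(2)]) auto
      also have "(\<integral>\<^sup>+u\<in>ball z (d/2). ennreal \<bar>g u\<bar> \<partial>lborel) \<le>
          (\<integral>\<^sup>+u. ennreal ((\<kappa> * G) powr (1 - p)) * (ennreal (\<bar>g u\<bar> powr p) * indicator (ball z (d/2)) u) \<partial>lborel)"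
        using bound by (intro nn_integral_mono) (auto simp: indicator_def ennreal_mult'[symmetric])
      also have "\<dots> = ennreal ((\<kappa> * G) powr (1 - p)) * (\<integral>\<^sup>+u\<in>ball z (d/2). ennreal (\<bar>g u\<bar> powr p) \<partial>lborel)"
        by (rule nn_integral_cmult[OF meas])
      also have "(\<integral>\<^sup>+u\<in>ball z (d/2). ennreal (\<bar>g u\<bar> powr p) \<partial>lborel) \<le> J"
        unfolding J_def using sub(1) by (intro nn_integral_mono) (auto simp: indicator_def)
      finally have le: "ennreal G \<le> ennreal (C0 / (d/2) ^ ?N) * (ennreal ((\<kappa> * G) powr (1 - p)) * J)"
        by (simp add: mult_left_mono)
      have "h z = (G powr p * d ^ ?N / G) * G" using G by (simp add: h_def G_def d_def)
      then have "ennreal (h z) = ennreal (G powr p * d ^ ?N / G) * ennreal G"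
        using G d by (simp add: ennreal_mult[symmetric])
      also have "\<dots> \<le> ennreal (G powr p * d ^ ?N / G) * (ennreal (C0 / (d/2) ^ ?N) * (ennreal ((\<kappa> * G) powr (1 - p)) * J))"
        by (rule mult_left_mono[OF le]) simp
      also have "\<dots> = ennreal (G powr p * d ^ ?N / G * (C0 / (d/2) ^ ?N) * (\<kappa> * G) powr (1 - p)) * J"
        by (rule ennreal_mult3) (use G d C0 \<kappa> in auto)
      also have "G powr p * d ^ ?N / G * (C0 / (d/2) ^ ?N) * (\<kappa> * G) powr (1 - p) = C"
      proof -
        have "(\<kappa> * G) powr (1 - p) = \<kappa> powr (1 - p) * (G / G powr p)"
          using G \<kappa> by (simp add: powr_mult powr_diff)
        then show ?thesis using G d by (simp add: C_def power_divide)
      qed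
      finally show ?thesis .
    next
      case False
      then show ?thesis by (simp add: ennreal_neg)
    qed
    have "ennreal (\<bar>g w\<bar> powr p) = ennreal (1 / r ^ ?N) * ennreal (\<bar>g w\<bar> powr p * r ^ ?N)"
      using r by (subst ennreal_mult[symmetric]) auto
    also have "\<dots> \<le> ennreal (1 / r ^ ?N) * (ennreal C * J)"
      using main hw by (intro mult_left_mono order_trans[OF _ main] ennreal_leI) auto
    also have "\<dots> = ennreal (C / r ^ ?N) * J"
      using r \<open>C > 0\<close> by (simp add: mult.assoc[symmetric] ennreal_mult[symmetric])
    finally show "ennreal (\<bar>g w\<bar> powr p) \<le> ennreal (C / r ^ ?N) * (\<integral>\<^sup>+u\<in>ball w r. ennreal (\<bar>g u\<bar> powr p) \<partial>lborel)"
      unfolding J_def .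
  qed
qed

section \<open>Uniqueness of bounded harmonic functions in a half-space\<close>

lemma second_derivative_nonpos_at_max:
  fixes \<phi> \<phi>' :: "real \<Rightarrow> real"
  assumes e: "e > 0"
    and d1: "\<And>s. \<bar>s\<bar> < e \<Longrightarrow> (\<phi> has_real_derivative \<phi>' s) (at s)"
    and d2: "(\<phi>' has_real_derivative L) (at 0)"
    and max: "\<And>s. \<bar>s\<bar> < e \<Longrightarrow> \<phi> s \<le> \<phi> 0"
  shows "L \<le> 0"
proof (rule ccontr)
  assume "\<not> L \<le> 0"
  then obtain d where d: "d > 0" "\<And>h. 0 < h \<Longrightarrow> h < d \<Longrightarrow> \<phi>' 0 < \<phi>' h"
    using DERIV_pos_inc_right[OF d2] by auto
  have "\<phi>' 0 = 0" by (rule DERIV_local_max[OF d1[of 0] e]) (use max e in auto)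
  define k where "k = min d e / 2"
  have k: "0 < k" "k < d" "k < e" using d e by (auto simp: k_def)
  have "\<phi> 0 < \<phi> k"
  proof (rule DERIV_pos_imp_increasing_open[OF k(1)])
    fix x assume "0 < x" "x < k"
    then show "\<exists>y. (\<phi> has_real_derivative y) (at x) \<and> 0 < y"
      using d(2)[of x] d1[of x] k \<open>\<phi>' 0 = 0\<close> by (intro exI[of _ "\<phi>' x"]) auto
  next
    show "continuous_on {0..k} \<phi>" 
      by (intro continuous_at_imp_continuous_on ballI DERIV_isCont[OF d1]) (use k in auto)
  qed
  then show False using max[of k] k by auto
qed

lemma sum_Basis_prod:
  "sum f (Basis :: ('a::euclidean_space \<times> 'b::euclidean_space) set) = (\<Sum>i\<in>Basis. f (i, 0)) + (\<Sum>i\<in>Basis. f (0, i))"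
  for f :: "_ \<Rightarrow> real"
proof -
  have "inj_on (\<lambda>u. (u::'a, 0::'b)) Basis" "inj_on (\<lambda>u. (0::'a, u::'b)) Basis"
    by (auto intro!: inj_onI)
  moreover have "(\<lambda>u. (u::'a, 0::'b)) ` Basis \<inter> (\<lambda>u. (0::'a, u::'b)) ` Basis = {}"
    by auto
  ultimately show ?thesis unfolding Basis_prod_def by (simp add: sum.union_disjoint sum.reindex)
qed

text \<open>
  On the cylinder \<open>norm x \<le> T\<close>, \<open>0 \<le> t \<le> T\<close> the function is
  compared with the quadratic polynomial \<open>q T\<close>. It has constant Laplacian \<open>-2 B /
  T\<^sup>2\<close>, exceeds \<open>u\<close> on the top and on the side because it is at least
  \<open>B\<close> there, and is nonnegative on the bottom, where \<open>u\<close> vanishes. A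
  positive maximum of \<open>u - q T\<close> would therefore be attained in the interior, against
  the second derivative test. At a fixed point \<open>q T\<close> is of order \<open>1 / T\<close>,
  and \<open>T\<close> is arbitrary.
\<close>

lemma harmonic_half_space_max_principle:
  fixes u :: "'a::euclidean_space \<times> real \<Rightarrow> real"
  assumes harm: "harmonic_on u {z. snd z > 0}" and cont: "continuous_on {z. snd z \<ge> 0} u"
    and bdd: "\<And>z. snd z \<ge> 0 \<Longrightarrow> u z \<le> M" and bdry: "\<And>x. u (x, 0) = 0" and z: "snd z \<ge> 0"
  shows "u z \<le> 0"
proof -
  define B where "B = \<bar>M\<bar> + 1"
  have B: "B > 0" "u z < B" if "snd z \<ge> 0" for z using bdd[OF that] unfolding B_def by linarith+
  note B = B(1)[of z, OF z] B(2)
  define n where "n = real DIM('a)"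
  have n: "n \<ge> 1" unfolding n_def using DIM_positive[where 'a='a] by linarith
  obtain D E where D: "has_gradient u D {z. snd z > 0}" and E: "\<And>b. b \<in> Basis \<Longrightarrow> has_gradient (D b) (E b) {z. snd z > 0}"
    and lap: "\<And>z. z \<in> {z. snd z > 0} \<Longrightarrow> (\<Sum>b\<in>Basis. E b b z) = 0"
    by (rule harmonic_onE[OF harm]) blast
  define q where "q T z = B * ((norm (fst z))\<^sup>2 + (n + 1) * snd z * (2 * T - snd z)) / T\<^sup>2" for T and z :: "'a \<times> real"
  have barrier: "u z \<le> q T z" if T: "T > 0" and zT: "norm (fst z) \<le> T" "snd z \<le> T" "snd z \<ge> 0" for T z
  proof (rule ccontr)
    assume neg: "\<not> u z \<le> q T z"
    define K :: "('a \<times> real) set" where "K = cball 0 T \<times> {0..T}"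
    have K: "compact K" unfolding K_def by (intro compact_Times compact_cball compact_Icc)
    have "continuous_on K (\<lambda>z. u z - q T z)"
      unfolding q_def using T by (intro continuous_intros continuous_on_subset[OF cont]) (auto simp: K_def)
    moreover have "z \<in> K" using zT by (auto simp: K_def mem_Times_iff)
    ultimately obtain y where y: "y \<in> K" and ymax: "\<And>v. v \<in> K \<Longrightarrow> u v - q T v \<le> u y - q T y"
      using continuous_attains_sup[OF K] by blast
    have pos: "u y > q T y" using ymax[OF \<open>z \<in> K\<close>] neg by linarith
    have yK: "norm (fst y) \<le> T" "0 \<le> snd y" "snd y \<le> T" using y by (auto simp: K_def)
    have nn: "0 \<le> (n + 1) * snd y * (2 * T - snd y)" using n yK T by (intro mult_nonneg_nonneg) auto
    have large: "u y < q T y" if "T\<^sup>2 \<le> (norm (fst y))\<^sup>2 + (n + 1) * snd y * (2 * T - snd y)"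
    proof -
      have "B * T\<^sup>2 \<le> B * ((norm (fst y))\<^sup>2 + (n + 1) * snd y * (2 * T - snd y))"
        using that B(1) by (intro mult_left_mono) auto
      then have "B \<le> q T y" using T unfolding q_def by (simp only: pos_le_divide_eq zero_less_power)
      then show ?thesis using B(2)[OF yK(2)] by simp
    qed
    have ne0: "snd y \<noteq> 0"
    proof
      assume "snd y = 0"
      then have "u y = 0" using bdry[of "fst y"] by (metis prod.collapse)
      moreover have "q T y \<ge> 0" unfolding q_def using B(1) nn by simp
      ultimately show False using pos by simp
    qed
    have neT: "norm (fst y) \<noteq> T" using large pos nn by force
    have nT: "snd y \<noteq> T"
    proof
      assume "snd y = T"
      then have "(n + 1) * snd y * (2 * T - snd y) = (n + 1) * T\<^sup>2" by (simp add: power2_eq_square)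
      moreover have "1 * T\<^sup>2 \<le> (n + 1) * T\<^sup>2" using n by (intro mult_right_mono) auto
      ultimately have "T\<^sup>2 \<le> (norm (fst y))\<^sup>2 + (n + 1) * snd y * (2 * T - snd y)"
        using zero_le_power2[of "norm (fst y)"] by linarith
      then show False using large pos by simp
    qed
    let ?U = "ball 0 T \<times> {0<..<T} :: ('a \<times> real) set"
    have yU: "y \<in> ?U" using yK ne0 neT nT by (cases y) auto
    have "open ?U" by (intro open_Times) auto
    then obtain e where e: "e > 0" "ball y e \<subseteq> ?U" using yU openE by blast
    have Ebb: "E b b y \<le> B * (2 * (fst b \<bullet> fst b) - 2 * (n + 1) * (snd b)\<^sup>2) / T\<^sup>2" if b: "b \<in> Basis" for b :: "'a \<times> real"
    proof -
      have in_U: "y + s *\<^sub>R b \<in> ?U" if "\<bar>s\<bar> < e" for s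
      proof -
        have "y + s *\<^sub>R b \<in> ball y e" using that b by (simp add: dist_norm norm_Basis)
        then show ?thesis using e(2) by blast
      qed
      have q_eq: "q T (y + s *\<^sub>R b) = B * (fst y \<bullet> fst y + 2 * s * (fst y \<bullet> fst b) + s\<^sup>2 * (fst b \<bullet> fst b) +
          (n + 1) * (snd y + s * snd b) * (2 * T - (snd y + s * snd b))) / T\<^sup>2" for s
        unfolding q_def power2_norm_eq_inner
        by (simp add: inner_add_left inner_add_right inner_commute power2_eq_square algebra_simps)
      define Q' where "Q' s = B * (2 * (fst y \<bullet> fst b) + 2 * s * (fst b \<bullet> fst b) +
          (n + 1) * (snd b * (2 * T - (snd y + s * snd b)) - (snd y + s * snd b) * snd b)) / T\<^sup>2" for s
      have Q1: "((\<lambda>s. q T (y + s *\<^sub>R b)) has_real_derivative Q' s) (at s)" for s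
        unfolding q_eq Q'_def using T by (auto intro!: derivative_eq_intros simp: field_simps)
      have Q2: "(Q' has_real_derivative B * (2 * (fst b \<bullet> fst b) - 2 * (n + 1) * (snd b)\<^sup>2) / T\<^sup>2) (at s)" for s
        unfolding Q'_def using T by (auto intro!: derivative_eq_intros simp: field_simps power2_eq_square)
      have "E b b y - B * (2 * (fst b \<bullet> fst b) - 2 * (n + 1) * (snd b)\<^sup>2) / T\<^sup>2 \<le> 0"
      proof (rule second_derivative_nonpos_at_max[OF e(1), of "\<lambda>s. u (y + s *\<^sub>R b) - q T (y + s *\<^sub>R b)" "\<lambda>s. D b (y + s *\<^sub>R b) - Q' s"])
        fix s assume s: "\<bar>s\<bar> < e"
        have "y + s *\<^sub>R b \<in> {z. snd z > 0}" using in_U[OF s] by (simp add: mem_Times_iff)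
        then show "((\<lambda>s. u (y + s *\<^sub>R b) - q T (y + s *\<^sub>R b)) has_real_derivative D b (y + s *\<^sub>R b) - Q' s) (at s)"
          by (intro DERIV_diff Q1 has_gradient_line[OF D] b)
        have "y + s *\<^sub>R b \<in> K" using in_U[OF s] unfolding K_def by (simp add: mem_Times_iff)
        then show "u (y + s *\<^sub>R b) - q T (y + s *\<^sub>R b) \<le> u (y + 0 *\<^sub>R b) - q T (y + 0 *\<^sub>R b)"
          using ymax by simp
      next
        have "y + 0 *\<^sub>R b \<in> {z. snd z > 0}" using yU by (simp add: mem_Times_iff)
        from DERIV_diff[OF has_gradient_line[OF E[OF b] this b] Q2[of 0]]
        show "((\<lambda>s. D b (y + s *\<^sub>R b) - Q' s) has_real_derivative E b b y - B * (2 * (fst b \<bullet> fst b) - 2 * (n + 1) * (snd b)\<^sup>2) / T\<^sup>2) (at 0)"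
          by simp
      qed
      then show ?thesis by simp
    qed
    have "0 = (\<Sum>b\<in>Basis. E b b y)" using lap[of y] yU by (simp add: mem_Times_iff)
    also have "\<dots> \<le> (\<Sum>b\<in>(Basis::('a \<times> real) set). B * (2 * (fst b \<bullet> fst b) - 2 * (n + 1) * (snd b)\<^sup>2) / T\<^sup>2)"
      by (rule sum_mono[OF Ebb])
    also have "\<dots> = B * (2 * n - 2 * (n + 1)) / T\<^sup>2"
    proof -
      have "(\<Sum>b\<in>(Basis::'a set). B * (2 * (b \<bullet> b)) / T\<^sup>2) = n * (B * 2 / T\<^sup>2)"
        by (simp add: n_def inner_Basis)
      then show ?thesis unfolding sum_Basis_prod using T by (simp add: field_simps)
    qed
    also have "\<dots> < 0" using B(1) T by (simp add: field_simps)
    finally show False by simp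
  qed
  show ?thesis
  proof (rule ccontr)
    assume "\<not> u z \<le> 0"
    then have pos: "u z > 0" by simp
    define k where "k = (norm (fst z))\<^sup>2 + (n + 1) * snd z * 2"
    have k: "k \<ge> 0" unfolding k_def using n z by simp
    define T where "T = max (max 1 (norm (fst z))) (max (snd z) (B * k / u z + 1))"
    have T: "T \<ge> 1" "norm (fst z) \<le> T" "snd z \<le> T" "B * k / u z < T" unfolding T_def by auto
    have "u z \<le> q T z" by (rule barrier) (use T z in auto)
    also have "q T z \<le> B * (k * T) / T\<^sup>2"
    proof -
      have "(n + 1) * snd z * (2 * T - snd z) \<le> (n + 1) * snd z * (2 * T)"
        using n z by (intro mult_left_mono) auto
      moreover have "(norm (fst z))\<^sup>2 * 1 \<le> (norm (fst z))\<^sup>2 * T" using T by (intro mult_left_mono) auto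
      ultimately have "(norm (fst z))\<^sup>2 + (n + 1) * snd z * (2 * T - snd z) \<le> k * T"
        unfolding k_def by (simp add: algebra_simps)
      then show ?thesis unfolding q_def using B(1) by (intro divide_right_mono mult_left_mono) auto
    qed
    also have "\<dots> = B * k / T" using T by (simp add: power2_eq_square)
    also have "\<dots> < u z" using T pos by (simp add: field_simps)
    finally show False by simp
  qed
qed

lemma harmonic_half_space_unique:
  fixes u :: "'a::euclidean_space \<times> real \<Rightarrow> real"
  assumes harm: "harmonic_on u {z. snd z > 0}" and cont: "continuous_on {z. snd z \<ge> 0} u"
    and bdd: "\<And>z. snd z \<ge> 0 \<Longrightarrow> \<bar>u z\<bar> \<le> M" and bdry: "\<And>x. u (x, 0) = 0" and z: "snd z \<ge> 0"
  shows "u z = 0"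
proof -
  have "u z \<le> 0"
    by (rule harmonic_half_space_max_principle[OF harm cont _ bdry z, of M]) (use bdd in fastforce)
  moreover have "-1 * u z \<le> 0"
    by (rule harmonic_half_space_max_principle[OF harmonic_on_cmult[OF harm] _ _ _ z, of _ M])
       (use bdd bdry cont in \<open>auto intro!: continuous_intros simp: abs_le_iff\<close>)
  ultimately show ?thesis by simp
qed

section \<open>Homogeneous kernels and their integrals\<close>

lemma has_gradient_inner_times:
  assumes "has_gradient f D S"
  shows "has_gradient (\<lambda>z. (z \<bullet> a) * f z) (\<lambda>b z. (b \<bullet> a) * f z + (z \<bullet> a) * D b z) S"
  unfolding has_gradient_def
proof
  fix z assume z: "z \<in> S"
  have "((\<lambda>z. z \<bullet> a) has_derivative (\<lambda>v. v \<bullet> a)) (at z)" by (auto intro!: derivative_eq_intros)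
  from has_derivative_mult[OF this has_gradientD[OF assms z]]
  show "((\<lambda>z. (z \<bullet> a) * f z) has_derivative (\<lambda>v. \<Sum>b\<in>Basis. (v \<bullet> b) * ((b \<bullet> a) * f z + (z \<bullet> a) * D b z))) (at z)"
  proof (rule back_subst[of "\<lambda>g. (_ has_derivative g) (at z)"], intro ext)
    fix v
    have "v \<bullet> a = (\<Sum>b\<in>Basis. (v \<bullet> b) * (b \<bullet> a))"
      by (subst euclidean_inner[of v a]) (simp add: inner_commute)
    then show "(z \<bullet> a) * (\<Sum>b\<in>Basis. (v \<bullet> b) * D b z) + (v \<bullet> a) * f z =
        (\<Sum>b\<in>Basis. (v \<bullet> b) * ((b \<bullet> a) * f z + (z \<bullet> a) * D b z))"
      by (simp add: distrib_left sum.distrib sum_distrib_left sum_distrib_right mult_ac)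
  qed
qed

lemma has_gradient_norm_powr:
  "has_gradient (\<lambda>z::'a::euclidean_space. norm z powr d) (\<lambda>b z. d * ((z \<bullet> b) * norm z powr (d - 2))) (- {0})"
  unfolding has_gradient_def
proof
  fix z :: 'a assume "z \<in> - {0}"
  then have z: "z \<noteq> 0" "norm z > 0" by auto
  have "(norm has_derivative (\<lambda>v. v \<bullet> sgn z)) (at z)"
    by (rule has_derivative_norm[OF z(1)])
  from has_derivative_compose[OF this, of "\<lambda>x. x powr d" "(*) (d * norm z powr (d - 1))"]
  have "((\<lambda>z. norm z powr d) has_derivative (\<lambda>v. d * norm z powr (d - 1) * (v \<bullet> sgn z))) (at z)"
    using has_real_derivative_powr[OF z(2), of d] by (simp add: has_field_derivative_def)
  then show "((\<lambda>z. norm z powr d) has_derivative (\<lambda>v. \<Sum>b\<in>Basis. (v \<bullet> b) * (d * ((z \<bullet> b) * norm z powr (d - 2))))) (at z)"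
  proof (rule back_subst[of "\<lambda>g. (_ has_derivative g) (at z)"], intro ext)
    fix v
    have "norm z powr (d - 1) = norm z * norm z powr (d - 2)"
      using z powr_add[of "norm z" 1 "d - 2"] by simp
    then have "d * norm z powr (d - 1) * (v \<bullet> sgn z) = d * norm z powr (d - 2) * (v \<bullet> z)"
      using z by (simp add: sgn_div_norm)
    then show "d * norm z powr (d - 1) * (v \<bullet> sgn z) = (\<Sum>b\<in>Basis. (v \<bullet> b) * (d * ((z \<bullet> b) * norm z powr (d - 2))))"
      by (subst (asm) euclidean_inner[of v z]) (simp add: sum_distrib_left mult_ac)
  qed
qed

definition partial :: "'a::euclidean_space \<Rightarrow> ('a \<Rightarrow> real) \<Rightarrow> 'a \<Rightarrow> real" where
  "partial b f z = frechet_derivative f (at z) b"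

lemma partial_eq:
  assumes "has_gradient f D S" "z \<in> S" "b \<in> Basis"
  shows "partial b f z = D b z"
proof -
  have "partial b f z = (\<Sum>c\<in>Basis. (b \<bullet> c) * D c z)"
    unfolding partial_def frechet_derivative_at[OF has_gradientD[OF assms(1,2)], symmetric] ..
  also have "\<dots> = (\<Sum>c\<in>Basis. if c = b then D b z else 0)"
    using assms(3) by (intro sum.cong) (auto simp: inner_Basis)
  finally show ?thesis using assms(3) by simp
qed

text \<open>
  A class of functions that contains the Poisson kernel and is closed under partial derivatives,
  each of which lowers the degree \<open>d\<close> by one. Since a member of degree \<open>d\<close>
  is bounded by a multiple of \<open>norm z powr d\<close>, all derivatives of the Poisson kernel
  are estimated without computing them. Only values away from the origin matter, whence the last
  rule.
\<close>

inductive homogeneous_kernel :: "real \<Rightarrow> ('a::euclidean_space \<Rightarrow> real) \<Rightarrow> bool" where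
  norm_powr: "homogeneous_kernel d (\<lambda>z. norm z powr d)"
| inner_times: "homogeneous_kernel d \<phi> \<Longrightarrow> homogeneous_kernel (d + 1) (\<lambda>z. (z \<bullet> a) * \<phi> z)"
| add: "homogeneous_kernel d \<phi> \<Longrightarrow> homogeneous_kernel d \<psi> \<Longrightarrow> homogeneous_kernel d (\<lambda>z. \<phi> z + \<psi> z)"
| cmult: "homogeneous_kernel d \<phi> \<Longrightarrow> homogeneous_kernel d (\<lambda>z. c * \<phi> z)"
| cong: "homogeneous_kernel d \<phi> \<Longrightarrow> (\<And>z. z \<noteq> 0 \<Longrightarrow> \<phi> z = \<psi> z) \<Longrightarrow> homogeneous_kernel d \<psi>"

lemma open_minus_zero: "open (- {0::'a::euclidean_space})"
  by (simp add: open_Compl)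

text \<open>
  The induction carries explicit first and second derivatives. For these formulas the symmetry of
  the second derivatives is visible at every rule, so that no general theorem on mixed derivatives
  is involved.
\<close>

lemma homogeneous_kernel_derivatives:
  assumes "homogeneous_kernel d \<phi>"
  shows "\<exists>D E. has_gradient \<phi> D (- {0}) \<and> (\<forall>b. homogeneous_kernel (d - 1) (D b)) \<and>
     (\<forall>b. has_gradient (D b) (E b) (- {0})) \<and> (\<forall>a b z. E a b z = E b a z)"
  using assms
proof induction
  case (norm_powr d)
  let ?D = "\<lambda>b z. d * ((z \<bullet> b) * norm z powr (d - 2))"
  let ?E = "\<lambda>b c z. d * ((c \<bullet> b) * norm z powr (d - 2) + (z \<bullet> b) * ((d - 2) * ((z \<bullet> c) * norm z powr (d - 2 - 2))))"
  have "homogeneous_kernel (d - 1) (?D b)" for b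
    using homogeneous_kernel.cmult[OF homogeneous_kernel.inner_times[OF homogeneous_kernel.norm_powr[of "d - 2"], of b], of d]
    by (simp add: add.commute)
  moreover have "has_gradient (?D b) (?E b) (- {0})" for b
    by (intro has_gradient_cmult has_gradient_inner_times has_gradient_norm_powr)
  moreover have "?E b c z = ?E c b z" for b c z by (simp add: inner_commute mult_ac)
  ultimately show ?case using has_gradient_norm_powr[of d] by (intro exI[of _ ?D] exI[of _ ?E]) blast
next
  case (inner_times d \<phi> a)
  then obtain D E where D: "has_gradient \<phi> D (- {0})" "\<And>b. homogeneous_kernel (d - 1) (D b)"
    and E: "\<And>b. has_gradient (D b) (E b) (- {0})" "\<And>b c z. E b c z = E c b z" by blast
  let ?D = "\<lambda>b z. (b \<bullet> a) * \<phi> z + (z \<bullet> a) * D b z"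
  let ?E = "\<lambda>b c z. (b \<bullet> a) * D c z + ((c \<bullet> a) * D b z + (z \<bullet> a) * E b c z)"
  have "homogeneous_kernel (d + 1 - 1) (?D b)" for b
    using homogeneous_kernel.add[OF homogeneous_kernel.cmult[OF inner_times(1)] homogeneous_kernel.inner_times[OF D(2)[of b], of a, simplified]]
    by simp
  moreover have "has_gradient (?D b) (?E b) (- {0})" for b
    by (intro has_gradient_add has_gradient_cmult has_gradient_inner_times D E)
  moreover have "?E b c z = ?E c b z" for b c z using E(2)[of b c z] by simp
  ultimately show ?case using has_gradient_inner_times[OF D(1)] by (intro exI[of _ ?D] exI[of _ ?E]) blast
next
  case (add d \<phi> \<psi>)
  then obtain D E D' E' where D: "has_gradient \<phi> D (- {0})" "\<And>b. homogeneous_kernel (d - 1) (D b)"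
    and E: "\<And>b. has_gradient (D b) (E b) (- {0})" "\<And>b c z. E b c z = E c b z"
    and D': "has_gradient \<psi> D' (- {0})" "\<And>b. homogeneous_kernel (d - 1) (D' b)"
    and E': "\<And>b. has_gradient (D' b) (E' b) (- {0})" "\<And>b c z. E' b c z = E' c b z" by blast
  show ?case
    by (intro exI[of _ "\<lambda>b z. D b z + D' b z"] exI[of _ "\<lambda>b c z. E b c z + E' b c z"] conjI allI
         has_gradient_add D D' E E' homogeneous_kernel.add arg_cong2[where f="(+)"])
next
  case (cmult d \<phi> c)
  then obtain D E where D: "has_gradient \<phi> D (- {0})" "\<And>b. homogeneous_kernel (d - 1) (D b)"
    and E: "\<And>b. has_gradient (D b) (E b) (- {0})" "\<And>b c z. E b c z = E c b z" by blast
  show ?case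
    by (intro exI[of _ "\<lambda>b z. c * D b z"] exI[of _ "\<lambda>b e z. c * E b e z"] conjI allI
         has_gradient_cmult D E homogeneous_kernel.cmult arg_cong2[where f="(*)"] refl)
next
  case (cong d \<phi> \<psi>)
  then obtain D E where D: "has_gradient \<phi> D (- {0})" "\<And>b. homogeneous_kernel (d - 1) (D b)"
    and E: "\<And>b. has_gradient (D b) (E b) (- {0})" "\<And>b c z. E b c z = E c b z" by blast
  moreover have "has_gradient \<psi> D (- {0})"
    by (rule has_gradient_cong[OF D(1) open_minus_zero]) (use cong in auto)
  ultimately show ?case by blast
qed

lemma homogeneous_kernel_gradient:
  assumes "homogeneous_kernel d \<phi>"
  shows "has_gradient \<phi> (\<lambda>b. partial b \<phi>) (- {0})"
proof -
  obtain D where D: "has_gradient \<phi> D (- {0})" using homogeneous_kernel_derivatives[OF assms] by blast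
  show ?thesis by (rule has_gradient_cong[OF D open_minus_zero]) (use partial_eq[OF D] in auto)
qed

lemma homogeneous_kernel_partial:
  assumes "homogeneous_kernel d \<phi>" "b \<in> Basis"
  shows "homogeneous_kernel (d - 1) (partial b \<phi>)"
proof -
  obtain D where D: "has_gradient \<phi> D (- {0})" "\<And>b. homogeneous_kernel (d - 1) (D b)"
    using homogeneous_kernel_derivatives[OF assms(1)] by blast
  show ?thesis by (rule homogeneous_kernel.cong[OF D(2)[of b]]) (use partial_eq[OF D(1) _ assms(2)] in auto)
qed

lemma partial_cong:
  fixes \<phi> \<psi> :: "'a::euclidean_space \<Rightarrow> real"
  assumes "homogeneous_kernel d \<phi>" "\<And>z. z \<noteq> 0 \<Longrightarrow> \<phi> z = \<psi> z" "z \<noteq> 0" "b \<in> Basis"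
  shows "partial b \<psi> z = partial b \<phi> z"
  by (rule partial_eq[OF has_gradient_cong[OF homogeneous_kernel_gradient[OF assms(1)] open_minus_zero]])
     (use assms in auto)

lemma partial_commute:
  fixes \<phi> :: "'a::euclidean_space \<Rightarrow> real"
  assumes "homogeneous_kernel d \<phi>" "a \<in> Basis" "b \<in> Basis" "z \<noteq> 0"
  shows "partial a (partial b \<phi>) z = partial b (partial a \<phi>) z"
proof -
  obtain D E where D: "has_gradient \<phi> D (- {0})" and E: "\<And>b. has_gradient (D b) (E b) (- {0})" "\<And>b c z. E b c z = E c b z"
    using homogeneous_kernel_derivatives[OF assms(1)] by blast
  have "partial a (partial b \<phi>) z = E b a z" if "a \<in> Basis" "b \<in> Basis" for a b
    by (rule partial_eq[OF has_gradient_cong[OF E(1)[of b] open_minus_zero]])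
       (use partial_eq[OF D] that assms(4) in auto)
  then show ?thesis using assms E(2)[of b a z] by simp
qed

lemma homogeneous_kernel_bound:
  assumes "homogeneous_kernel d (\<phi> :: 'a::euclidean_space \<Rightarrow> real)"
  shows "\<exists>C\<ge>0. \<forall>z. z \<noteq> 0 \<longrightarrow> \<bar>\<phi> z\<bar> \<le> C * norm z powr d"
  using assms
proof induction
  case (norm_powr d)
  show ?case by (intro exI[of _ 1]) auto
next
  case (inner_times d \<phi> a)
  then obtain C where C: "C \<ge> 0" "\<And>z. z \<noteq> 0 \<Longrightarrow> \<bar>\<phi> z\<bar> \<le> C * norm z powr d" by blast
  show ?case
  proof (intro exI[of _ "C * norm a"] conjI allI impI)
    fix z :: 'a assume z: "z \<noteq> 0"
    have "\<bar>z \<bullet> a\<bar> * \<bar>\<phi> z\<bar> \<le> (norm z * norm a) * (C * norm z powr d)"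
      using C z by (intro mult_mono Cauchy_Schwarz_ineq2) auto
    also have "\<dots> = C * norm a * norm z powr (d + 1)" using z by (simp add: powr_add)
    finally show "\<bar>(z \<bullet> a) * \<phi> z\<bar> \<le> C * norm a * norm z powr (d + 1)" by (simp add: abs_mult)
  qed (use C in simp)
next
  case (add d \<phi> \<psi>)
  then obtain C C' where C: "C \<ge> 0" "\<And>z. z \<noteq> 0 \<Longrightarrow> \<bar>\<phi> z\<bar> \<le> C * norm z powr d"
     "C' \<ge> 0" "\<And>z. z \<noteq> 0 \<Longrightarrow> \<bar>\<psi> z\<bar> \<le> C' * norm z powr d" by blast
  show ?case
  proof (intro exI[of _ "C + C'"] conjI allI impI)
    fix z :: 'a assume z: "z \<noteq> 0"
    show "\<bar>\<phi> z + \<psi> z\<bar> \<le> (C + C') * norm z powr d"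
      using C(2)[OF z] C(4)[OF z] abs_triangle_ineq[of "\<phi> z" "\<psi> z"] by (simp add: distrib_right)
  qed (use C in simp)
next
  case (cmult d \<phi> c)
  then obtain C where C: "C \<ge> 0" "\<And>z. z \<noteq> 0 \<Longrightarrow> \<bar>\<phi> z\<bar> \<le> C * norm z powr d" by blast
  show ?case
    by (intro exI[of _ "\<bar>c\<bar> * C"]) (use C in \<open>auto simp: abs_mult mult.assoc intro!: mult_left_mono\<close>)
next
  case (cong d \<phi> \<psi>)
  then show ?case by metis
qed

lemma homogeneous_kernel_measurable:
  assumes "homogeneous_kernel d (\<phi> :: 'a::euclidean_space \<Rightarrow> real)"
  shows "\<phi> \<in> borel_measurable borel"
proof -
  have "(\<lambda>z. indicator (- {0}) z *\<^sub>R \<phi> z) \<in> borel_measurable borel"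
    by (rule borel_measurable_continuous_on_indicator[OF _ has_gradient_imp_continuous_on[OF homogeneous_kernel_gradient[OF assms]]]) simp
  then have "(\<lambda>z. indicator (- {0}) z *\<^sub>R \<phi> z + \<phi> 0 * indicator {0} z) \<in> borel_measurable borel"
    by (intro borel_measurable_add borel_measurable_times borel_measurable_indicator) auto
  moreover have "(\<lambda>z. indicator (- {0}) z *\<^sub>R \<phi> z + \<phi> 0 * indicator {0} z) = \<phi>"
    by (auto simp: fun_eq_iff indicator_def)
  ultimately show ?thesis by simp
qed

definition laplacian :: "('a::euclidean_space \<Rightarrow> real) \<Rightarrow> 'a \<Rightarrow> real" where
  "laplacian \<phi> z = (\<Sum>b\<in>Basis. partial b (partial b \<phi>) z)"

text \<open>
  Partial derivatives of a kernel commute, so the Laplacian of \<open>partial e \<phi>\<close> is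
  \<open>partial e\<close> of the Laplacian of \<open>\<phi>\<close>, hence the derivative of zero.
\<close>

lemma laplacian_partial_zero:
  fixes \<phi> :: "'a::euclidean_space \<Rightarrow> real"
  assumes hk: "homogeneous_kernel d \<phi>" and lap: "\<And>z. z \<noteq> 0 \<Longrightarrow> laplacian \<phi> z = 0"
    and e: "e \<in> Basis" and z: "z \<noteq> 0"
  shows "laplacian (partial e \<phi>) z = 0"
proof -
  have hk2: "homogeneous_kernel (d - 1 - 1) (partial b (partial b \<phi>))" if "b \<in> Basis" for b
    by (intro homogeneous_kernel_partial hk that)
  have swap: "partial b (partial b (partial e \<phi>)) z = partial e (partial b (partial b \<phi>)) z" if b: "b \<in> Basis" for b
  proof -
    have "partial b (partial b (partial e \<phi>)) z = partial b (partial e (partial b \<phi>)) z"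
      by (rule partial_cong[OF homogeneous_kernel_partial[OF homogeneous_kernel_partial[OF hk b] e] _ z b])
         (rule partial_commute[OF hk e b])
    also have "\<dots> = partial e (partial b (partial b \<phi>)) z"
      by (rule partial_commute[OF homogeneous_kernel_partial[OF hk b] b e z])
    finally show ?thesis .
  qed
  have "has_gradient (\<lambda>z. \<Sum>b\<in>Basis. partial b (partial b \<phi>) z) (\<lambda>c z. \<Sum>b\<in>Basis. partial c (partial b (partial b \<phi>)) z) (- {0})"
    unfolding has_gradient_def
  proof
    fix z :: 'a assume "z \<in> - {0}"
    then have "((\<lambda>z. \<Sum>b\<in>Basis. partial b (partial b \<phi>) z) has_derivative
       (\<lambda>v. \<Sum>b\<in>Basis. \<Sum>c\<in>Basis. (v \<bullet> c) * partial c (partial b (partial b \<phi>)) z)) (at z)"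
      by (intro has_derivative_sum has_gradientD[OF homogeneous_kernel_gradient[OF hk2]])
    then show "((\<lambda>z. \<Sum>b\<in>Basis. partial b (partial b \<phi>) z) has_derivative
       (\<lambda>v. \<Sum>c\<in>Basis. (v \<bullet> c) * (\<Sum>b\<in>Basis. partial c (partial b (partial b \<phi>)) z))) (at z)"
      by (subst (asm) sum.swap) (simp add: sum_distrib_left)
  qed
  then have "has_gradient (\<lambda>z. 0) (\<lambda>c z. \<Sum>b\<in>Basis. partial c (partial b (partial b \<phi>)) z) (- {0})"
    by (rule has_gradient_cong[OF _ open_minus_zero]) (use lap in \<open>auto simp: laplacian_def\<close>)
  moreover have "has_gradient (\<lambda>z::'a. 0) (\<lambda>c z. 0) (- {0})" by (simp add: has_gradient_def)
  ultimately have "(\<Sum>b\<in>Basis. partial e (partial b (partial b \<phi>)) z) = 0"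
    using has_gradient_unique[of "\<lambda>z. 0" "\<lambda>c z. \<Sum>b\<in>Basis. partial c (partial b (partial b \<phi>)) z" "- {0}" "\<lambda>c z. 0" z e] e z by simp
  then show ?thesis by (simp add: laplacian_def swap)
qed

text \<open>
  At distance at least \<open>e\<close> from the singularity, the power \<open>d'\<close> of the
  norm is at most \<open>e powr (d' - d)\<close> times the power \<open>d\<close>.
\<close>

lemma integrable_kernel_bound:
  fixes \<tau> :: "'w \<Rightarrow> 'a::euclidean_space"
  assumes hk: "homogeneous_kernel d' \<psi>" and d': "d' \<le> d"
    and c: "c \<in> borel_measurable M" and \<tau>: "\<tau> \<in> borel_measurable M"
    and int: "integrable M (\<lambda>w. c w * norm (z + \<tau> w) powr d)"
    and e: "e > 0" "\<And>w. w \<in> space M \<Longrightarrow> e \<le> norm (z + \<tau> w)"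
  shows "integrable M (\<lambda>w. c w * \<psi> (z + \<tau> w))"
proof -
  obtain C where C: "C \<ge> 0" "\<And>z. z \<noteq> 0 \<Longrightarrow> \<bar>\<psi> z\<bar> \<le> C * norm z powr d'"
    using homogeneous_kernel_bound[OF hk] by blast
  show ?thesis
  proof (rule Bochner_Integration.integrable_bound[where f="\<lambda>w. (C * e powr (d' - d)) * (c w * norm (z + \<tau> w) powr d)"])
    show "integrable M (\<lambda>w. (C * e powr (d' - d)) * (c w * norm (z + \<tau> w) powr d))"
      by (intro integrable_mult_right int)
    show "(\<lambda>w. c w * \<psi> (z + \<tau> w)) \<in> borel_measurable M"
      using c \<tau> by (intro borel_measurable_times measurable_compose[OF _ homogeneous_kernel_measurable[OF hk]]) auto
    show "AE w in M. norm (c w * \<psi> (z + \<tau> w)) \<le> norm ((C * e powr (d' - d)) * (c w * norm (z + \<tau> w) powr d))"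
    proof (rule AE_I2)
      fix w assume w: "w \<in> space M"
      let ?r = "norm (z + \<tau> w)"
      have r: "e \<le> ?r" "?r > 0" "z + \<tau> w \<noteq> 0" using e(2)[OF w] e(1) by auto
      have "\<bar>\<psi> (z + \<tau> w)\<bar> \<le> C * ?r powr d'" using C r by auto
      also have "?r powr d' = ?r powr (d' - d) * ?r powr d" using r by (simp add: powr_add[symmetric])
      also have "\<dots> \<le> e powr (d' - d) * ?r powr d"
        using r e d' by (intro mult_right_mono powr_mono2') auto
      finally have "\<bar>\<psi> (z + \<tau> w)\<bar> \<le> C * (e powr (d' - d) * ?r powr d)" using C(1) by (simp add: mult_left_mono)
      then have "\<bar>c w\<bar> * \<bar>\<psi> (z + \<tau> w)\<bar> \<le> \<bar>c w\<bar> * (C * (e powr (d' - d) * ?r powr d))" by (intro mult_left_mono) auto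
      then show "norm (c w * \<psi> (z + \<tau> w)) \<le> norm ((C * e powr (d' - d)) * (c w * norm (z + \<tau> w) powr d))"
        using C(1) by (simp add: abs_mult mult_ac)
    qed
  qed
qed

text \<open>
  Near a point \<open>z0\<close> the norm of \<open>z + \<tau> w\<close> stays above half its value
  at \<open>z0\<close>, uniformly in \<open>w\<close>; so the gradient of the integrand is dominated
  by a multiple of \<open>\<bar>c w\<bar> * norm (z0 + \<tau> w) powr d\<close>. The kernel may have
  degree \<open>d + 1\<close>. This leeway serves the Poisson kernel of degree \<open>-n\<close>:
  \<open>norm z powr (-n)\<close> is not integrable over horizontal planes, but the Poisson kernel
  is, because its numerator is constant there.
\<close>

lemma has_gradient_kernel_integral:
  fixes \<tau> :: "'w \<Rightarrow> 'a::euclidean_space"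
  assumes hk: "homogeneous_kernel d' \<psi>" and d: "d' - 1 \<le> d" "d \<le> 0" and U: "open U"
    and c: "c \<in> borel_measurable M" and \<tau>: "\<tau> \<in> borel_measurable M"
    and int\<psi>: "\<And>z. z \<in> U \<Longrightarrow> integrable M (\<lambda>w. c w * \<psi> (z + \<tau> w))"
    and int: "\<And>z. z \<in> U \<Longrightarrow> integrable M (\<lambda>w. c w * norm (z + \<tau> w) powr d)"
    and gap: "\<And>z. z \<in> U \<Longrightarrow> \<exists>e>0. \<forall>w\<in>space M. e \<le> norm (z + \<tau> w)"
  shows "has_gradient (\<lambda>z. \<integral>w. c w * \<psi> (z + \<tau> w) \<partial>M) (\<lambda>b z. \<integral>w. c w * partial b \<psi> (z + \<tau> w) \<partial>M) U"
  unfolding has_gradient_def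
proof
  fix z0 assume z0: "z0 \<in> U"
  obtain e where e: "e > 0" "\<And>w. w \<in> space M \<Longrightarrow> e \<le> norm (z0 + \<tau> w)" using gap[OF z0] by blast
  obtain \<delta>0 where \<delta>0: "\<delta>0 > 0" "ball z0 \<delta>0 \<subseteq> U" using U z0 openE by blast
  define \<delta> where "\<delta> = min \<delta>0 (e / 2)"
  have \<delta>: "\<delta> > 0" "ball z0 \<delta> \<subseteq> U" "\<delta> \<le> e / 2" using \<delta>0 e by (auto simp: \<delta>_def subset_iff)
  have half: "norm (z0 + \<tau> w) / 2 \<le> norm (z + \<tau> w)" if "z \<in> ball z0 \<delta>" "w \<in> space M" for z w
  proof -
    have "norm (z0 + \<tau> w) - norm (z + \<tau> w) \<le> norm (z0 - z)"
      using norm_triangle_ineq2[of "z0 + \<tau> w" "z + \<tau> w"] by simp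
    moreover have "norm (z0 - z) < \<delta>" using that by (simp add: dist_norm)
    ultimately show ?thesis using \<delta>(3) e(2)[OF that(2)] by linarith
  qed
  have "\<forall>b\<in>Basis. \<exists>C\<ge>0. \<forall>z. z \<noteq> 0 \<longrightarrow> \<bar>partial b \<psi> z\<bar> \<le> C * norm z powr (d' - 1)"
    using homogeneous_kernel_bound[OF homogeneous_kernel_partial[OF hk]] by blast
  then obtain C where C: "\<And>b. b \<in> Basis \<Longrightarrow> C b \<ge> 0"
    "\<And>b z. b \<in> Basis \<Longrightarrow> z \<noteq> 0 \<Longrightarrow> \<bar>partial b \<psi> z\<bar> \<le> C b * norm z powr (d' - 1)" by metis
  define K where "K = (\<Sum>b\<in>(Basis::'a set). C b)"
  have K: "C b \<le> K" if "b \<in> Basis" for b unfolding K_def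
    by (rule member_le_sum) (use that C in auto)
  have K0: "K \<ge> 0" unfolding K_def by (intro sum_nonneg C)
  let ?q = "d' - 1 - d"
  have "has_gradient (\<lambda>z. \<integral>w. c w * \<psi> (z + \<tau> w) \<partial>M) (\<lambda>b z. \<integral>w. c w * partial b \<psi> (z + \<tau> w) \<partial>M) (ball z0 \<delta>)"
  proof (rule has_gradient_integral[where B="\<lambda>w. (K * (e/2) powr ?q * (1/2) powr d) * \<bar>c w * norm (z0 + \<tau> w) powr d\<bar>"])
    fix z assume z: "z \<in> ball z0 \<delta>"
    have e2: "e / 2 \<le> norm (z + \<tau> w)" if "w \<in> space M" for w
      using half[OF z that] e(2)[OF that] by linarith
    show "integrable M (\<lambda>w. c w * \<psi> (z + \<tau> w))"
      using int\<psi> z \<delta> by auto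
    fix b :: 'a assume b: "b \<in> Basis"
    show "(\<lambda>w. c w * partial b \<psi> (z + \<tau> w)) \<in> borel_measurable M"
      using c \<tau> by (intro borel_measurable_times measurable_compose[OF _ homogeneous_kernel_measurable[OF homogeneous_kernel_partial[OF hk b]]]) auto
    fix w assume w: "w \<in> space M"
    let ?r = "norm (z + \<tau> w)" and ?s = "norm (z0 + \<tau> w)"
    have r: "e / 2 \<le> ?r" "?r > 0" "z + \<tau> w \<noteq> 0" "?s / 2 \<le> ?r" "?s > 0"
      using e2[OF w] e(1) half[OF z w] e(2)[OF w] by auto
    have "\<bar>partial b \<psi> (z + \<tau> w)\<bar> \<le> C b * ?r powr (d' - 1)" using C(2)[OF b r(3)] .
    also have "\<dots> \<le> K * ?r powr (d' - 1)" by (intro mult_right_mono K b) auto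
    also have "?r powr (d' - 1) = ?r powr ?q * ?r powr d" using r by (simp add: powr_add[symmetric])
    also have "\<dots> \<le> (e/2) powr ?q * (?s / 2) powr d"
      using r e d by (intro mult_mono powr_mono2') auto
    also have "(?s / 2) powr d = (1/2) powr d * ?s powr d" using powr_mult[of "1/2" ?s d] r by simp
    finally have "\<bar>partial b \<psi> (z + \<tau> w)\<bar> \<le> K * ((e/2) powr ?q * ((1/2) powr d * ?s powr d))"
      using K0 by (simp add: mult_left_mono)
    then have "\<bar>c w\<bar> * \<bar>partial b \<psi> (z + \<tau> w)\<bar> \<le> \<bar>c w\<bar> * (K * ((e/2) powr ?q * ((1/2) powr d * ?s powr d)))"
      by (intro mult_left_mono) auto
    then show "\<bar>c w * partial b \<psi> (z + \<tau> w)\<bar> \<le> (K * (e/2) powr ?q * (1/2) powr d) * \<bar>c w * norm (z0 + \<tau> w) powr d\<bar>"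
      by (simp add: abs_mult mult_ac)
  next
    fix w assume w: "w \<in> space M"
    show "has_gradient (\<lambda>z. c w * \<psi> (z + \<tau> w)) (\<lambda>b z. c w * partial b \<psi> (z + \<tau> w)) (ball z0 \<delta>)"
    proof (rule has_gradient_cmult, unfold has_gradient_def, rule ballI)
      fix z assume z: "z \<in> ball z0 \<delta>"
      have "z + \<tau> w \<in> - {0}" using half[OF z w] e(2)[OF w] e(1) by auto
      then show "((\<lambda>z. \<psi> (z + \<tau> w)) has_derivative (\<lambda>v. \<Sum>b\<in>Basis. (v \<bullet> b) * partial b \<psi> (z + \<tau> w))) (at z)"
        by (intro has_derivative_compose[of "\<lambda>z. z + \<tau> w" "\<lambda>v. v" z UNIV, OF _ has_gradientD[OF homogeneous_kernel_gradient[OF hk]]])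
           (auto intro!: derivative_eq_intros)
    qed
  qed (use int[OF z0] in auto)
  then show "((\<lambda>z. \<integral>w. c w * \<psi> (z + \<tau> w) \<partial>M) has_derivative
      (\<lambda>v. \<Sum>b\<in>Basis. (v \<bullet> b) * (\<integral>w. c w * partial b \<psi> (z0 + \<tau> w) \<partial>M))) (at z0)"
    using \<delta>(1) by (intro has_gradientD) auto
qed

text \<open>
  The previous lemma, applied to the kernel and to its partial derivatives of first and second
  order, gives two derivatives and the continuity of the second; the Laplacian is taken under the
  integral.
\<close>

lemma harmonic_on_kernel_integral:
  fixes \<tau> :: "'w \<Rightarrow> 'a::euclidean_space"
  assumes hk: "homogeneous_kernel d' \<psi>" and d: "d' - 1 \<le> d" "d \<le> 0" and lap: "\<And>z. z \<noteq> 0 \<Longrightarrow> laplacian \<psi> z = 0" and U: "open U"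
    and c: "c \<in> borel_measurable M" and \<tau>: "\<tau> \<in> borel_measurable M"
    and int\<psi>: "\<And>z. z \<in> U \<Longrightarrow> integrable M (\<lambda>w. c w * \<psi> (z + \<tau> w))"
    and int: "\<And>z. z \<in> U \<Longrightarrow> integrable M (\<lambda>w. c w * norm (z + \<tau> w) powr d)"
    and gap: "\<And>z. z \<in> U \<Longrightarrow> \<exists>e>0. \<forall>w\<in>space M. e \<le> norm (z + \<tau> w)"
  shows "harmonic_on (\<lambda>z. \<integral>w. c w * \<psi> (z + \<tau> w) \<partial>M) U"
proof (rule harmonic_onI)
  have grad: "has_gradient (\<lambda>z. \<integral>w. c w * \<phi> (z + \<tau> w) \<partial>M) (\<lambda>b z. \<integral>w. c w * partial b \<phi> (z + \<tau> w) \<partial>M) U"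
    if hk: "homogeneous_kernel d'' \<phi>" and d'': "d'' \<le> d" for d'' \<phi>
  proof (rule has_gradient_kernel_integral[OF hk _ d(2) U c \<tau> _ int gap])
    fix z assume z: "z \<in> U"
    obtain e where e: "e > 0" "\<And>w. w \<in> space M \<Longrightarrow> e \<le> norm (z + \<tau> w)" using gap[OF z] by blast
    show "integrable M (\<lambda>w. c w * \<phi> (z + \<tau> w))"
      by (rule integrable_kernel_bound[OF hk d'' c \<tau> int[OF z] e])
  qed (use d'' in auto)
  show "has_gradient (\<lambda>z. \<integral>w. c w * \<psi> (z + \<tau> w) \<partial>M) (\<lambda>b z. \<integral>w. c w * partial b \<psi> (z + \<tau> w) \<partial>M) U"
    by (rule has_gradient_kernel_integral[OF hk d U c \<tau> int\<psi> int gap])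
  fix b :: 'a assume b: "b \<in> Basis"
  have hkb: "homogeneous_kernel (d' - 1) (partial b \<psi>)" by (intro homogeneous_kernel_partial hk b)
  show "has_gradient (\<lambda>z. \<integral>w. c w * partial b \<psi> (z + \<tau> w) \<partial>M) (\<lambda>a z. \<integral>w. c w * partial a (partial b \<psi>) (z + \<tau> w) \<partial>M) U"
    by (rule grad[OF hkb d(1)])
  fix a :: 'a assume a: "a \<in> Basis"
  have "homogeneous_kernel (d' - 1 - 1) (partial a (partial b \<psi>))" by (intro homogeneous_kernel_partial hkb a)
  from has_gradient_imp_continuous_on[OF grad[OF this]]
  show "continuous_on U (\<lambda>z. \<integral>w. c w * partial a (partial b \<psi>) (z + \<tau> w) \<partial>M)" using d(1) by simp
next
  fix z assume z: "z \<in> U"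
  obtain e where e: "e > 0" "\<And>w. w \<in> space M \<Longrightarrow> e \<le> norm (z + \<tau> w)" using gap[OF z] by blast
  have "(\<Sum>b\<in>Basis. \<integral>w. c w * partial b (partial b \<psi>) (z + \<tau> w) \<partial>M) = (\<integral>w. (\<Sum>b\<in>Basis. c w * partial b (partial b \<psi>) (z + \<tau> w)) \<partial>M)"
    by (intro Bochner_Integration.integral_sum[symmetric] integrable_kernel_bound[OF homogeneous_kernel_partial[OF homogeneous_kernel_partial[OF hk]] _ c \<tau> int[OF z] e]) (use d in auto)
  also have "\<dots> = (\<integral>w. 0 \<partial>M)"
  proof (rule Bochner_Integration.integral_cong[OF refl])
    fix w assume w: "w \<in> space M"
    have "z + \<tau> w \<noteq> 0" using e(1) e(2)[OF w] by auto
    from lap[OF this] show "(\<Sum>b\<in>Basis. c w * partial b (partial b \<psi>) (z + \<tau> w)) = 0"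
      by (simp add: laplacian_def sum_distrib_left[symmetric])
  qed
  finally show "(\<Sum>b\<in>Basis. \<integral>w. c w * partial b (partial b \<psi>) (z + \<tau> w) \<partial>M) = 0" by simp
qed

section \<open>The Poisson kernel and its vertical derivatives\<close>

lemma borel_measurable_fst_raw [measurable (raw)]:
  fixes f :: "'w \<Rightarrow> 'a::second_countable_topology \<times> 'b::second_countable_topology"
  assumes "f \<in> borel_measurable M"
  shows "(\<lambda>x. fst (f x)) \<in> borel_measurable M"
  by (rule measurable_compose[OF assms borel_measurable_continuous_onI]) (intro continuous_intros)

lemma borel_measurable_snd_raw [measurable (raw)]:
  fixes f :: "'w \<Rightarrow> 'a::second_countable_topology \<times> 'b::second_countable_topology"
  assumes "f \<in> borel_measurable M"
  shows "(\<lambda>x. snd (f x)) \<in> borel_measurable M"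
  by (rule measurable_compose[OF assms borel_measurable_continuous_onI]) (intro continuous_intros)

text \<open>
  With \<open>N\<close> the dimension, \<open>\<Delta> (z\<^sub>e |z|\<^sup>-\<^sup>N) = 2
  \<partial>\<^sub>e |z|\<^sup>-\<^sup>N + z\<^sub>e \<Delta> |z|\<^sup>-\<^sup>N\<close>, and the
  two terms are \<open>-2 N z\<^sub>e |z|\<^sup>-\<^sup>N\<^sup>-\<^sup>2\<close> and \<open>2 N
  z\<^sub>e |z|\<^sup>-\<^sup>N\<^sup>-\<^sup>2\<close>.
\<close>

lemma laplacian_poisson_profile:
  fixes e :: "'a::euclidean_space"
  defines "N \<equiv> real DIM('a)"
  assumes e: "e \<in> Basis" and z: "z \<noteq> 0"
  shows "laplacian (\<lambda>z. (z \<bullet> e) * norm z powr (- N)) z = 0"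
proof -
  let ?D = "\<lambda>b z. (b \<bullet> e) * norm z powr (- N) + (z \<bullet> e) * (- N * ((z \<bullet> b) * norm z powr (- N - 2)))"
  let ?E = "\<lambda>b c z. (b \<bullet> e) * (- N * ((z \<bullet> c) * norm z powr (- N - 2))) +
     ((c \<bullet> e) * (- N * ((z \<bullet> b) * norm z powr (- N - 2))) +
      (z \<bullet> e) * (- N * ((c \<bullet> b) * norm z powr (- N - 2) + (z \<bullet> b) * ((- N - 2) * ((z \<bullet> c) * norm z powr (- N - 2 - 2))))))"
  have D: "has_gradient (\<lambda>z. (z \<bullet> e) * norm z powr (- N)) ?D (- {0})"
    by (intro has_gradient_inner_times has_gradient_norm_powr)
  have E: "has_gradient (?D b) (?E b) (- {0})" for b
    by (intro has_gradient_add has_gradient_cmult has_gradient_inner_times has_gradient_norm_powr)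
  have second: "partial b (partial b (\<lambda>z. (z \<bullet> e) * norm z powr (- N))) z = ?E b b z" if b: "b \<in> Basis" for b
  proof -
    have "has_gradient (partial b (\<lambda>z. (z \<bullet> e) * norm z powr (- N))) (?E b) (- {0})"
      by (rule has_gradient_cong[OF E[of b] open_minus_zero]) (use partial_eq[OF D _ b] in auto)
    from partial_eq[OF this _ b, of z] z show ?thesis by simp
  qed
  define \<rho> where "\<rho> = norm z powr (- N - 2)"
  have \<rho>': "norm z powr (- N - 2 - 2) * (norm z)\<^sup>2 = \<rho>"
  proof -
    have "(norm z)\<^sup>2 = norm z powr 2" using z by simp
    moreover have "- N - 2 - 2 + 2 = - N - 2" by simp
    ultimately show ?thesis unfolding \<rho>_def by (simp only: powr_add[symmetric])
  qed
  have 1: "(\<Sum>b\<in>Basis. (b \<bullet> e) * (z \<bullet> b)) = z \<bullet> e"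
    by (subst euclidean_inner[of z e]) (simp add: inner_commute mult.commute)
  have 2: "(\<Sum>b\<in>(Basis::'a set). b \<bullet> b) = N" by (simp add: N_def inner_Basis)
  have 3: "(\<Sum>b\<in>Basis. (z \<bullet> b) * (z \<bullet> b)) = (norm z)\<^sup>2"
    unfolding power2_norm_eq_inner by (rule euclidean_inner[symmetric])
  have "laplacian (\<lambda>z. (z \<bullet> e) * norm z powr (- N)) z = (\<Sum>b\<in>Basis. ?E b b z)"
    unfolding laplacian_def by (rule sum.cong) (use second in auto)
  also have "\<dots> = (\<Sum>b\<in>Basis. - 2 * N * \<rho> * ((b \<bullet> e) * (z \<bullet> b)) + - N * (z \<bullet> e) * \<rho> * (b \<bullet> b)
      + N * (N + 2) * (z \<bullet> e) * norm z powr (- N - 2 - 2) * ((z \<bullet> b) * (z \<bullet> b)))"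
    unfolding \<rho>_def by (intro sum.cong refl) (simp add: algebra_simps)
  also have "\<dots> = - 2 * N * \<rho> * (z \<bullet> e) + - N * (z \<bullet> e) * \<rho> * N
      + N * (N + 2) * (z \<bullet> e) * (norm z powr (- N - 2 - 2) * (norm z)\<^sup>2)"
    unfolding sum.distrib sum_distrib_left[symmetric] 1 2 3 by (simp add: mult_ac)
  also have "\<dots> = 0" unfolding \<rho>' by (simp add: algebra_simps)
  finally show ?thesis .
qed

lemma laplacian_cong:
  fixes \<phi> \<psi> :: "'a::euclidean_space \<Rightarrow> real"
  assumes hk: "homogeneous_kernel d \<phi>" and eq: "\<And>z. z \<noteq> 0 \<Longrightarrow> \<phi> z = \<psi> z" and z: "z \<noteq> 0"
  shows "laplacian \<psi> z = laplacian \<phi> z"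
  unfolding laplacian_def
proof (rule sum.cong[OF refl])
  fix b :: 'a assume b: "b \<in> Basis"
  show "partial b (partial b \<psi>) z = partial b (partial b \<phi>) z"
    by (rule partial_cong[OF homogeneous_kernel_partial[OF hk b] _ z b]) (rule partial_cong[OF hk eq _ b, symmetric])
qed

lemma laplacian_cmult:
  assumes hk: "homogeneous_kernel d \<phi>" and z: "z \<noteq> 0"
  shows "laplacian (\<lambda>z. c * \<phi> z) z = c * laplacian \<phi> z"
proof -
  have "partial b (partial b (\<lambda>z. c * \<phi> z)) z = c * partial b (partial b \<phi>) z" if b: "b \<in> Basis" for b
  proof -
    have 1: "partial b (\<lambda>z. c * \<phi> z) z = c * partial b \<phi> z" if "z \<noteq> 0" for z
      by (rule partial_eq[OF has_gradient_cmult[OF homogeneous_kernel_gradient[OF hk]]]) (use that b in auto)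
    show ?thesis
      by (rule partial_eq[OF has_gradient_cong[OF has_gradient_cmult[OF homogeneous_kernel_gradient[OF homogeneous_kernel_partial[OF hk b]]] open_minus_zero]])
         (use 1 z b in auto)
  qed
  then show ?thesis by (simp add: laplacian_def sum_distrib_left)
qed

definition poisson :: "'n::finite point \<Rightarrow> real" where
  "poisson z = poisson_kernel (fst z) (snd z)"

lemma poisson_kernel_eq:
  fixes z :: "'n::finite point"
  assumes "z \<noteq> 0"
  shows "poisson z = poisson_const TYPE('n) * ((z \<bullet> (0, 1)) * norm z powr (- (real CARD('n) + 1)))"
proof -
  have "(norm (fst z))\<^sup>2 + (snd z)\<^sup>2 = (norm z)\<^sup>2" by (simp add: norm_prod_def)
  then have 1: "poisson z = poisson_const TYPE('n) * (snd z / ((norm z)\<^sup>2) powr ((real CARD('n) + 1) / 2))"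
    unfolding poisson_def poisson_kernel_def by (simp only:)
  have 2: "((norm z)\<^sup>2) powr ((real CARD('n) + 1) / 2) = norm z powr (real CARD('n) + 1)"
  proof -
    have "(norm z)\<^sup>2 = norm z powr 2" using assms by simp
    moreover have "2 * ((real CARD('n) + 1) / 2) = real CARD('n) + 1" by simp
    ultimately show ?thesis by (simp only: powr_powr)
  qed
  have 3: "z \<bullet> (0, 1) = snd z" by (simp add: inner_prod_def)
  show ?thesis unfolding 1 2 3 powr_minus_divide times_divide_eq_right mult_1_right ..
qed

lemma vertical_in_Basis: "(0 :: 'a::euclidean_space, 1 :: real) \<in> Basis"
  by (simp add: Basis_prod_def)

lemma poisson_homogeneous: "homogeneous_kernel (- real CARD('n)) (poisson :: 'n::finite point \<Rightarrow> real)"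
  and poisson_laplacian: "z \<noteq> 0 \<Longrightarrow> laplacian (poisson :: 'n::finite point \<Rightarrow> real) z = 0"
proof -
  let ?N = "real DIM('n point)"
  let ?\<phi> = "\<lambda>z :: 'n point. (z \<bullet> (0, 1)) * norm z powr (- ?N)"
  have N: "?N = real CARD('n) + 1" by simp
  have hk: "homogeneous_kernel (- real CARD('n)) ?\<phi>"
    using homogeneous_kernel.inner_times[OF homogeneous_kernel.norm_powr[of "- ?N"], of "(0,1)"] by simp
  have eq: "poisson_const TYPE('n) * ?\<phi> z = poisson z" if "z \<noteq> 0" for z
    using poisson_kernel_eq[OF that] by (simp only: N)
  show "homogeneous_kernel (- real CARD('n)) (poisson :: 'n point \<Rightarrow> real)"
    by (rule homogeneous_kernel.cong[OF homogeneous_kernel.cmult[OF hk] eq])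
  assume z: "z \<noteq> 0"
  have "laplacian poisson z = laplacian (\<lambda>z. poisson_const TYPE('n) * ?\<phi> z) z"
    by (rule laplacian_cong[OF homogeneous_kernel.cmult[OF hk] eq z])
  also have "\<dots> = 0"
    using laplacian_cmult[OF hk z] laplacian_poisson_profile[OF vertical_in_Basis z] by simp
  finally show "laplacian (poisson :: 'n point \<Rightarrow> real) z = 0" .
qed

definition poisson_deriv :: "nat \<Rightarrow> 'n::finite point \<Rightarrow> real" where
  "poisson_deriv k = (partial (0, 1) ^^ k) poisson"

lemma poisson_deriv_0: "poisson_deriv 0 = poisson"
  and poisson_deriv_Suc: "poisson_deriv (Suc k) = partial (0, 1) (poisson_deriv k)"
  by (simp_all add: poisson_deriv_def comp_def)

lemma poisson_deriv_homogeneous: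
  "homogeneous_kernel (- (real CARD('n) + real k)) (poisson_deriv k :: 'n::finite point \<Rightarrow> real)"
proof (induction k)
  case 0
  then show ?case using poisson_homogeneous by (simp add: poisson_deriv_0)
next
  case (Suc k)
  have "- (real CARD('n) + real k) - 1 = - (real CARD('n) + real (Suc k))" by simp
  then show ?case using homogeneous_kernel_partial[OF Suc vertical_in_Basis] by (simp only: poisson_deriv_Suc)
qed

lemma poisson_deriv_laplacian:
  "z \<noteq> 0 \<Longrightarrow> laplacian (poisson_deriv k :: 'n::finite point \<Rightarrow> real) z = 0"
proof (induction k arbitrary: z)
  case 0
  show ?case unfolding poisson_deriv_0 by (rule poisson_laplacian[OF 0])
next
  case (Suc k)
  show ?case unfolding poisson_deriv_Suc
    by (rule laplacian_partial_zero[OF poisson_deriv_homogeneous Suc.IH vertical_in_Basis Suc.prems])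
qed

text \<open>
  The Bergman kernel is defined by iterated one-variable derivatives; this identifies them with the
  vertical partial derivatives of the Poisson kernel, to which the estimates for homogeneous kernels
  apply.
\<close>

lemma higher_deriv_poisson:
  fixes x :: "real ^ 'n::finite"
  assumes "t + s > 0"
  shows "(deriv ^^ k) (\<lambda>t. poisson_kernel x (t + s)) t = poisson_deriv k (x, t + s)"
  using assms
proof (induction k arbitrary: t)
  case 0
  show ?case unfolding poisson_deriv_0 poisson_def by simp
next
  case (Suc k)
  let ?f = "\<lambda>t. poisson_deriv k (x, t + s)"
  have "(x, s) + t *\<^sub>R (0, 1) \<in> - {0}" using Suc.prems by (auto simp: zero_prod_def)
  from has_gradient_line[OF homogeneous_kernel_gradient[OF poisson_deriv_homogeneous] this vertical_in_Basis]
  have "(?f has_real_derivative poisson_deriv (Suc k) (x, t + s)) (at t)"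
    by (simp add: poisson_deriv_Suc add.commute)
  then have "((deriv ^^ k) (\<lambda>t. poisson_kernel x (t + s)) has_real_derivative poisson_deriv (Suc k) (x, t + s)) (at t)"
    by (rule has_field_derivative_transform_within_open[where S="{-s<..}"]) (use Suc in auto)
  then show ?case by (simp add: DERIV_imp_deriv)
qed

lemma bergman_kernel_eq:
  fixes z w :: "'n::finite point"
  assumes "snd z > 0" "snd w > 0"
  shows "bergman_kernel l z w = (-2) ^ (l + 1) / fact l * poisson_deriv (l + 1) (fst z - fst w, snd z + snd w)"
  unfolding bergman_kernel_def by (subst higher_deriv_poisson) (use assms in auto)

section \<open>Integral estimates for the kernels\<close>

lemma nn_integral_powr_atLeast:
  assumes "e < -1" "a > 0"
  shows "(\<integral>\<^sup>+r. ennreal (r powr e) * indicator {a..} r \<partial>lborel) = ennreal (a powr (e + 1) / (- e - 1))"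
proof -
  have "(\<integral>\<^sup>+r. ennreal (r powr e) * indicator {a..} r \<partial>lborel) = ennreal (- (a powr (e + 1)) / (e + 1))"
    by (rule nn_integral_has_integral_lebesgue'[OF _ has_integral_powr_to_inf[OF assms]]) auto
  also have "- (a powr (e + 1)) / (e + 1) = a powr (e + 1) / (- e - 1)"
    using minus_divide_divide[of "a powr (e + 1)" "- e - 1"] by (simp add: field_simps)
  finally show ?thesis .
qed

text \<open>
  Layer cake: with \<open>\<rho> = norm (x - y, \<tau>)\<close>, the power \<open>\<rho> powr
  (-q)\<close> is the integral of \<open>q * r powr (-q - 1)\<close> over \<open>r \<ge>
  \<rho>\<close>. For fixed \<open>r\<close> the points \<open>y\<close> with \<open>\<rho> \<le>
  r\<close> lie in the ball of radius \<open>r\<close> about \<open>x\<close>, and there are none if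
  \<open>r < \<tau>\<close>; what remains is a one-dimensional integral over \<open>r \<ge>
  \<tau>\<close>.
\<close>

lemma nn_integral_kernel_slice:
  fixes x :: "'a::euclidean_space"
  assumes q: "q > real DIM('a)" and \<tau>: "\<tau> > 0"
  shows "(\<integral>\<^sup>+y. ennreal (norm (x - y, \<tau>) powr (- q)) \<partial>lborel) \<le>
    ennreal (unit_ball_vol (real DIM('a)) * q / (q - real DIM('a)) * \<tau> powr (real DIM('a) - q))"
proof -
  let ?n = "real DIM('a)"
  define V where "V = unit_ball_vol ?n"
  have V: "V \<ge> 0" unfolding V_def by simp
  define h where "h y r = ennreal (q * r powr (- q - 1)) * indicator {norm (x - y, \<tau>)..} r" for y r
  have nrm: "norm (x - y, \<tau>) \<ge> \<tau>" "norm (x - y, \<tau>) \<ge> norm (x - y)" for y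
    using norm_snd_le[of \<tau> "x - y"] norm_fst_le[of "x - y" \<tau>] \<tau> by auto
  have "(\<integral>\<^sup>+r. h y r \<partial>lborel) = ennreal (norm (x - y, \<tau>) powr (- q))" for y
  proof -
    have "(\<integral>\<^sup>+r. h y r \<partial>lborel) = (\<integral>\<^sup>+r. ennreal q * (ennreal (r powr (- q - 1)) * indicator {norm (x - y, \<tau>)..} r) \<partial>lborel)"
      using q by (intro nn_integral_cong) (simp add: h_def ennreal_mult mult.assoc)
    also have "\<dots> = ennreal q * (\<integral>\<^sup>+r. ennreal (r powr (- q - 1)) * indicator {norm (x - y, \<tau>)..} r \<partial>lborel)"
      by (rule nn_integral_cmult) measurable
    also have "\<dots> = ennreal q * ennreal (norm (x - y, \<tau>) powr (- q - 1 + 1) / (- (- q - 1) - 1))"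
      using q nrm(1)[of y] \<tau> by (subst nn_integral_powr_atLeast) auto
    also have "\<dots> = ennreal (norm (x - y, \<tau>) powr (- q))" 
      using q by (subst ennreal_mult[symmetric]) auto
    finally show ?thesis .
  qed
  then have "(\<integral>\<^sup>+y. ennreal (norm (x - y, \<tau>) powr (- q)) \<partial>lborel) = (\<integral>\<^sup>+y. \<integral>\<^sup>+r. h y r \<partial>lborel \<partial>lborel)"
    by simp
  also have "\<dots> = (\<integral>\<^sup>+r. \<integral>\<^sup>+y. h y r \<partial>lborel \<partial>lborel)"
  proof (rule lborel_pair.Fubini'[symmetric])
    have eq: "case_prod h = (\<lambda>u. ennreal (q * snd u powr (- q - 1)) * indicator {u. norm (x - fst u, \<tau>) \<le> snd u} u)"
      by (auto simp: h_def fun_eq_iff indicator_def)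
    have "closed {u :: 'a \<times> real. norm (x - fst u, \<tau>) \<le> snd u}"
      by (intro closed_Collect_le continuous_intros)
    then have [measurable]: "{u :: 'a \<times> real. norm (x - fst u, \<tau>) \<le> snd u} \<in> sets borel" by (rule borel_closed)
    have "(\<lambda>u :: 'a \<times> real. ennreal (q * snd u powr (- q - 1)) * indicator {u. norm (x - fst u, \<tau>) \<le> snd u} u) \<in> borel_measurable borel"
      by measurable
    then show "case_prod h \<in> borel_measurable (lborel \<Otimes>\<^sub>M lborel)"
      unfolding eq lborel_prod by simp
  qed
  also have "\<dots> \<le> (\<integral>\<^sup>+r. ennreal (q * V) * (ennreal (r powr (?n - q - 1)) * indicator {\<tau>..} r) \<partial>lborel)"
  proof (rule nn_integral_mono)
    fix r :: real
    show "(\<integral>\<^sup>+y. h y r \<partial>lborel) \<le> ennreal (q * V) * (ennreal (r powr (?n - q - 1)) * indicator {\<tau>..} r)"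
    proof (cases "r \<ge> \<tau>")
      case True
      have "(\<integral>\<^sup>+y. h y r \<partial>lborel) \<le> (\<integral>\<^sup>+y. ennreal (q * r powr (- q - 1)) * indicator (cball x r) y \<partial>lborel)"
      proof (rule nn_integral_mono)
        fix y show "h y r \<le> ennreal (q * r powr (- q - 1)) * indicator (cball x r) y"
          using nrm(2)[of y] by (auto simp: h_def indicator_def dist_norm)
      qed
      also have "\<dots> = ennreal (q * r powr (- q - 1)) * ennreal (V * r ^ DIM('a))"
        using True \<tau> by (subst nn_integral_cmult_indicator) (auto simp: emeasure_cball V_def)
      also have "r ^ DIM('a) = r powr ?n" using True \<tau> by (simp add: powr_realpow)
      also have "ennreal (q * r powr (- q - 1)) * ennreal (V * r powr ?n) = ennreal (q * V * (r powr (- q - 1) * r powr ?n))"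
        using q V by (subst ennreal_mult[symmetric]) (simp_all add: mult_ac)
      also have "r powr (- q - 1) * r powr ?n = r powr (?n - q - 1)"
      proof -
        have "- q - 1 + ?n = ?n - q - 1" by simp
        then show ?thesis by (simp only: powr_add[symmetric])
      qed
      also have "ennreal (q * V * r powr (?n - q - 1)) = ennreal (q * V) * (ennreal (r powr (?n - q - 1)) * indicator {\<tau>..} r)"
        using True q V by (simp add: ennreal_mult)
      finally show ?thesis .
    next
      case False
      have "h y r = 0" for y
      proof -
        have "r \<notin> {norm (x - y, \<tau>)..}" using False nrm(1)[of y] by simp
        then show ?thesis unfolding h_def by (simp del: atLeast_iff)
      qed
      then show ?thesis by simp
    qed
  qed
  also have "\<dots> = ennreal (q * V) * (\<integral>\<^sup>+r. ennreal (r powr (?n - q - 1)) * indicator {\<tau>..} r \<partial>lborel)"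
    by (rule nn_integral_cmult) measurable
  also have "\<dots> = ennreal (q * V) * ennreal (\<tau> powr (?n - q - 1 + 1) / (- (?n - q - 1) - 1))"
    using q \<tau> by (subst nn_integral_powr_atLeast) auto
  also have "\<dots> = ennreal (V * q / (q - ?n) * \<tau> powr (?n - q))"
    using q V by (subst ennreal_mult[symmetric]) (auto simp: field_simps)
  finally show ?thesis unfolding V_def .
qed

text \<open>
  Split at \<open>s = t\<close> and bound \<open>t + s\<close> from below by the larger of the two.
\<close>

lemma nn_integral_beta_type:
  assumes \<beta>: "\<beta> > -1" and \<gamma>: "\<gamma> > \<beta> + 1" and t: "t > 0"
  shows "(\<integral>\<^sup>+s. ennreal (s powr \<beta> * (t + s) powr (- \<gamma>)) * indicator {0<..} s \<partial>lborel) \<le>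
     ennreal ((1 / (\<beta> + 1) + 1 / (\<gamma> - \<beta> - 1)) * t powr (\<beta> + 1 - \<gamma>))"
proof -
  have "(\<integral>\<^sup>+s. ennreal (s powr \<beta> * (t + s) powr (- \<gamma>)) * indicator {0<..} s \<partial>lborel) \<le>
    (\<integral>\<^sup>+s. ennreal (t powr (- \<gamma>)) * (ennreal (s powr \<beta>) * indicator {0..t} s) + ennreal (s powr (\<beta> - \<gamma>)) * indicator {t..} s \<partial>lborel)"
  proof (rule nn_integral_mono)
    fix s :: real
    show "ennreal (s powr \<beta> * (t + s) powr (- \<gamma>)) * indicator {0<..} s \<le>
      ennreal (t powr (- \<gamma>)) * (ennreal (s powr \<beta>) * indicator {0..t} s) + ennreal (s powr (\<beta> - \<gamma>)) * indicator {t..} s"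
    proof (cases "s > 0")
      case True
      show ?thesis
      proof (cases "s \<le> t")
        case le: True
        have "s powr \<beta> * (t + s) powr (- \<gamma>) \<le> t powr (- \<gamma>) * s powr \<beta>"
          using True t \<beta> \<gamma> by (subst mult.commute, intro mult_right_mono powr_mono2') auto
        then have "ennreal (s powr \<beta> * (t + s) powr (- \<gamma>)) \<le> ennreal (t powr (- \<gamma>)) * ennreal (s powr \<beta>)"
          by (subst ennreal_mult[symmetric]) (auto intro: ennreal_leI)
        then show ?thesis using True le by (simp add: add_increasing2)
      next
        case False
        have "s powr \<beta> * (t + s) powr (- \<gamma>) \<le> s powr \<beta> * s powr (- \<gamma>)"
          using True t \<beta> \<gamma> by (intro mult_left_mono powr_mono2') auto
        also have "\<dots> = s powr (\<beta> - \<gamma>)" by (simp add: powr_add[symmetric])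
        finally show ?thesis using True False by (simp add: ennreal_leI)
      qed
    qed simp
  qed
  also have "\<dots> = ennreal (t powr (- \<gamma>)) * (\<integral>\<^sup>+s. ennreal (s powr \<beta>) * indicator {0..t} s \<partial>lborel)
      + (\<integral>\<^sup>+s. ennreal (s powr (\<beta> - \<gamma>)) * indicator {t..} s \<partial>lborel)"
    by (subst nn_integral_add) (auto simp: nn_integral_cmult)
  also have "(\<integral>\<^sup>+s. ennreal (s powr \<beta>) * indicator {0..t} s \<partial>lborel) = ennreal (t powr (\<beta> + 1) / (\<beta> + 1))"
    by (rule nn_integral_has_integral_lebesgue'[OF _ has_integral_powr_from_0]) (use \<beta> t in auto)
  also have "(\<integral>\<^sup>+s. ennreal (s powr (\<beta> - \<gamma>)) * indicator {t..} s \<partial>lborel) = ennreal (t powr (\<beta> - \<gamma> + 1) / (- (\<beta> - \<gamma>) - 1))"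
    by (rule nn_integral_powr_atLeast) (use \<gamma> t in auto)
  also have "ennreal (t powr (- \<gamma>)) * ennreal (t powr (\<beta> + 1) / (\<beta> + 1)) = ennreal (1 / (\<beta> + 1) * t powr (\<beta> + 1 - \<gamma>))"
    using \<beta> by (subst ennreal_mult[symmetric]) (auto simp: powr_add[symmetric] algebra_simps)
  also have "ennreal (1 / (\<beta> + 1) * t powr (\<beta> + 1 - \<gamma>)) + ennreal (t powr (\<beta> - \<gamma> + 1) / (- (\<beta> - \<gamma>) - 1)) =
      ennreal ((1 / (\<beta> + 1) + 1 / (\<gamma> - \<beta> - 1)) * t powr (\<beta> + 1 - \<gamma>))"
  proof -
    have "t powr (\<beta> - \<gamma> + 1) / (- (\<beta> - \<gamma>) - 1) = 1 / (\<gamma> - \<beta> - 1) * t powr (\<beta> + 1 - \<gamma>)"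
      by (simp add: algebra_simps)
    then show ?thesis using \<beta> \<gamma> by (simp add: ennreal_plus[symmetric] distrib_right del: ennreal_plus)
  qed
  finally show ?thesis .
qed

lemma open_upper_half_space: "open (\<H> :: 'n::finite point set)"
  unfolding upper_half_space_def by (intro open_Collect_less continuous_intros)

lemma upper_half_space_measurable [measurable]: "(\<H> :: 'n::finite point set) \<in> sets borel"
  using open_upper_half_space by (rule borel_open)

text \<open>
  The distance from \<open>z\<close> to the mirror image of \<open>w\<close> in the boundary of the
  half-space.
\<close>

definition reflected_dist :: "'n::finite point \<Rightarrow> 'n::finite point \<Rightarrow> real" where
  "reflected_dist z w = norm (fst z - fst w, snd z + snd w)"

lemma reflected_dist_commute: "reflected_dist z w = reflected_dist w z"
  unfolding reflected_dist_def norm_Pair by (simp add: norm_minus_commute add.commute)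

lemma reflected_dist_measurable [measurable]:
  "(\<lambda>u. reflected_dist (fst u) (snd u)) \<in> borel_measurable (borel :: ('n::finite point \<times> 'n point) measure)"
  "(\<lambda>w. reflected_dist z w) \<in> borel_measurable (borel :: 'n::finite point measure)"
  "(\<lambda>z. reflected_dist z w) \<in> borel_measurable (borel :: 'n::finite point measure)"
  unfolding reflected_dist_def by (intro borel_measurable_continuous_onI continuous_intros)+

lemma reflected_dist_ge:
  assumes "snd z > 0" "snd w > 0" shows "snd w \<le> reflected_dist z w" "reflected_dist z w > 0"
  using norm_snd_le[of "snd z + snd w" "fst z - fst w"] assms by (auto simp: reflected_dist_def)

text \<open>
  Integration over horizontal slices leaves the one-dimensional integral of
  \<open>nn_integral_beta_type\<close>, with \<open>\<gamma> = q - n\<close>.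
\<close>

lemma half_space_kernel_estimate:
  assumes \<beta>: "\<beta> > -1" and q: "q > real CARD('n) + 1 + \<beta>"
  obtains C where "C > 0" "\<And>z :: 'n::finite point. snd z > 0 \<Longrightarrow>
    (\<integral>\<^sup>+w\<in>\<H>. ennreal (reflected_dist z w powr (- q) * snd w powr \<beta>) \<partial>lborel)
      \<le> ennreal (C * snd z powr (real CARD('n) + 1 + \<beta> - q))"
proof -
  let ?n = "real CARD('n)"
  define A where "A = unit_ball_vol ?n * q / (q - ?n)"
  define B where "B = 1 / (\<beta> + 1) + 1 / (q - ?n - \<beta> - 1)"
  have A: "A > 0" unfolding A_def using q \<beta> by (intro divide_pos_pos mult_pos_pos) auto
  have B: "B > 0" unfolding B_def using q \<beta> by (intro add_pos_pos) auto
  show thesis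
  proof (rule that[of "A * B"])
    show "A * B > 0" using A B by simp
    fix z :: "'n point" assume z: "snd z > 0"
    obtain x t where zt: "z = (x, t)" by (cases z)
    have t: "t > 0" using z zt by simp
    let ?f = "\<lambda>w :: 'n point. ennreal (reflected_dist z w powr (- q) * snd w powr \<beta>) * indicator \<H> w"
    have f: "?f \<in> borel_measurable (borel :: 'n point measure)" by measurable
    have "(\<integral>\<^sup>+w. ?f w \<partial>lborel) = (\<integral>\<^sup>+s. \<integral>\<^sup>+y. ?f (y, s) \<partial>lborel \<partial>lborel)"
      by (subst lborel_pair.nn_integral_snd) (use f in \<open>simp_all add: lborel_prod\<close>)
    also have "\<dots> \<le> (\<integral>\<^sup>+s. ennreal A * (ennreal (s powr \<beta> * (t + s) powr (- (q - ?n))) * indicator {0<..} s) \<partial>lborel)"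
    proof (rule nn_integral_mono)
      fix s :: real
      show "(\<integral>\<^sup>+y. ?f (y, s) \<partial>lborel) \<le> ennreal A * (ennreal (s powr \<beta> * (t + s) powr (- (q - ?n))) * indicator {0<..} s)"
      proof (cases "s > 0")
        case True
        have "(\<integral>\<^sup>+y. ?f (y, s) \<partial>lborel) = (\<integral>\<^sup>+y. ennreal (s powr \<beta>) * ennreal (norm (x - y, t + s) powr (- q)) \<partial>lborel)"
          using True by (intro nn_integral_cong) (simp add: zt upper_half_space_def reflected_dist_def ennreal_mult mult.commute)
        also have "\<dots> = ennreal (s powr \<beta>) * (\<integral>\<^sup>+y. ennreal (norm (x - y, t + s) powr (- q)) \<partial>lborel)"
          by (rule nn_integral_cmult) measurable
        also have "\<dots> \<le> ennreal (s powr \<beta>) * ennreal (A * (t + s) powr (?n - q))"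
          using nn_integral_kernel_slice[of q "t + s" x] q \<beta> t True unfolding A_def by (intro mult_left_mono) auto
        also have "\<dots> = ennreal A * ennreal (s powr \<beta> * (t + s) powr (- (q - ?n)))"
          using A by (simp add: ennreal_mult[symmetric] mult_ac)
        finally show ?thesis using True by simp
      next
        case False
        then have "(\<integral>\<^sup>+y. ?f (y, s) \<partial>lborel) = (\<integral>\<^sup>+(y :: real ^ 'n). 0 \<partial>lborel)"
          by (intro nn_integral_cong) (simp add: upper_half_space_def)
        also have "\<dots> = 0" by simp
        finally show ?thesis by (simp only: zero_le)
      qed
    qed
    also have "\<dots> = ennreal A * (\<integral>\<^sup>+s. ennreal (s powr \<beta> * (t + s) powr (- (q - ?n))) * indicator {0<..} s \<partial>lborel)"
      by (rule nn_integral_cmult) measurable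
    also have "\<dots> \<le> ennreal A * ennreal (B * t powr (\<beta> + 1 - (q - ?n)))"
      unfolding B_def by (intro mult_left_mono nn_integral_beta_type) (use \<beta> q t in auto)
    also have "\<dots> = ennreal (A * B * snd z powr (?n + 1 + \<beta> - q))"
      using A B zt by (subst ennreal_mult[symmetric]) (auto simp: algebra_simps)
    finally show "(\<integral>\<^sup>+w. ?f w \<partial>lborel) \<le> ennreal (A * B * snd z powr (?n + 1 + \<beta> - q))" .
  qed
qed

lemma integral_lborel_affine:
  fixes f :: "'a::euclidean_space \<Rightarrow> real"
  assumes f: "f \<in> borel_measurable borel" and c: "c \<noteq> 0"
  shows "(\<integral>y. f y \<partial>lborel) = (\<integral>v. \<bar>c\<bar> ^ DIM('a) * f (x + c *\<^sub>R v) \<partial>lborel)"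
proof -
  have "(\<integral>y. f y \<partial>lborel) = (\<integral>y. f y \<partial>density (distr lborel borel (\<lambda>v. x + c *\<^sub>R v)) (\<lambda>_. ennreal (\<bar>c\<bar> ^ DIM('a))))"
    using lborel_affine[OF c, of x] by simp
  also have "\<dots> = (\<integral>y. \<bar>c\<bar> ^ DIM('a) *\<^sub>R f y \<partial>distr lborel borel (\<lambda>v. x + c *\<^sub>R v))"
    using f by (intro integral_density) auto
  also have "\<dots> = (\<integral>v. \<bar>c\<bar> ^ DIM('a) *\<^sub>R f (x + c *\<^sub>R v) \<partial>lborel)"
    using f by (intro integral_distr) auto
  finally show ?thesis by simp
qed

lemma kernel_slice_integrable:
  fixes x :: "'a::euclidean_space" and \<tau> :: real
  assumes q: "q > real DIM('a)" and \<tau>: "\<tau> > 0"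
  shows "integrable lborel (\<lambda>y. norm (x - y, \<tau>) powr (- q))"
  by (rule integrableI_bounded)
     (use nn_integral_kernel_slice[OF q \<tau>, of x] in \<open>auto intro: le_less_trans\<close>)

lemma poisson_nonneg: "\<tau> > 0 \<Longrightarrow> poisson (x, \<tau>) \<ge> 0"
  unfolding poisson_def poisson_kernel_def poisson_const_def by (simp add: integral_nonneg)

lemma poisson_integrable:
  fixes x :: "real ^ 'n::finite"
  assumes \<tau>: "\<tau> > 0"
  shows "integrable lborel (\<lambda>y. poisson (x - y, \<tau>))"
proof -
  have "integrable lborel (\<lambda>y. (poisson_const TYPE('n) * \<tau>) * norm (x - y, \<tau>) powr (- (real CARD('n) + 1)))"
    by (intro integrable_mult_right kernel_slice_integrable \<tau>) auto
  moreover have "(poisson_const TYPE('n) * \<tau>) * norm (x - y, \<tau>) powr (- (real CARD('n) + 1)) = poisson (x - y, \<tau>)" for y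
    using \<tau> by (subst poisson_kernel_eq) (auto simp: zero_prod_def)
  ultimately show ?thesis by (simp only:)
qed

lemma poisson_integral_1: "(\<integral>y. poisson (y :: real ^ 'n::finite, 1) \<partial>lborel) = 1"
proof -
  let ?g = "\<lambda>x :: real ^ 'n. 1 / ((norm x)\<^sup>2 + 1) powr ((real CARD('n) + 1) / 2)"
  have g: "?g x = norm (0 - x, 1::real) powr (- (real CARD('n) + 1))" for x
  proof -
    have "norm (0 - x, 1::real) = ((norm x)\<^sup>2 + 1) powr (1/2)"
      by (simp add: norm_Pair powr_half_sqrt)
    moreover have "1 / 2 * (real CARD('n) + 1) = (real CARD('n) + 1) / 2" by simp
    ultimately show ?thesis by (simp only: powr_powr powr_minus_divide)
  qed
  have int: "integrable lborel ?g" unfolding g by (intro kernel_slice_integrable) auto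
  let ?c = "1 / 2 powr ((real CARD('n) + 1) / 2) :: real"
  have "?c * indicator (ball 0 1) x \<le> ?g x" for x :: "real ^ 'n"
  proof (cases "x \<in> ball 0 1")
    case True
    then have "(norm x)\<^sup>2 \<le> 1" by (simp add: power_le_one)
    then have "((norm x)\<^sup>2 + 1) powr ((real CARD('n) + 1) / 2) \<le> 2 powr ((real CARD('n) + 1) / 2)"
      by (intro powr_mono2) auto
    moreover have "0 < ((norm x)\<^sup>2 + 1) powr ((real CARD('n) + 1) / 2)"
      using add_nonneg_pos[of "(norm x)\<^sup>2" 1] by simp
    ultimately show ?thesis using True by (simp add: frac_le)
  qed simp
  then have "(\<integral>x. ?c * indicator (ball 0 1) (x :: real ^ 'n) \<partial>lborel) \<le> (\<integral>x. ?g x \<partial>lborel)"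
    by (intro integral_mono int integrable_mult_right integrable_real_indicator) (auto simp: emeasure_ball)
  moreover have "(\<integral>x. ?c * indicator (ball 0 1) (x :: real ^ 'n) \<partial>lborel) = ?c * measure lborel (ball (0 :: real ^ 'n) 1)"
    by simp
  moreover have "0 < ?c * measure lborel (ball (0 :: real ^ 'n) 1)" by simp
  ultimately have pos: "(\<integral>x. ?g x \<partial>lborel) > 0" by linarith
  have "poisson (y, 1) = poisson_const TYPE('n) * ?g y" for y :: "real ^ 'n"
    by (simp add: poisson_def poisson_kernel_def)
  then have "(\<integral>y. poisson (y :: real ^ 'n, 1) \<partial>lborel) = poisson_const TYPE('n) * (\<integral>x. ?g x \<partial>lborel)"
    by (simp only: integral_mult_right_zero)
  then show ?thesis using pos by (simp add: poisson_const_def)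
qed

lemma poisson_dilate:
  fixes v :: "real ^ 'n::finite"
  assumes \<tau>: "\<tau> > 0"
  shows "\<tau> ^ CARD('n) * poisson (\<tau> *\<^sub>R v, \<tau>) = poisson (v, 1)"
proof -
  have nz: "(\<tau> *\<^sub>R v, \<tau>) \<noteq> 0" "(v, 1::real) \<noteq> 0" using \<tau> by (auto simp: zero_prod_def)
  have "norm (\<tau> *\<^sub>R v, \<tau>) = \<tau> * norm (v, 1::real)"
    using norm_scaleR[of \<tau> "(v, 1::real)"] \<tau> by simp
  then have "norm (\<tau> *\<^sub>R v, \<tau>) powr (- (real CARD('n) + 1)) = \<tau> powr (- (real CARD('n) + 1)) * norm (v, 1::real) powr (- (real CARD('n) + 1))"
    using \<tau> by (simp add: powr_mult)
  moreover have "\<tau> ^ CARD('n) * (\<tau> * \<tau> powr (- (real CARD('n) + 1))) = 1"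
  proof -
    have "\<tau> ^ CARD('n) * (\<tau> * \<tau> powr (- (real CARD('n) + 1))) = \<tau> powr real CARD('n) * (\<tau> powr 1 * \<tau> powr (- (real CARD('n) + 1)))"
      using \<tau> by (simp add: powr_realpow)
    also have "\<dots> = \<tau> powr 0" unfolding powr_add[symmetric] by simp
    finally show ?thesis using \<tau> by simp
  qed
  ultimately show ?thesis unfolding poisson_kernel_eq[OF nz(1)] poisson_kernel_eq[OF nz(2)]
    by (simp add: algebra_simps)
qed

text \<open>
  The substitution \<open>y = x - \<tau> v\<close> removes \<open>\<tau>\<close> from the kernel.
  The right-hand side makes sense for \<open>\<tau> = 0\<close> as well, where it is \<open>g
  x\<close>.
\<close>

lemma poisson_integral_rescale:
  fixes x :: "real ^ 'n::finite"
  assumes \<tau>: "\<tau> > 0" and g: "g \<in> borel_measurable borel"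
  shows "(\<integral>y. g y * poisson (x - y, \<tau>) \<partial>lborel) = (\<integral>v. poisson (v, 1) * g (x - \<tau> *\<^sub>R v) \<partial>lborel)"
proof -
  have m: "(\<lambda>y. g y * poisson (x - y, \<tau>)) \<in> borel_measurable borel"
    by (intro borel_measurable_times g measurable_compose[OF _ homogeneous_kernel_measurable[OF poisson_homogeneous]]
         borel_measurable_continuous_onI continuous_intros)
  have "(\<integral>y. g y * poisson (x - y, \<tau>) \<partial>lborel) =
      (\<integral>v. \<bar>- \<tau>\<bar> ^ DIM(real ^ 'n) * (g (x + (- \<tau>) *\<^sub>R v) * poisson (x - (x + (- \<tau>) *\<^sub>R v), \<tau>)) \<partial>lborel)"
    by (rule integral_lborel_affine[OF m]) (use \<tau> in simp)
  also have "\<dots> = (\<integral>v. poisson (v, 1) * g (x - \<tau> *\<^sub>R v) \<partial>lborel)"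
    using \<tau> by (intro Bochner_Integration.integral_cong) (auto simp: poisson_dilate[OF \<tau>, symmetric])
  finally show ?thesis .
qed

section \<open>The Poisson formula\<close>

lemma poisson_deriv_measurable [measurable]: "(poisson_deriv k :: 'n::finite point \<Rightarrow> real) \<in> borel_measurable borel"
  by (rule homogeneous_kernel_measurable[OF poisson_deriv_homogeneous])

lemma poisson_measurable [measurable]: "(poisson :: 'n::finite point \<Rightarrow> real) \<in> borel_measurable borel"
  by (rule homogeneous_kernel_measurable[OF poisson_homogeneous])

lemma integrable_bounded_times:
  fixes g h :: "'a \<Rightarrow> real"
  assumes "integrable M h" "g \<in> borel_measurable M" "\<And>y. \<bar>g y\<bar> \<le> B"
  shows "integrable M (\<lambda>y. g y * h y)"
proof (rule Bochner_Integration.integrable_bound[where f="\<lambda>y. B * h y"])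
  show "AE y in M. norm (g y * h y) \<le> norm (B * h y)"
  proof (rule AE_I2)
    fix y
    have "\<bar>g y\<bar> \<le> \<bar>B\<bar>" using assms(3)[of y] by linarith
    then show "norm (g y * h y) \<le> norm (B * h y)" by (simp add: abs_mult mult_right_mono)
  qed
qed (use assms in auto)

lemma poisson_deriv_slice_integrable:
  fixes x :: "real ^ 'n::finite"
  assumes \<tau>: "\<tau> > 0"
  shows "integrable lborel (\<lambda>y. poisson_deriv k (x - y, \<tau>))"
proof (cases k)
  case 0
  then show ?thesis using poisson_integrable[OF \<tau>] by (simp add: poisson_deriv_0)
next
  case (Suc j)
  have m: "(\<lambda>y. (x - y, \<tau>)) \<in> borel_measurable (lborel :: (real ^ 'n) measure)"
    unfolding measurable_lborel2 by (intro borel_measurable_continuous_onI continuous_intros)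
  have "integrable lborel (\<lambda>y. 1 * poisson_deriv k (0 + (x - y, \<tau>)))"
  proof (rule integrable_kernel_bound[OF poisson_deriv_homogeneous order_refl _ m, of _ _ _ \<tau>])
    show "integrable lborel (\<lambda>w. 1 * norm (0 + (x - w, \<tau>)) powr - (real CARD('n) + real k))"
      using kernel_slice_integrable[OF _ \<tau>, of "real CARD('n) + real k" x] Suc by simp
    show "\<tau> \<le> norm (0 + (x - w, \<tau>))" for w using norm_snd_le[of \<tau> "x - w"] \<tau> by simp
  qed (use \<tau> in auto)
  then show ?thesis by simp
qed

lemma poisson_deriv_slice_bound:
  obtains C where "C \<ge> 0" "\<And>(x :: real ^ 'n::finite) \<tau>. \<tau> > 0 \<Longrightarrow>
     (\<integral>y. \<bar>poisson_deriv (Suc k) (x - y, \<tau>)\<bar> \<partial>lborel) \<le> C * \<tau> powr (- real (Suc k))"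
proof -
  let ?q = "real CARD('n) + real (Suc k)"
  obtain C where C: "C \<ge> 0" "\<And>z :: 'n point. z \<noteq> 0 \<Longrightarrow> \<bar>poisson_deriv (Suc k) z\<bar> \<le> C * norm z powr (- ?q)"
    using homogeneous_kernel_bound[OF poisson_deriv_homogeneous[of "Suc k"]] by blast
  define A where "A = unit_ball_vol (real CARD('n)) * ?q / (?q - real CARD('n))"
  have A: "A \<ge> 0" unfolding A_def by simp
  show thesis
  proof (rule that[of "C * A"])
    show "C * A \<ge> 0" using C A by simp
    fix x :: "real ^ 'n" and \<tau> :: real assume \<tau>: "\<tau> > 0"
    have nn: "(\<integral>\<^sup>+y. ennreal (norm (x - y, \<tau>) powr (- ?q)) \<partial>lborel) \<le> ennreal (A * \<tau> powr (- real (Suc k)))"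
      using nn_integral_kernel_slice[OF _ \<tau>, of ?q x] unfolding A_def by simp
    have int: "integrable lborel (\<lambda>y. norm (x - y, \<tau>) powr (- ?q))"
      by (intro kernel_slice_integrable \<tau>) simp
    have "ennreal (\<integral>y. norm (x - y, \<tau>) powr (- ?q) \<partial>lborel) \<le> ennreal (A * \<tau> powr (- real (Suc k)))"
      by (subst nn_integral_eq_integral[OF int, symmetric]) (use nn in auto)
    then have le: "(\<integral>y. norm (x - y, \<tau>) powr (- ?q) \<partial>lborel) \<le> A * \<tau> powr (- real (Suc k))"
      using A by (subst (asm) ennreal_le_iff) auto
    have "(\<integral>y. \<bar>poisson_deriv (Suc k) (x - y, \<tau>)\<bar> \<partial>lborel) \<le> (\<integral>y. C * norm (x - y, \<tau>) powr (- ?q) \<partial>lborel)"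
    proof (rule integral_mono)
      show "integrable lborel (\<lambda>y. \<bar>poisson_deriv (Suc k) (x - y, \<tau>)\<bar>)"
        by (intro integrable_abs poisson_deriv_slice_integrable \<tau>)
      show "\<bar>poisson_deriv (Suc k) (x - y, \<tau>)\<bar> \<le> C * norm (x - y, \<tau>) powr (- ?q)" for y
        by (rule C(2)) (use \<tau> in \<open>auto simp: zero_prod_def\<close>)
    qed (intro integrable_mult_right int)
    also have "\<dots> \<le> C * (A * \<tau> powr (- real (Suc k)))" using le C(1) by (simp add: mult_left_mono)
    finally show "(\<integral>y. \<bar>poisson_deriv (Suc k) (x - y, \<tau>)\<bar> \<partial>lborel) \<le> C * A * \<tau> powr (- real (Suc k))"
      by (simp add: mult.assoc)
  qed
qed

lemma poisson_integrable_1: "integrable lborel (\<lambda>v :: real ^ 'n::finite. poisson (v, 1))"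
  using poisson_integral_1[where 'n='n] not_integrable_integral_eq by fastforce

text \<open>
  Dominated convergence with the majorant \<open>B * poisson (v, 1)\<close>. The boundary \<open>snd
  z = 0\<close> is included, so this also gives the boundary values of the Poisson integral.
\<close>

lemma poisson_extension_continuous:
  fixes g :: "real ^ 'n::finite \<Rightarrow> real"
  assumes g: "continuous_on UNIV g" and B: "\<And>y. \<bar>g y\<bar> \<le> B"
  shows "continuous_on S (\<lambda>z. \<integral>v. poisson (v, 1) * g (fst z - snd z *\<^sub>R v) \<partial>lborel)"
proof -
  have gm [measurable]: "g \<in> borel_measurable borel" by (rule borel_measurable_continuous_onI[OF g])
  have pint: "integrable lborel (\<lambda>v :: real ^ 'n. poisson (v, 1))"
    by (rule poisson_integrable_1)
  have m1 [measurable]: "(\<lambda>v :: real ^ 'n. poisson (v, 1)) \<in> borel_measurable borel"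
    using pint by auto
  have m2: "(\<lambda>v. g (fst z - snd z *\<^sub>R v)) \<in> borel_measurable borel" for z :: "'n point"
    by (intro measurable_compose[OF _ gm] borel_measurable_continuous_onI continuous_intros)
  have "isCont (\<lambda>z. \<integral>v. poisson (v, 1) * g (fst z - snd z *\<^sub>R v) \<partial>lborel) z" for z
    unfolding continuous_at_sequentially
  proof (intro allI impI)
    fix X assume X: "X \<longlonglongrightarrow> z"
    have "(\<lambda>i. \<integral>v. poisson (v, 1) * g (fst (X i) - snd (X i) *\<^sub>R v) \<partial>lborel) \<longlonglongrightarrow> (\<integral>v. poisson (v, 1) * g (fst z - snd z *\<^sub>R v) \<partial>lborel)"
    proof (rule integral_dominated_convergence[where w="\<lambda>v. B * poisson (v, 1)"])
      show "AE v in lborel. (\<lambda>i. poisson (v, 1) * g (fst (X i) - snd (X i) *\<^sub>R v)) \<longlonglongrightarrow> poisson (v, 1) * g (fst z - snd z *\<^sub>R v)"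
      proof (rule AE_I2)
        fix v :: "real ^ 'n"
        have "isCont g (fst z - snd z *\<^sub>R v)" using g by (simp add: continuous_on_eq_continuous_at)
        moreover have "(\<lambda>i. fst (X i) - snd (X i) *\<^sub>R v) \<longlonglongrightarrow> fst z - snd z *\<^sub>R v"
          by (intro tendsto_intros X)
        ultimately have "(\<lambda>i. g (fst (X i) - snd (X i) *\<^sub>R v)) \<longlonglongrightarrow> g (fst z - snd z *\<^sub>R v)"
          by (rule isCont_tendsto_compose)
        then show "(\<lambda>i. poisson (v, 1) * g (fst (X i) - snd (X i) *\<^sub>R v)) \<longlonglongrightarrow> poisson (v, 1) * g (fst z - snd z *\<^sub>R v)"
          by (intro tendsto_mult tendsto_const)
      qed
      show "AE v in lborel. norm (poisson (v, 1) * g (fst (X i) - snd (X i) *\<^sub>R v)) \<le> B * poisson (v, 1)" for i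
      proof (rule AE_I2)
        fix v :: "real ^ 'n"
        have "poisson (v, 1) * \<bar>g (fst (X i) - snd (X i) *\<^sub>R v)\<bar> \<le> poisson (v, 1) * B"
          by (intro mult_left_mono B poisson_nonneg) auto
        then show "norm (poisson (v, 1) * g (fst (X i) - snd (X i) *\<^sub>R v)) \<le> B * poisson (v, 1)"
          using poisson_nonneg[of 1 v] by (simp add: abs_mult mult.commute)
      qed
    qed (use pint m1 m2 in \<open>auto intro!: borel_measurable_times\<close>)
    then show "((\<lambda>z. \<integral>v. poisson (v, 1) * g (fst z - snd z *\<^sub>R v) \<partial>lborel) \<circ> X) \<longlonglongrightarrow> (\<integral>v. poisson (v, 1) * g (fst z - snd z *\<^sub>R v) \<partial>lborel)"
      by (simp add: comp_def)
  qed
  then show ?thesis by (simp add: continuous_at_imp_continuous_on)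
qed

lemma poisson_kernel_integral_gradient:
  fixes g :: "real ^ 'n::finite \<Rightarrow> real"
  assumes g: "g \<in> borel_measurable borel" and B: "\<And>y. \<bar>g y\<bar> \<le> B"
  shows "harmonic_on (\<lambda>z. \<integral>y. g y * poisson (fst z - y, snd z) \<partial>lborel) \<H>"
    and "has_gradient (\<lambda>z. \<integral>y. g y * poisson_deriv k (fst z - y, snd z) \<partial>lborel)
          (\<lambda>b z. \<integral>y. g y * partial b (poisson_deriv k) (fst z - y, snd z) \<partial>lborel) \<H>"
proof -
  let ?d = "- (real CARD('n) + 1)"
  have eq: "z + (- y, 0) = (fst z - y, snd z)" for z :: "'n point" and y by (cases z) simp
  have \<tau>: "(\<lambda>y :: real ^ 'n. (- y, 0 :: real)) \<in> borel_measurable lborel"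
    unfolding measurable_lborel2 by (intro borel_measurable_continuous_onI continuous_intros)
  have c: "g \<in> borel_measurable lborel" using g by simp
  have gap: "\<exists>e>0. \<forall>w\<in>space lborel. e \<le> norm (z + (- w, 0))" if "z \<in> \<H>" for z :: "'n point"
    using that norm_snd_le[of "snd z"] unfolding eq upper_half_space_def
    by (intro exI[of _ "snd z"]) (auto intro: order_trans[OF abs_ge_self])
  have int: "integrable lborel (\<lambda>w. g w * norm (z + (- w, 0)) powr d)" if z: "z \<in> \<H>" and d: "d \<le> ?d" for z :: "'n point" and d
    unfolding eq using z d kernel_slice_integrable[of "- d" "snd z" "fst z"]
    by (intro integrable_bounded_times[OF _ c B]) (auto simp: upper_half_space_def)
  have int\<psi>: "integrable lborel (\<lambda>w. g w * poisson_deriv k (z + (- w, 0)))" if z: "z \<in> \<H>" for z :: "'n point" and k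
    unfolding eq using z by (intro integrable_bounded_times[OF _ c B] poisson_deriv_slice_integrable) (auto simp: upper_half_space_def)
  have "harmonic_on (\<lambda>z. \<integral>y. g y * poisson_deriv 0 (z + (- y, 0)) \<partial>lborel) \<H>"
    by (rule harmonic_on_kernel_integral[OF poisson_deriv_homogeneous _ _ poisson_deriv_laplacian open_upper_half_space c \<tau> int\<psi> int[OF _ order_refl] gap]) auto
  then show "harmonic_on (\<lambda>z. \<integral>y. g y * poisson (fst z - y, snd z) \<partial>lborel) \<H>"
    by (simp only: eq poisson_deriv_0)
  have "has_gradient (\<lambda>z. \<integral>y. g y * poisson_deriv k (z + (- y, 0)) \<partial>lborel)
          (\<lambda>b z. \<integral>y. g y * partial b (poisson_deriv k) (z + (- y, 0)) \<partial>lborel) \<H>"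
    by (rule has_gradient_kernel_integral[OF poisson_deriv_homogeneous _ _ open_upper_half_space c \<tau> int\<psi> int[OF _ order_refl] gap]) auto
  then show "has_gradient (\<lambda>z. \<integral>y. g y * poisson_deriv k (fst z - y, snd z) \<partial>lborel)
          (\<lambda>b z. \<integral>y. g y * partial b (poisson_deriv k) (fst z - y, snd z) \<partial>lborel) \<H>"
    by (simp only: eq)
qed

lemma growth_slice:
  fixes f :: "'n::finite point \<Rightarrow> real"
  assumes harm: "harmonic_on f \<H>"
    and bd: "\<And>z. snd z > 0 \<Longrightarrow> \<bar>f z\<bar> \<le> M * snd z powr (- l)" and \<sigma>: "\<sigma> > 0"
  shows "continuous_on UNIV (\<lambda>y. f (y, \<sigma>))" "(\<lambda>y. f (y, \<sigma>)) \<in> borel_measurable borel" "\<bar>f (y, \<sigma>)\<bar> \<le> M * \<sigma> powr (- l)"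
proof -
  show c: "continuous_on UNIV (\<lambda>y. f (y, \<sigma>))"
    by (rule continuous_on_compose2[OF harmonic_on_imp_continuous_on[OF harm]])
       (use \<sigma> in \<open>auto intro!: continuous_intros simp: upper_half_space_def\<close>)
  show "(\<lambda>y. f (y, \<sigma>)) \<in> borel_measurable borel" by (rule borel_measurable_continuous_onI[OF c])
  show "\<bar>f (y, \<sigma>)\<bar> \<le> M * \<sigma> powr (- l)" using bd[of "(y, \<sigma>)"] \<sigma> by simp
qed

text \<open>
  As functions of \<open>(x, \<tau>)\<close> both sides are harmonic, bounded, and continuous up to
  \<open>\<tau> = 0\<close> with boundary values \<open>f (x, \<sigma>)\<close>; the uniqueness
  lemma for the half-space applies to their difference.
\<close>

lemma poisson_formula:
  fixes f :: "'n::finite point \<Rightarrow> real"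
  assumes harm: "harmonic_on f \<H>" and l: "l > 0"
    and bd: "\<And>z. snd z > 0 \<Longrightarrow> \<bar>f z\<bar> \<le> M * snd z powr (- l)" and \<sigma>: "\<sigma> > 0" and \<tau>: "\<tau> > 0"
  shows "(\<integral>y. f (y, \<sigma>) * poisson (x - y, \<tau>) \<partial>lborel) = f (x, \<sigma> + \<tau>)"
proof -
  define g where "g y = f (y, \<sigma>)" for y
  define B where "B = M * \<sigma> powr (- l)"
  note slice = growth_slice[OF harm bd \<sigma>, folded g_def B_def]
  have B0: "B \<ge> 0" using slice(3)[of 0] by linarith
  have M0: "M \<ge> 0" using B0 \<sigma> unfolding B_def by (simp add: zero_le_mult_iff)
  \<comment> \<open>The Poisson integral in its rescaled form, which includes the boundary.\<close>
  define U where "U z = (\<integral>v. poisson (v, 1) * g (fst z - snd z *\<^sub>R v) \<partial>lborel)" for z :: "'n point"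
  have U: "U z = (\<integral>y. g y * poisson (fst z - y, snd z) \<partial>lborel)" if "snd z > 0" for z
    unfolding U_def by (rule poisson_integral_rescale[OF that slice(2), symmetric])
  have H: "{z :: 'n point. snd z > 0} = \<H>" by (simp add: upper_half_space_def)
  have pint: "integrable lborel (\<lambda>v :: real ^ 'n. poisson (v, 1))"
    by (rule poisson_integrable_1)
  have gm2: "(\<lambda>v. g (fst z - snd z *\<^sub>R v)) \<in> borel_measurable borel" for z :: "'n point"
    by (intro measurable_compose[OF _ slice(2)] borel_measurable_continuous_onI continuous_intros)
  have U_int: "integrable lborel (\<lambda>v. poisson (v, 1) * g (fst z - snd z *\<^sub>R v))" for z :: "'n point"
    by (subst mult.commute, rule integrable_bounded_times[OF pint _ slice(3)]) (use gm2[of z] in simp)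
  have U_bd: "\<bar>U z\<bar> \<le> B" for z
  proof -
    have "\<bar>U z\<bar> \<le> (\<integral>v. \<bar>poisson (v, 1) * g (fst z - snd z *\<^sub>R v)\<bar> \<partial>lborel)"
      unfolding U_def by (rule integral_abs_bound)
    also have "\<dots> \<le> (\<integral>v. B * poisson (v :: real ^ 'n, 1) \<partial>lborel)"
    proof (rule integral_mono)
      fix v :: "real ^ 'n"
      have "poisson (v, 1) * \<bar>g (fst z - snd z *\<^sub>R v)\<bar> \<le> poisson (v, 1) * B"
        by (intro mult_left_mono slice(3) poisson_nonneg) auto
      then show "\<bar>poisson (v, 1) * g (fst z - snd z *\<^sub>R v)\<bar> \<le> B * poisson (v, 1)"
        using poisson_nonneg[of 1 v] by (simp add: abs_mult mult.commute)
    qed (use pint U_int in auto)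
    also have "\<dots> = B" by (simp add: poisson_integral_1)
    finally show ?thesis .
  qed
  have U_harm: "harmonic_on U \<H>"
  proof -
    have "harmonic_on (\<lambda>z. \<integral>y. g y * poisson (fst z - y, snd z) \<partial>lborel) \<H>"
      by (rule poisson_kernel_integral_gradient(1)[OF slice(2,3)])
    then obtain D E where *: "has_gradient (\<lambda>z. \<integral>y. g y * poisson (fst z - y, snd z) \<partial>lborel) D \<H>"
      "\<And>b. b \<in> Basis \<Longrightarrow> has_gradient (D b) (E b) \<H>"
      "\<And>b c. b \<in> Basis \<Longrightarrow> c \<in> Basis \<Longrightarrow> continuous_on \<H> (E b c)"
      "\<And>z. z \<in> \<H> \<Longrightarrow> (\<Sum>b\<in>Basis. E b b z) = 0"
      by (rule harmonic_onE) blast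
    have "has_gradient U D \<H>"
      by (rule has_gradient_cong[OF *(1) open_upper_half_space]) (use U in \<open>auto simp: upper_half_space_def\<close>)
    from harmonic_onI[OF this *(2-4)] show ?thesis by blast
  qed
  define u where "u z = f (z + (0, \<sigma>)) - U z" for z
  have "u (x, \<tau>) = 0"
  proof (rule harmonic_half_space_unique[of u "2 * B"])
    show "harmonic_on u {z. snd z > 0}"
      unfolding u_def H by (intro harmonic_on_diff harmonic_on_translate[OF harm] U_harm) (use \<sigma> in \<open>auto simp: upper_half_space_def\<close>)
    show "continuous_on {z. snd z \<ge> 0} u"
      unfolding u_def U_def
      by (intro continuous_on_diff poisson_extension_continuous[OF slice(1,3)]
            continuous_on_compose2[OF harmonic_on_imp_continuous_on[OF harm]])
         (use \<sigma> in \<open>auto intro!: continuous_intros simp: upper_half_space_def\<close>)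
    fix z :: "'n point" assume z: "snd z \<ge> 0"
    have "\<bar>f (z + (0, \<sigma>))\<bar> \<le> M * (snd z + \<sigma>) powr (- l)" using bd[of "z + (0, \<sigma>)"] z \<sigma> by simp
    also have "\<dots> \<le> B" unfolding B_def using z \<sigma> l M0 by (intro mult_left_mono powr_mono2') auto
    finally show "\<bar>u z\<bar> \<le> 2 * B" using U_bd[of z] unfolding u_def by linarith
  next
    fix x :: "real ^ 'n"
    show "u (x, 0) = 0" by (simp add: u_def U_def g_def poisson_integral_1)
  qed (use \<tau> in auto)
  then show ?thesis using U[of "(x, \<tau>)"] \<tau> by (simp add: u_def g_def add.commute)
qed

section \<open>The reproducing formula\<close>

text \<open>
  The right-hand side of the Poisson formula can be differentiated in \<open>\<tau>\<close> any
  number of times, whereas the left-hand side depends on \<open>\<sigma> + \<tau>\<close> only. In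
  particular all vertical derivatives of \<open>f\<close> exist.
\<close>

lemma vertical_derivatives:
  fixes f :: "'n::finite point \<Rightarrow> real"
  assumes harm: "harmonic_on f \<H>" and l: "l > 0"
    and bd: "\<And>z. snd z > 0 \<Longrightarrow> \<bar>f z\<bar> \<le> M * snd z powr (- l)"
    and \<sigma>: "\<sigma> > 0" and \<tau>: "\<tau> > 0"
  shows "(deriv ^^ k) (\<lambda>t. f (x, t)) (\<sigma> + \<tau>) = (\<integral>y. f (y, \<sigma>) * poisson_deriv k (x - y, \<tau>) \<partial>lborel)" (is ?integral)
    and "((deriv ^^ k) (\<lambda>t. f (x, t)) has_real_derivative (deriv ^^ Suc k) (\<lambda>t. f (x, t)) (\<sigma> + \<tau>)) (at (\<sigma> + \<tau>))" (is ?deriv)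
proof -
  define F where "F k \<tau> = (\<integral>y. f (y, \<sigma>) * poisson_deriv k (x - y, \<tau>) \<partial>lborel)" for k \<tau>
  have F_deriv: "(F k has_real_derivative F (Suc k) \<tau>) (at \<tau>)" if \<tau>: "\<tau> > 0" for k \<tau>
  proof -
    have "(x, 0) + \<tau> *\<^sub>R (0, 1) \<in> \<H>" using \<tau> by (simp add: upper_half_space_def)
    from has_gradient_line[OF poisson_kernel_integral_gradient(2)[OF growth_slice(2,3)[OF harm bd \<sigma>]] this vertical_in_Basis]
    show ?thesis by (simp add: F_def[abs_def] poisson_deriv_Suc)
  qed
  have D: "(deriv ^^ k) (\<lambda>t. f (x, t)) (\<sigma> + \<tau>) = F k \<tau>" if "\<tau> > 0" for k \<tau>
    using that
  proof (induction k arbitrary: \<tau>)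
    case 0
    show ?case using poisson_formula[OF harm l bd \<sigma> 0] unfolding F_def poisson_deriv_0 by simp
  next
    case (Suc k)
    have "((\<lambda>t. F k (t - \<sigma>)) has_real_derivative F (Suc k) \<tau>) (at (\<sigma> + \<tau>))"
      using DERIV_shift[of "F k" "F (Suc k) \<tau>" "\<sigma> + \<tau>" "- \<sigma>"] F_deriv[OF Suc.prems, of k] by simp
    then have "((deriv ^^ k) (\<lambda>t. f (x, t)) has_real_derivative F (Suc k) \<tau>) (at (\<sigma> + \<tau>))"
    proof (rule has_field_derivative_transform_within_open[where S="{\<sigma><..}"])
      fix t assume "t \<in> {\<sigma><..}"
      then show "F k (t - \<sigma>) = (deriv ^^ k) (\<lambda>t. f (x, t)) t" using Suc.IH[of "t - \<sigma>"] by simp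
    qed (use Suc.prems in auto)
    then show ?case by (simp add: DERIV_imp_deriv)
  qed
  show ?integral using D[OF \<tau>] by (simp add: F_def)
  have "((\<lambda>t. F k (t - \<sigma>)) has_real_derivative F (Suc k) \<tau>) (at (\<sigma> + \<tau>))"
    using DERIV_shift[of "F k" "F (Suc k) \<tau>" "\<sigma> + \<tau>" "- \<sigma>"] F_deriv[OF \<tau>, of k] by simp
  then have "((deriv ^^ k) (\<lambda>t. f (x, t)) has_real_derivative F (Suc k) \<tau>) (at (\<sigma> + \<tau>))"
  proof (rule has_field_derivative_transform_within_open[where S="{\<sigma><..}"])
    fix t assume "t \<in> {\<sigma><..}"
    then show "F k (t - \<sigma>) = (deriv ^^ k) (\<lambda>t. f (x, t)) t" using D[of "t - \<sigma>"] by simp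
  qed (use \<tau> in auto)
  then show ?deriv by (simp only: D[OF \<tau>, of "Suc k"])
qed

text \<open>
  Use half the height for \<open>\<sigma>\<close>, which contributes the growth \<open>t powr
  (-l)\<close> of \<open>f\<close>, and half for \<open>\<tau>\<close>, where the
  \<open>k\<close>-th derivative of the Poisson kernel has mass of order \<open>t powr (-k)\<close>.
\<close>

lemma vertical_derivative_decay:
  fixes f :: "'n::finite point \<Rightarrow> real"
  assumes harm: "harmonic_on f \<H>" and l: "l > 0"
    and bd: "\<And>z. snd z > 0 \<Longrightarrow> \<bar>f z\<bar> \<le> M * snd z powr (- l)"
  shows "\<exists>C. \<forall>t>0. \<bar>(deriv ^^ k) (\<lambda>t. f (x, t)) t\<bar> \<le> C * t powr (- l - real k)"
proof (cases k)
  case 0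
  then show ?thesis using bd[of "(x, _)"] by (intro exI[of _ M]) auto
next
  case (Suc j)
  obtain C where C: "C \<ge> 0" "\<And>(x :: real ^ 'n) \<tau>. \<tau> > 0 \<Longrightarrow>
     (\<integral>y. \<bar>poisson_deriv (Suc j) (x - y, \<tau>)\<bar> \<partial>lborel) \<le> C * \<tau> powr (- real (Suc j))"
    by (rule poisson_deriv_slice_bound[of j]) blast
  show ?thesis
  proof (intro exI[of _ "M * C * (1/2) powr (- l - real k)"] allI impI)
    fix t :: real assume t: "t > 0"
    define h where "h = t / 2"
    have h: "h > 0" "h + h = t" using t by (auto simp: h_def)
    note slice = growth_slice[OF harm bd h(1)]
    have M0: "M * h powr (- l) \<ge> 0" using slice(3)[of 0] by linarith
    have pint: "integrable lborel (\<lambda>y. poisson_deriv k (x - y, h))" by (rule poisson_deriv_slice_integrable[OF h(1)])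
    have fint: "integrable lborel (\<lambda>y. f (y, h) * poisson_deriv k (x - y, h))"
      by (rule integrable_bounded_times[OF pint _ slice(3)]) (use slice(2) in simp)
    have "\<bar>(deriv ^^ k) (\<lambda>t. f (x, t)) t\<bar> = \<bar>\<integral>y. f (y, h) * poisson_deriv k (x - y, h) \<partial>lborel\<bar>"
      using vertical_derivatives(1)[OF harm l bd h(1) h(1)] unfolding h(2) by simp
    also have "\<dots> \<le> (\<integral>y. \<bar>f (y, h) * poisson_deriv k (x - y, h)\<bar> \<partial>lborel)" by (rule integral_abs_bound)
    also have "\<dots> \<le> (\<integral>y. M * h powr (- l) * \<bar>poisson_deriv k (x - y, h)\<bar> \<partial>lborel)"
      by (rule integral_mono[OF integrable_abs[OF fint]])
         (use pint slice(3) in \<open>auto simp: abs_mult intro!: mult_right_mono\<close>)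
    also have "\<dots> \<le> M * h powr (- l) * (C * h powr (- real k))"
      using C(2)[OF h(1), of x] M0 unfolding Suc by (simp only: integral_mult_right_zero mult_left_mono)
    also have "\<dots> = M * C * h powr (- l - real k)"
      using powr_add[of h "- l" "- real k"] by simp
    also have "\<dots> = M * C * (1/2) powr (- l - real k) * t powr (- l - real k)"
      using powr_mult[of "1/2" t "- l - real k"] t by (simp add: h_def)
    finally show "\<bar>(deriv ^^ k) (\<lambda>t. f (x, t)) t\<bar> \<le> M * C * (1/2) powr (- l - real k) * t powr (- l - real k)" .
  qed
qed

lemma taylor_telescope:
  fixes D :: "nat \<Rightarrow> real \<Rightarrow> real"
  assumes D: "\<And>k u. u > 0 \<Longrightarrow> (D k has_real_derivative D (Suc k) u) (at u)" and ts: "t + 2 * s > 0"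
  shows "((\<lambda>s. \<Sum>j\<le>m. (- 1) ^ j * (2 * s) ^ j / fact j * D j (t + 2 * s)) has_real_derivative
     2 * (- 1) ^ m * (2 * s) ^ m / fact m * D (Suc m) (t + 2 * s)) (at s)"
proof -
  have comp: "((\<lambda>s. D k (t + 2 * s)) has_real_derivative D (Suc k) (t + 2 * s) * 2) (at s)" for k
    by (rule DERIV_chain2[where f="D k" and g="\<lambda>s. t + 2 * s", OF D[OF ts]]) (auto intro!: derivative_eq_intros)
  show ?thesis
  proof (induction m)
    case 0
    then show ?case using comp[of 0] by (simp add: mult.commute)
  next
    case (Suc m)
    have pw: "((\<lambda>s. (2 * s) ^ Suc m / fact (Suc m)) has_real_derivative 2 * (2 * s) ^ m / fact m) (at s)"
      by (rule derivative_eq_intros refl | simp)+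
    have "((\<lambda>s. (- 1) ^ Suc m * ((2 * s) ^ Suc m / fact (Suc m) * D (Suc m) (t + 2 * s))) has_real_derivative
       (- 1) ^ Suc m * (2 * (2 * s) ^ m / fact m * D (Suc m) (t + 2 * s) + D (Suc (Suc m)) (t + 2 * s) * 2 * ((2 * s) ^ Suc m / fact (Suc m)))) (at s)"
      by (intro DERIV_cmult DERIV_mult pw comp)
    note sum_deriv = DERIV_add[OF Suc this]
    have sign: "(- 1 :: real) ^ Suc m = - ((- 1) ^ m)" by simp
    have "(\<lambda>s. \<Sum>j\<le>Suc m. (- 1) ^ j * (2 * s) ^ j / fact j * D j (t + 2 * s)) =
       (\<lambda>s. (\<Sum>j\<le>m. (- 1) ^ j * (2 * s) ^ j / fact j * D j (t + 2 * s)) +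
          (- 1) ^ Suc m * ((2 * s) ^ Suc m / fact (Suc m) * D (Suc m) (t + 2 * s)))"
      by (simp add: fun_eq_iff del: power_Suc fact_Suc)
    moreover have "2 * (- 1) ^ m * (2 * s) ^ m / fact m * D (Suc m) (t + 2 * s) +
       (- 1) ^ Suc m * (2 * (2 * s) ^ m / fact m * D (Suc m) (t + 2 * s) + D (Suc (Suc m)) (t + 2 * s) * 2 * ((2 * s) ^ Suc m / fact (Suc m))) =
       2 * (- 1) ^ Suc m * (2 * s) ^ Suc m / fact (Suc m) * D (Suc (Suc m)) (t + 2 * s)"
      unfolding sign by (simp add: distrib_left mult_ac del: power_Suc fact_Suc)
    ultimately show ?case using sum_deriv by (simp only:)
  qed
qed

text \<open>
  By the telescoping identity the Taylor type sum is, up to sign, an antiderivative of the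
  integrand. It tends to \<open>0\<close> at infinity by the decay of the derivatives, and for
  \<open>s = 0\<close> it reduces to \<open>D 0 t\<close>.
\<close>

lemma repeated_integration_by_parts:
  fixes D :: "nat \<Rightarrow> real \<Rightarrow> real"
  assumes D: "\<And>k u. u > 0 \<Longrightarrow> (D k has_real_derivative D (Suc k) u) (at u)"
    and decay: "\<And>k. \<exists>C. \<forall>u>0. \<bar>D k u\<bar> \<le> C * u powr (- l - real k)" and l: "l > 0" and t: "t > 0"
    and int: "set_integrable lborel {0<..} (\<lambda>s. (-2) ^ (m + 1) / fact m * s ^ m * D (Suc m) (t + 2 * s))"
  shows "(\<integral>s. indicator {0<..} s * ((-2) ^ (m + 1) / fact m * s ^ m * D (Suc m) (t + 2 * s)) \<partial>lborel) = D 0 t"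
proof -
  define A where "A s = (\<Sum>j\<le>m. (- 1) ^ j * (2 * s) ^ j / fact j * D j (t + 2 * s))" for s
  define a where "a s = (-2) ^ (m + 1) / fact m * s ^ m * D (Suc m) (t + 2 * s)" for s
  have A: "((\<lambda>s. - A s) has_real_derivative a s) (at s)" if "t + 2 * s > 0" for s
  proof -
    have "(-2::real) ^ (m + 1) * s ^ m = - (2 * (- 1) ^ m * (2 * s) ^ m)"
      by (simp add: power_mult_distrib power_minus[of 2])
    then have "a s = - (2 * (- 1) ^ m * (2 * s) ^ m / fact m * D (Suc m) (t + 2 * s))"
      by (simp add: a_def)
    then show ?thesis using DERIV_minus[OF taylor_telescope[where D=D and t=t and s=s and m=m, OF D that]] unfolding A_def by simp
  qed
  have lim_inf: "(A \<longlongrightarrow> 0) at_top"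
  proof -
    have "((\<lambda>s. (- 1) ^ j * (2 * s) ^ j / fact j * D j (t + 2 * s)) \<longlongrightarrow> 0) at_top" for j
    proof -
      obtain C where C: "\<And>u. u > 0 \<Longrightarrow> \<bar>D j u\<bar> \<le> C * u powr (- l - real j)" using decay[of j] by blast
      show ?thesis
      proof (rule Lim_null_comparison[where g="\<lambda>s. \<bar>C\<bar> * (t + 2 * s) powr (- l)"])
        show "\<forall>\<^sub>F s in at_top. norm ((- 1) ^ j * (2 * s) ^ j / fact j * D j (t + 2 * s)) \<le> \<bar>C\<bar> * (t + 2 * s) powr (- l)"
          using eventually_gt_at_top[of 0]
        proof eventually_elim
          case (elim s)
          define u where "u = t + 2 * s"
          have u: "u > 0" "2 * s \<le> u" using elim t by (auto simp: u_def)
          have "\<bar>D j u\<bar> \<le> \<bar>C\<bar> * u powr (- l - real j)"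
            using C[OF u(1)] by (rule order_trans) (intro mult_right_mono, auto)
          moreover have "(2 * s) ^ j \<le> u ^ j" using u elim by (intro power_mono) auto
          ultimately have "(2 * s) ^ j * \<bar>D j u\<bar> \<le> u ^ j * (\<bar>C\<bar> * u powr (- l - real j))"
            using elim u by (intro mult_mono) auto
          also have "\<dots> = \<bar>C\<bar> * u powr (- l)"
            using u powr_add[of u "- l - real j" "real j"] by (simp add: powr_realpow)
          finally have le: "(2 * s) ^ j * \<bar>D j u\<bar> \<le> \<bar>C\<bar> * u powr (- l)" .
          have "(2 * s) ^ j * \<bar>D j u\<bar> / fact j \<le> (2 * s) ^ j * \<bar>D j u\<bar> / 1"
            using elim by (intro divide_left_mono) (auto simp: fact_ge_1)
          with le have "(2 * s) ^ j * \<bar>D j u\<bar> / fact j \<le> \<bar>C\<bar> * u powr (- l)" by simp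
          then show ?case using elim unfolding u_def by (simp add: abs_mult power_abs)
        qed
        have "filterlim (\<lambda>s. t + 2 * s) at_top at_top"
          by (intro filterlim_tendsto_add_at_top[OF tendsto_const] filterlim_tendsto_pos_mult_at_top[OF tendsto_const] filterlim_ident) auto
        then have "((\<lambda>s. (t + 2 * s) powr (- l)) \<longlongrightarrow> 0) at_top"
          using l by (intro tendsto_neg_powr) auto
        then show "((\<lambda>s. \<bar>C\<bar> * (t + 2 * s) powr (- l)) \<longlongrightarrow> 0) at_top"
          by (auto intro: tendsto_mult_right_zero)
      qed
    qed
    then have "((\<lambda>s. \<Sum>j\<le>m. (- 1) ^ j * (2 * s) ^ j / fact j * D j (t + 2 * s)) \<longlongrightarrow> (\<Sum>j\<le>m. 0)) at_top"
      by (intro tendsto_sum) auto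
    then show ?thesis unfolding A_def by simp
  qed
  have A0: "A 0 = D 0 t"
  proof -
    have "A 0 = (\<Sum>j\<le>m. if j = 0 then D 0 t else 0)" unfolding A_def
      by (intro sum.cong) (auto simp: power_0_left)
    then show ?thesis by simp
  qed
  have "(LBINT s=ereal 0..\<infinity>. a s) = - 0 - (- A 0)"
  proof (rule interval_integral_FTC_integrable)
    fix s assume "ereal 0 < ereal s"
    then have s: "t + 2 * s > 0" using t by simp
    show "((\<lambda>s. - A s) has_vector_derivative a s) (at s)"
      using A[OF s] by (simp add: has_real_derivative_iff_has_vector_derivative)
    have "((\<lambda>s. D (Suc m) (t + 2 * s)) has_real_derivative D (Suc (Suc m)) (t + 2 * s) * 2) (at s)"
      by (rule DERIV_chain2[where f="D (Suc m)" and g="\<lambda>s. t + 2 * s", OF D[OF s]]) (auto intro!: derivative_eq_intros)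
    then show "isCont a s" unfolding a_def by (intro continuous_intros DERIV_isCont)
  next
    show "set_integrable lborel (einterval (ereal 0) \<infinity>) a" using int unfolding a_def[abs_def] by simp
    have "isCont (\<lambda>s. - A s) 0" by (rule DERIV_isCont[OF A]) (use t in simp)
    then have "((\<lambda>s. - A s) \<longlongrightarrow> - A 0) (at_right 0)"
      by (metis continuous_within filterlim_at_split isCont_def)
    then show "(((\<lambda>s. - A s) \<circ> real_of_ereal) \<longlongrightarrow> - A 0) (at_right (ereal 0))"
      by (simp only: ereal_tendsto_simps)
    show "(((\<lambda>s. - A s) \<circ> real_of_ereal) \<longlongrightarrow> - 0) (at_left \<infinity>)"
      using tendsto_minus[OF lim_inf] by (simp only: ereal_tendsto_simps)
  qed simp
  then have "(LINT s:{0<..}|lborel. a s) = D 0 t"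
    by (simp only: interval_integral_to_infinity_eq A0)
  then show ?thesis by (simp add: set_lebesgue_integral_def a_def mult.assoc)
qed

text \<open>
  The absolute value keeps \<open>z + reflect w\<close> away from the origin for all
  \<open>w\<close>, not only for those in the half-space. Kernel integrals can then be taken over
  the whole space, with the restriction placed in the weight.
\<close>

definition reflect :: "'n::finite point \<Rightarrow> 'n::finite point" where
  "reflect w = (- fst w, \<bar>snd w\<bar>)"

text \<open>
  The numerical factor of the Bergman kernel belongs to the weight, so that the kernel itself is the
  derivative of order \<open>m + 1\<close> of the Poisson kernel.
\<close>

definition bergman_weight :: "nat \<Rightarrow> ('n::finite point \<Rightarrow> real) \<Rightarrow> 'n::finite point set \<Rightarrow> 'n::finite point \<Rightarrow> real" where
  "bergman_weight m f V w = indicator V w * ((-2) ^ (m + 1) / fact m * f w * snd w ^ m)"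

abbreviation bergman_potential :: "nat \<Rightarrow> ('n::finite point \<Rightarrow> real) \<Rightarrow> 'n::finite point set \<Rightarrow> 'n::finite point \<Rightarrow> real" where
  "bergman_potential m f V z \<equiv> \<integral>w. bergman_weight m f V w * poisson_deriv (m + 1) (z + reflect w) \<partial>lborel"

lemma add_reflect: "z + reflect w = (fst z - fst w, snd z + \<bar>snd w\<bar>)"
  by (cases z) (simp add: reflect_def)

lemma norm_add_reflect: "snd w \<ge> 0 \<Longrightarrow> norm (z + reflect w) = reflected_dist z w"
  by (simp add: add_reflect reflected_dist_def)

lemma reflect_measurable: "reflect \<in> borel_measurable (lborel :: 'n::finite point measure)"
  unfolding measurable_lborel2 reflect_def by (intro borel_measurable_continuous_onI continuous_intros)

lemma reflect_gap: "z \<in> \<H> \<Longrightarrow> snd z \<le> norm (z + reflect w)"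
  using norm_snd_le[of "snd z + \<bar>snd w\<bar>" "fst z - fst w"] by (simp add: add_reflect upper_half_space_def)

lemma bergman_weight_measurable:
  fixes f :: "'n::finite point \<Rightarrow> real"
  assumes f: "continuous_on \<H> f" and V: "V \<in> sets borel" "V \<subseteq> \<H>"
  shows "bergman_weight m f V \<in> borel_measurable lborel"
proof -
  have [measurable]: "(\<lambda>w. indicator \<H> w *\<^sub>R f w) \<in> borel_measurable borel"
    by (rule borel_measurable_continuous_on_indicator[OF upper_half_space_measurable f])
  note V(1)[measurable]
  have "(\<lambda>w. indicator V w * ((-2) ^ (m + 1) / fact m * (indicator \<H> w *\<^sub>R f w) * snd w ^ m)) \<in> borel_measurable borel"
    by measurable
  also have "(\<lambda>w. indicator V w * ((-2) ^ (m + 1) / fact m * (indicator \<H> w *\<^sub>R f w) * snd w ^ m)) = bergman_weight m f V"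
    using V(2) by (auto simp: bergman_weight_def fun_eq_iff indicator_def)
  finally show ?thesis by simp
qed

lemma bergman_weight_integrable:
  fixes f :: "'n::finite point \<Rightarrow> real"
  assumes f: "continuous_on \<H> f" and V: "V \<in> sets borel" "V \<subseteq> \<H>"
    and l: "l > 0" and m: "real m > l - 1"
    and bd: "\<And>z. snd z > 0 \<Longrightarrow> \<bar>f z\<bar> \<le> M * snd z powr (- l)" and z: "z \<in> \<H>"
  shows "integrable lborel (\<lambda>w. bergman_weight m f V w * norm (z + reflect w) powr (- (real CARD('n) + real (m + 1))))"
proof -
  let ?q = "real CARD('n) + real (m + 1)"
  obtain C where C: "\<And>z :: 'n point. snd z > 0 \<Longrightarrow>
    (\<integral>\<^sup>+w\<in>\<H>. ennreal (reflected_dist z w powr (- ?q) * snd w powr (real m - l)) \<partial>lborel)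
      \<le> ennreal (C * snd z powr (real CARD('n) + 1 + (real m - l) - ?q))"
    by (rule half_space_kernel_estimate[where 'n='n, of "real m - l" ?q]) (use l m in auto)
  have kern: "integrable lborel (\<lambda>w. indicator \<H> w * (reflected_dist z w powr (- ?q) * snd w powr (real m - l)))"
  proof (rule integrableI_bounded)
    show "(\<lambda>w. indicator \<H> w * (reflected_dist z w powr (- ?q) * snd w powr (real m - l))) \<in> borel_measurable lborel"
      by measurable
    have "(\<integral>\<^sup>+w. ennreal (norm (indicator \<H> w * (reflected_dist z w powr (- ?q) * snd w powr (real m - l)))) \<partial>lborel)
      = (\<integral>\<^sup>+w\<in>\<H>. ennreal (reflected_dist z w powr (- ?q) * snd w powr (real m - l)) \<partial>lborel)"
      by (intro nn_integral_cong) (auto simp: indicator_def)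
    also have "\<dots> < \<infinity>" using C[of z] z by (auto simp: upper_half_space_def intro: le_less_trans)
    finally show "(\<integral>\<^sup>+w. ennreal (norm (indicator \<H> w * (reflected_dist z w powr (- ?q) * snd w powr (real m - l)))) \<partial>lborel) < \<infinity>" .
  qed
  show ?thesis
  proof (rule Bochner_Integration.integrable_bound[OF integrable_mult_right[OF kern, of "2 ^ (m + 1) / fact m * M"]])
    show "(\<lambda>w. bergman_weight m f V w * norm (z + reflect w) powr (- ?q)) \<in> borel_measurable lborel"
      using bergman_weight_measurable[OF f V, of m, measurable] reflect_measurable[measurable] by measurable
    show "AE w in lborel. norm (bergman_weight m f V w * norm (z + reflect w) powr (- ?q)) \<le>
       norm (2 ^ (m + 1) / fact m * M * (indicator \<H> w * (reflected_dist z w powr (- ?q) * snd w powr (real m - l))))"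
    proof (rule AE_I2)
      fix w :: "'n point"
      show "norm (bergman_weight m f V w * norm (z + reflect w) powr (- ?q)) \<le>
       norm (2 ^ (m + 1) / fact m * M * (indicator \<H> w * (reflected_dist z w powr (- ?q) * snd w powr (real m - l))))"
      proof (cases "w \<in> V")
        case True
        then have w: "w \<in> \<H>" "snd w > 0" using V(2) by (auto simp: upper_half_space_def)
        define k where "k = reflected_dist z w powr (- ?q)"
        have k: "norm (z + reflect w) powr (- ?q) = k" "k \<ge> 0" using w(2) by (simp_all add: k_def norm_add_reflect)
        have "\<bar>f w\<bar> * snd w ^ m \<le> M * snd w powr (- l) * snd w ^ m"
          using bd[OF w(2)] w by (intro mult_right_mono) auto
        also have "\<dots> = M * snd w powr (real m - l)"
          using w(2) powr_add[of "snd w" "- l" "real m"] by (simp add: powr_realpow)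
        finally have "2 ^ (m + 1) / fact m * (\<bar>f w\<bar> * snd w ^ m) * k \<le> 2 ^ (m + 1) / fact m * (M * snd w powr (real m - l)) * k"
          using k by (intro mult_right_mono mult_left_mono) auto
        also have "\<dots> \<le> \<bar>2 ^ (m + 1) / fact m * (M * snd w powr (real m - l)) * k\<bar>" by (rule abs_ge_self)
        finally show ?thesis using True w k unfolding k_def[symmetric] bergman_weight_def
          by (simp add: abs_mult power_abs mult_ac)
      qed (simp add: bergman_weight_def)
    qed
  qed
qed

lemma bergman_projection_harmonic:
  fixes f :: "'n::finite point \<Rightarrow> real"
  assumes f: "continuous_on \<H> f" and V: "V \<in> sets borel" "V \<subseteq> \<H>"
    and l: "l > 0" and m: "real m > l - 1"
    and bd: "\<And>z. snd z > 0 \<Longrightarrow> \<bar>f z\<bar> \<le> M * snd z powr (- l)"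
  shows "harmonic_on (\<lambda>z. bergman_potential m f V z) \<H>"
    and "z \<in> \<H> \<Longrightarrow> integrable lborel (\<lambda>w. bergman_weight m f V w * poisson_deriv (m + 1) (z + reflect w))"
proof -
  have int: "integrable lborel (\<lambda>w. bergman_weight m f V w * norm (z + reflect w) powr (- (real CARD('n) + real (m + 1))))"
    if "z \<in> \<H>" for z
    by (rule bergman_weight_integrable[OF f V l m _ that]) (rule bd)
  note c = bergman_weight_measurable[OF f V, of m]
  have int\<psi>: "integrable lborel (\<lambda>w. bergman_weight m f V w * poisson_deriv (m + 1) (z + reflect w))" if z: "z \<in> \<H>" for z
    by (rule integrable_kernel_bound[OF poisson_deriv_homogeneous order_refl c reflect_measurable int[OF z], of "snd z"])
       (use z reflect_gap[OF z] in \<open>auto simp: upper_half_space_def\<close>)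
  show "harmonic_on (\<lambda>z. bergman_potential m f V z) \<H>"
  proof (rule harmonic_on_kernel_integral[OF poisson_deriv_homogeneous _ _ poisson_deriv_laplacian open_upper_half_space c reflect_measurable int\<psi> int])
    fix z :: "'n point" assume z: "z \<in> \<H>"
    show "\<exists>e>0. \<forall>w\<in>space lborel. e \<le> norm (z + reflect w)"
      by (intro exI[of _ "snd z"]) (use z reflect_gap[OF z] in \<open>auto simp: upper_half_space_def\<close>)
  qed auto
  show "z \<in> \<H> \<Longrightarrow> integrable lborel (\<lambda>w. bergman_weight m f V w * poisson_deriv (m + 1) (z + reflect w))"
    by (rule int\<psi>)
qed

text \<open>
  On the slice at height \<open>s\<close> the integral is, up to the factor \<open>s ^ m\<close> and
  a constant, the vertical derivative of order \<open>m + 1\<close> of \<open>f\<close> at height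
  \<open>s + (t + s) = t + 2 s\<close>. What is left is the integral over \<open>s\<close> evaluated
  by repeated integration by parts.
\<close>

lemma bergman_reproducing:
  fixes f :: "'n::finite point \<Rightarrow> real"
  assumes harm: "harmonic_on f \<H>" and l: "l > 0" and m: "real m > l - 1"
    and bd: "\<And>z. snd z > 0 \<Longrightarrow> \<bar>f z\<bar> \<le> M * snd z powr (- l)" and z: "z \<in> \<H>"
  shows "bergman_potential m f \<H> z = f z"
proof -
  obtain x t where zt: "z = (x, t)" by (cases z)
  have t: "t > 0" using z zt by (simp add: upper_half_space_def)
  define D where "D k = (deriv ^^ k) (\<lambda>t. f (x, t))" for k
  have D: "(D k has_real_derivative D (Suc k) u) (at u)" if "u > 0" for k u
    using vertical_derivatives(2)[OF harm l bd, of "u/2" "u/2" k x] that unfolding D_def by simp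
  let ?h = "\<lambda>y s. bergman_weight m f \<H> (y, s) * poisson_deriv (m + 1) (z + reflect (y, s))"
  have inner: "(\<integral>y. ?h y s \<partial>lborel) = indicator {0<..} s * ((-2) ^ (m + 1) / fact m * s ^ m * D (Suc m) (t + 2 * s))" for s
  proof (cases "s > 0")
    case True
    have "(\<integral>y. ?h y s \<partial>lborel) = (\<integral>y. (-2) ^ (m + 1) / fact m * s ^ m * (f (y, s) * poisson_deriv (m + 1) (x - y, t + s)) \<partial>lborel)"
      using True by (intro Bochner_Integration.integral_cong) (auto simp: bergman_weight_def upper_half_space_def add_reflect zt)
    also have "\<dots> = (-2) ^ (m + 1) / fact m * s ^ m * (\<integral>y. f (y, s) * poisson_deriv (m + 1) (x - y, t + s) \<partial>lborel)"
      by (rule integral_mult_right_zero)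
    also have "(\<integral>y. f (y, s) * poisson_deriv (m + 1) (x - y, t + s) \<partial>lborel) = D (m + 1) (s + (t + s))"
      unfolding D_def by (rule vertical_derivatives(1)[OF harm l bd, symmetric]) (use True t in auto)
    also have "s + (t + s) = t + 2 * s" by simp
    finally show ?thesis using True by simp
  next
    case False
    have "(\<integral>y. ?h y s \<partial>lborel) = integral\<^sup>L lborel (\<lambda>y :: real ^ 'n. 0)"
      by (rule Bochner_Integration.integral_cong) (use False in \<open>simp_all add: bergman_weight_def upper_half_space_def\<close>)
    also have "\<dots> = indicator {0<..} s * ((-2) ^ (m + 1) / fact m * s ^ m * D (Suc m) (t + 2 * s))" using False by simp
    finally show ?thesis .
  qed
  have "integrable lborel (\<lambda>w. bergman_weight m f \<H> w * poisson_deriv (m + 1) (z + reflect w))"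
    by (rule bergman_projection_harmonic(2)[OF harmonic_on_imp_continuous_on[OF harm] upper_half_space_measurable order_refl l m bd z])
  then have int: "integrable (lborel \<Otimes>\<^sub>M lborel) (case_prod ?h)"
    unfolding lborel_prod by (simp add: case_prod_unfold)
  have "bergman_potential m f \<H> z = (\<integral>s. (\<integral>y. ?h y s \<partial>lborel) \<partial>lborel)"
    unfolding lborel_pair.integral_snd[OF int] by (simp add: lborel_prod case_prod_unfold)
  also have "\<dots> = (\<integral>s. indicator {0<..} s * ((-2) ^ (m + 1) / fact m * s ^ m * D (Suc m) (t + 2 * s)) \<partial>lborel)"
    by (simp only: inner)
  also have "\<dots> = D 0 t"
  proof (rule repeated_integration_by_parts[where D=D, OF D _ l t])
    show "\<exists>C. \<forall>u>0. \<bar>D k u\<bar> \<le> C * u powr (- l - real k)" for k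
      unfolding D_def by (rule vertical_derivative_decay[OF harm l bd])
    show "set_integrable lborel {0<..} (\<lambda>s. (-2) ^ (m + 1) / fact m * s ^ m * D (Suc m) (t + 2 * s))"
      using lborel_pair.integrable_snd[OF int] unfolding inner set_integrable_def by (simp only: real_scaleR_def)
  qed
  also have "\<dots> = f z" by (simp add: D_def zt)
  finally show ?thesis .
qed

section \<open>Approximation by the Bergman integral over a level set\<close>

abbreviation abs_kernel :: "nat \<Rightarrow> 'n::finite point \<Rightarrow> 'n::finite point \<Rightarrow> real" where
  "abs_kernel m z w \<equiv> 2 ^ (m + 1) / fact m * \<bar>poisson_deriv (m + 1) (z + reflect w)\<bar>"

text \<open>
  For \<open>z\<close> and \<open>V\<close> in the half-space this is the inner integral in the
  definition of \<open>level_dist\<close>. Written with \<open>reflect\<close>, its integrand is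
  measurable in both variables on the whole space.
\<close>

definition kernel_mass :: "nat \<Rightarrow> real \<Rightarrow> 'n::finite point set \<Rightarrow> 'n::finite point \<Rightarrow> ennreal" where
  "kernel_mass m l V z = (\<integral>\<^sup>+w\<in>V. ennreal (abs_kernel m z w * snd w powr (real m - l)) \<partial>lborel)"

lemma kernel_mass_eq:
  fixes z :: "'n::finite point"
  assumes V: "V \<subseteq> \<H>" and z: "z \<in> \<H>"
  shows "(\<integral>\<^sup>+w\<in>V. ennreal (\<bar>bergman_kernel m z w\<bar> * snd w powr (real m - l)) \<partial>lborel) = kernel_mass m l V z"
  unfolding kernel_mass_def
proof (rule nn_integral_cong)
  fix w :: "'n point"
  show "ennreal (\<bar>bergman_kernel m z w\<bar> * snd w powr (real m - l)) * indicator V w =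
    ennreal (abs_kernel m z w * snd w powr (real m - l)) * indicator V w"
  proof (cases "w \<in> V")
    case True
    then have w: "snd w > 0" using V by (auto simp: upper_half_space_def)
    have "\<bar>(-2 :: real) ^ (m + 1)\<bar> = 2 ^ (m + 1)" by (simp only: power_abs abs_minus_cancel abs_numeral)
    then have "\<bar>bergman_kernel m z w\<bar> = abs_kernel m z w"
      using z w by (subst bergman_kernel_eq) (simp_all only: upper_half_space_def mem_Collect_eq abs_mult abs_divide add_reflect abs_of_pos fact_gt_zero)
    then show ?thesis by (simp only:)
  next
    case False
    show ?thesis by (simp only: indicator_simps(2)[OF False] mult_zero_right)
  qed
qed

lemma kernel_mass_mono: "V \<subseteq> W \<Longrightarrow> kernel_mass m l V z \<le> kernel_mass m l W z"
  unfolding kernel_mass_def by (intro nn_integral_mono mult_left_mono) (auto simp: indicator_def)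

lemma kernel_mass_integrand_measurable:
  "(\<lambda>w. ennreal (abs_kernel m z w * snd w powr (real m - l)))
     \<in> borel_measurable (borel :: 'n::finite point measure)"
proof -
  have [measurable]: "(reflect :: 'n point \<Rightarrow> _) \<in> borel_measurable borel"
    using reflect_measurable by simp
  show ?thesis by measurable
qed

lemma kernel_mass_measurable:
  fixes V :: "'n::finite point set"
  assumes V: "V \<in> sets borel"
  shows "kernel_mass m l V \<in> borel_measurable borel"
proof -
  have [measurable]: "(reflect :: 'n point \<Rightarrow> _) \<in> borel_measurable borel"
    using reflect_measurable by simp
  note V[measurable]
  have "(\<lambda>(z, w). ennreal (abs_kernel m z w * snd w powr (real m - l)) * indicator V w)
     \<in> borel_measurable (borel \<Otimes>\<^sub>M lborel)"
    by measurable
  then show ?thesis unfolding kernel_mass_def[abs_def] by (rule lborel.borel_measurable_nn_integral)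
qed

text \<open>
  The estimate for reflected distances with \<open>q = n + m + 1\<close> and \<open>\<beta> = m -
  l\<close>; its two hypotheses are the assumptions on \<open>m\<close> and \<open>l\<close>.
\<close>

lemma kernel_mass_bound:
  fixes l :: real
  assumes l: "l > 0" and m: "real m > l - 1"
  obtains K where "K > 0"
    "\<And>z :: 'n::finite point. z \<in> \<H> \<Longrightarrow> kernel_mass m l \<H> z \<le> ennreal (K * snd z powr (- l))"
proof -
  let ?q = "real CARD('n) + real (m + 1)"
  obtain C where C: "C \<ge> 0" "\<And>z :: 'n point. z \<noteq> 0 \<Longrightarrow> \<bar>poisson_deriv (m + 1) z\<bar> \<le> C * norm z powr (- ?q)"
    using homogeneous_kernel_bound[OF poisson_deriv_homogeneous[of "m + 1"]] by blast
  obtain C' where C': "C' > 0" "\<And>z :: 'n point. snd z > 0 \<Longrightarrow>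
    (\<integral>\<^sup>+w\<in>\<H>. ennreal (reflected_dist z w powr (- ?q) * snd w powr (real m - l)) \<partial>lborel)
      \<le> ennreal (C' * snd z powr (real CARD('n) + 1 + (real m - l) - ?q))"
    by (rule half_space_kernel_estimate[where 'n='n, of "real m - l" ?q]) (use l m in auto)
  define c where "c = 2 ^ (m + 1) / fact m * (C + 1)"
  have c: "c > 0" using C by (simp add: c_def)
  show thesis
  proof (rule that[of "c * C'"])
    show "c * C' > 0" using c C' by simp
    fix z :: "'n point" assume z: "z \<in> \<H>"
    then have t: "snd z > 0" by (simp add: upper_half_space_def)
    have "kernel_mass m l \<H> z \<le>
      (\<integral>\<^sup>+w. ennreal c * (ennreal (reflected_dist z w powr (- ?q) * snd w powr (real m - l)) * indicator \<H> w) \<partial>lborel)"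
      unfolding kernel_mass_def
    proof (rule nn_integral_mono)
      fix w :: "'n point"
      let ?r = "reflected_dist z w"
      show "ennreal (abs_kernel m z w * snd w powr (real m - l)) * indicator \<H> w
        \<le> ennreal c * (ennreal (?r powr (- ?q) * snd w powr (real m - l)) * indicator \<H> w)"
      proof (cases "w \<in> \<H>")
        case True
        then have w: "snd w > 0" by (simp add: upper_half_space_def)
        have nz: "z + reflect w \<noteq> 0" using w t by (simp add: add_reflect zero_prod_def)
        have "\<bar>poisson_deriv (m + 1) (z + reflect w)\<bar> \<le> C * ?r powr (- ?q)"
          using C(2)[OF nz] w by (simp only: norm_add_reflect less_imp_le)
        also have "\<dots> \<le> (C + 1) * ?r powr (- ?q)" by (intro mult_right_mono) auto
        finally have "abs_kernel m z w * snd w powr (real m - l) \<le>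
            2 ^ (m + 1) / fact m * ((C + 1) * ?r powr (- ?q)) * snd w powr (real m - l)"
          by (intro mult_right_mono mult_left_mono) auto
        also have "\<dots> = c * (?r powr (- ?q) * snd w powr (real m - l))" unfolding c_def by (simp only: mult_ac)
        finally have "ennreal (abs_kernel m z w * snd w powr (real m - l)) \<le>
           ennreal c * ennreal (?r powr (- ?q) * snd w powr (real m - l))"
          using c by (subst ennreal_mult[symmetric]) (auto intro: ennreal_leI)
        then show ?thesis by (simp only: indicator_simps(1)[OF True] mult_1_right)
      next
        case False
        show ?thesis by (simp only: indicator_simps(2)[OF False] mult_zero_right order_refl)
      qed
    qed
    also have "\<dots> = ennreal c * (\<integral>\<^sup>+w\<in>\<H>. ennreal (reflected_dist z w powr (- ?q) * snd w powr (real m - l)) \<partial>lborel)"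
      by (rule nn_integral_cmult) measurable
    also have "\<dots> \<le> ennreal c * ennreal (C' * snd z powr (real CARD('n) + 1 + (real m - l) - ?q))"
      by (intro mult_left_mono C'(2) t) simp
    also have "\<dots> = ennreal (c * C' * snd z powr (- l))"
      using c C' by (subst ennreal_mult[symmetric]) (auto simp: mult.assoc)
    finally show "kernel_mass m l \<H> z \<le> ennreal (c * C' * snd z powr (- l))" .
  qed
qed

lemma bergman_projection_bound:
  fixes f :: "'n::finite point \<Rightarrow> real"
  assumes f: "continuous_on \<H> f" and W: "W \<in> sets borel" "W \<subseteq> \<H>"
    and l: "l > 0" and m: "real m > l - 1"
    and bd: "\<And>z. snd z > 0 \<Longrightarrow> \<bar>f z\<bar> \<le> M * snd z powr (- l)"
    and B: "B \<ge> 0" "\<And>w. w \<in> W \<Longrightarrow> \<bar>f w\<bar> \<le> B * snd w powr (- l)" and z: "z \<in> \<H>"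
  shows "ennreal \<bar>bergman_potential m f W z\<bar> \<le> ennreal B * kernel_mass m l W z"
proof -
  note W(1)[measurable] kernel_mass_integrand_measurable[of m z l, measurable]
  have "integrable lborel (\<lambda>w. bergman_weight m f W w * poisson_deriv (m + 1) (z + reflect w))"
    by (rule bergman_projection_harmonic(2)[OF f W l m _ z]) (rule bd)
  from integral_norm_bound_ennreal[OF this]
  have "ennreal \<bar>bergman_potential m f W z\<bar> \<le>
    (\<integral>\<^sup>+w. ennreal \<bar>bergman_weight m f W w * poisson_deriv (m + 1) (z + reflect w)\<bar> \<partial>lborel)" by (simp only: real_norm_def)
  also have "\<dots> \<le> (\<integral>\<^sup>+w. ennreal B * (ennreal (abs_kernel m z w * snd w powr (real m - l)) * indicator W w) \<partial>lborel)"
  proof (rule nn_integral_mono)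
    fix w :: "'n point"
    let ?p = "\<bar>poisson_deriv (m + 1) (z + reflect w)\<bar>"
    show "ennreal \<bar>bergman_weight m f W w * poisson_deriv (m + 1) (z + reflect w)\<bar> \<le>
      ennreal B * (ennreal (2 ^ (m + 1) / fact m * ?p * snd w powr (real m - l)) * indicator W w)"
    proof (cases "w \<in> W")
      case True
      then have w: "snd w > 0" using W(2) by (auto simp: upper_half_space_def)
      have "\<bar>f w\<bar> * snd w ^ m \<le> B * snd w powr (- l) * snd w ^ m"
        using B(2)[OF True] w by (intro mult_right_mono) auto
      also have "\<dots> = B * snd w powr (real m - l)"
        using w powr_add[of "snd w" "- l" "real m"] by (simp add: powr_realpow)
      finally have le: "\<bar>f w\<bar> * snd w ^ m \<le> B * snd w powr (real m - l)" .
      have two: "\<bar>(-2 :: real) ^ (m + 1)\<bar> = 2 ^ (m + 1)" by (simp only: power_abs abs_minus_cancel abs_numeral)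
      have "\<bar>bergman_weight m f W w * poisson_deriv (m + 1) (z + reflect w)\<bar> = 2 ^ (m + 1) / fact m * ?p * (\<bar>f w\<bar> * snd w ^ m)"
        unfolding bergman_weight_def abs_mult abs_divide two using w True by (simp add: mult_ac)
      also have "\<dots> \<le> 2 ^ (m + 1) / fact m * ?p * (B * snd w powr (real m - l))"
        by (intro mult_left_mono le) auto
      also have "\<dots> = B * (2 ^ (m + 1) / fact m * ?p * snd w powr (real m - l))" by (simp only: mult_ac)
      finally have "ennreal \<bar>bergman_weight m f W w * poisson_deriv (m + 1) (z + reflect w)\<bar> \<le>
         ennreal B * ennreal (2 ^ (m + 1) / fact m * ?p * snd w powr (real m - l))"
        using B(1) by (subst ennreal_mult[symmetric]) (auto intro: ennreal_leI)
      then show ?thesis by (simp only: indicator_simps(1)[OF True] mult_1_right)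
    next
      case False
      then show ?thesis by (simp add: bergman_weight_def)
    qed
  qed
  also have "\<dots> = ennreal B * kernel_mass m l W z"
    unfolding kernel_mass_def by (rule nn_integral_cmult) measurable
  finally show ?thesis .
qed

lemma ennreal_powr_mono:
  assumes "x \<le> y" "p \<ge> 0" shows "ennreal_powr x p \<le> ennreal_powr y p"
proof (cases "y = \<infinity>")
  case False
  then have "x \<noteq> \<infinity>" using assms(1) by (auto simp: top_unique)
  moreover have "enn2real x \<le> enn2real y" using assms(1) False by (intro enn2real_mono) (auto simp: less_top)
  ultimately show ?thesis using False assms(2) by (auto simp: ennreal_powr_def intro!: ennreal_leI powr_mono2)
qed (simp add: ennreal_powr_def)

lemma ennreal_powr_measurable [measurable]: "(\<lambda>x. ennreal_powr x p) \<in> borel_measurable borel"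
  unfolding ennreal_powr_def by measurable

lemma level_set_measurable:
  fixes f :: "'n::finite point \<Rightarrow> real"
  assumes f: "continuous_on \<H> f"
  shows "level_set \<epsilon> l f \<in> sets borel"
proof -
  have [measurable]: "(\<lambda>w. indicator \<H> w *\<^sub>R f w) \<in> borel_measurable borel"
    by (rule borel_measurable_continuous_on_indicator[OF upper_half_space_measurable f])
  have "level_set \<epsilon> l f = \<H> \<inter> {w \<in> space borel. \<epsilon> \<le> \<bar>indicator \<H> w *\<^sub>R f w\<bar> * snd w powr l}"
    by (auto simp: level_set_def indicator_def)
  also have "\<dots> \<in> sets borel" by measurable
  finally show ?thesis .
qed

lemma growth_space_bound:
  fixes f :: "'n::finite point \<Rightarrow> real"
  assumes "growth_norm l f < \<infinity>"
  shows "z \<in> \<H> \<Longrightarrow> \<bar>f z\<bar> * snd z powr l \<le> enn2real (growth_norm l f)"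
    and "snd z > 0 \<Longrightarrow> \<bar>f z\<bar> \<le> enn2real (growth_norm l f) * snd z powr (- l)"
proof -
  show 1: "\<bar>f z\<bar> * snd z powr l \<le> enn2real (growth_norm l f)" if "z \<in> \<H>" for z
  proof -
    have "ennreal (\<bar>f z\<bar> * snd z powr l) \<le> growth_norm l f"
      unfolding growth_norm_def by (rule SUP_upper[OF that])
    also have "\<dots> = ennreal (enn2real (growth_norm l f))" using assms by simp
    finally show ?thesis by (simp only: ennreal_le_iff[OF enn2real_nonneg])
  qed
  assume z: "snd z > 0"
  show "\<bar>f z\<bar> \<le> enn2real (growth_norm l f) * snd z powr (- l)"
    using 1[of z] z by (simp add: upper_half_space_def powr_minus_divide pos_le_divide_eq)
qed

abbreviation level_integral :: "real \<Rightarrow> real \<Rightarrow> real \<Rightarrow> nat \<Rightarrow> real \<Rightarrow> ('n::finite point \<Rightarrow> real) \<Rightarrow> ennreal" where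
  "level_integral p \<alpha> l m \<epsilon> f \<equiv> \<integral>\<^sup>+z\<in>\<H>. ennreal_powr (kernel_mass m l (level_set \<epsilon> l f) z) p * ennreal (snd z powr \<alpha>) \<partial>lborel"

text \<open>
  Restricting the reproducing integral of \<open>f\<close> to the level set gives the competitor
  \<open>g\<close>. Its size is controlled by the kernel mass of the level set, so \<open>g\<close>
  lies in the Bergman space by the finiteness assumption. The difference \<open>f - g\<close> is the
  integral over the complement, where \<open>\<bar>f w\<bar> \<le> \<epsilon> * snd w powr
  (-l)\<close>, and is therefore at most \<open>\<epsilon>\<close> times the kernel mass of the
  half-space.
\<close>

lemma bergman_dist_le_level:
  assumes p: "0 < p" and l: "l > 0" and m: "real m > l - 1"
  obtains K where "K > 0" "\<And>(f :: 'n::finite point \<Rightarrow> real) \<epsilon>.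
    f \<in> growth_space l \<Longrightarrow> \<epsilon> > 0 \<Longrightarrow>
    level_integral p \<alpha> l m \<epsilon> f < \<infinity> \<Longrightarrow>
    bergman_dist p \<alpha> l f \<le> ennreal (K * \<epsilon>)"
proof -
  obtain K where K: "K > 0"
    "\<And>z :: 'n point. z \<in> \<H> \<Longrightarrow> kernel_mass m l \<H> z \<le> ennreal (K * snd z powr (- l))"
    by (rule kernel_mass_bound[where 'n='n, OF l m]) blast
  show thesis
  proof (rule that[OF K(1)])
    fix f :: "'n point \<Rightarrow> real" and \<epsilon> :: real
    assume f: "f \<in> growth_space l" and \<epsilon>: "\<epsilon> > 0"
      and fin: "level_integral p \<alpha> l m \<epsilon> f < \<infinity>"
    define M where "M = enn2real (growth_norm l f)"
    have harm: "harmonic_on f \<H>" and bd: "\<And>z. snd z > 0 \<Longrightarrow> \<bar>f z\<bar> \<le> M * snd z powr (- l)"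
      using f growth_space_bound(2)[of l f] unfolding growth_space_def M_def by auto
    have M0: "M \<ge> 0" by (simp add: M_def)
    have cf: "continuous_on \<H> f" by (rule harmonic_on_imp_continuous_on[OF harm])
    define V where "V = level_set \<epsilon> l f"
    have V: "V \<in> sets borel" "V \<subseteq> \<H>"
      unfolding V_def using level_set_measurable[OF cf] by (auto simp: level_set_def)
    define H where "H = (\<H> :: 'n point set)"
    have HV: "H - V \<in> sets borel" "H - V \<subseteq> \<H>" using V by (auto simp: H_def)
    define g where "g z = bergman_potential m f V z" for z
    have fg: "ennreal \<bar>f z - g z\<bar> \<le> ennreal (K * \<epsilon> * snd z powr (- l))" if z: "z \<in> \<H>" for z
    proof -
      have int: "integrable lborel (\<lambda>w. bergman_weight m f W w * poisson_deriv (m + 1) (z + reflect w))"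
        if "W \<in> sets borel" "W \<subseteq> \<H>" for W
        by (rule bergman_projection_harmonic(2)[OF cf that l m _ z]) (rule bd)
      have "f z = bergman_potential m f H z"
        unfolding H_def by (rule bergman_reproducing[OF harm l m _ z, symmetric]) (rule bd)
      then have "f z - g z = (\<integral>w. bergman_weight m f H w * poisson_deriv (m + 1) (z + reflect w)
          - bergman_weight m f V w * poisson_deriv (m + 1) (z + reflect w) \<partial>lborel)"
        unfolding g_def using int[of H] int[OF V] by (simp add: H_def)
      also have "\<dots> = bergman_potential m f (H - V) z"
        by (rule Bochner_Integration.integral_cong) (use V(2) in \<open>auto simp: bergman_weight_def H_def indicator_def\<close>)
      finally have "ennreal \<bar>f z - g z\<bar> \<le> ennreal \<epsilon> * kernel_mass m l (H - V) z"
      proof (rule ssubst, intro bergman_projection_bound[OF cf HV l m _ _ _ z])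
        fix w assume w: "w \<in> H - V"
        then have "\<bar>f w\<bar> * snd w powr l \<le> \<epsilon>" "snd w > 0"
          by (auto simp: H_def V_def level_set_def upper_half_space_def)
        then show "\<bar>f w\<bar> \<le> \<epsilon> * snd w powr (- l)" by (simp add: powr_minus_divide pos_le_divide_eq)
      qed (use bd \<epsilon> in auto)
      also have "\<dots> \<le> ennreal \<epsilon> * ennreal (K * snd z powr (- l))"
        by (intro mult_left_mono order_trans[OF kernel_mass_mono[OF HV(2)] K(2)[OF z]]) simp
      also have "\<dots> = ennreal (K * \<epsilon> * snd z powr (- l))"
        using K(1) \<epsilon> by (subst ennreal_mult[symmetric]) (auto simp: mult_ac)
      finally show ?thesis .
    qed
    have gmass: "ennreal (\<bar>g z\<bar> powr p * snd z powr \<alpha>) \<le> ennreal (M powr p) * (ennreal_powr (kernel_mass m l V z) p * ennreal (snd z powr \<alpha>))"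
      if z: "z \<in> \<H>" for z
    proof -
      have "ennreal \<bar>g z\<bar> \<le> ennreal M * kernel_mass m l V z"
        unfolding g_def by (rule bergman_projection_bound[OF cf V l m _ M0 _ z]) (use bd V(2) in \<open>auto simp: upper_half_space_def\<close>)
      moreover have "kernel_mass m l V z < \<infinity>"
        using order_trans[OF kernel_mass_mono[OF V(2)] K(2)[OF z]] le_less_trans ennreal_less_top by fastforce
      then obtain k where k: "kernel_mass m l V z = ennreal k" "k \<ge> 0"
        by (cases "kernel_mass m l V z") auto
      ultimately have "\<bar>g z\<bar> \<le> M * k" using M0 by (simp add: ennreal_mult[symmetric])
      then have "\<bar>g z\<bar> powr p \<le> M powr p * k powr p"
        using powr_mono2[of p "\<bar>g z\<bar>" "M * k"] p M0 k by (simp add: powr_mult)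
      then have "\<bar>g z\<bar> powr p * snd z powr \<alpha> \<le> M powr p * (k powr p * snd z powr \<alpha>)"
        by (simp add: mult.assoc[symmetric] mult_right_mono)
      then show ?thesis unfolding k(1) using k(2)
        by (simp add: ennreal_powr_def ennreal_mult[symmetric] ennreal_leI)
    qed
    have "g \<in> bergman_space p \<alpha>"
    proof -
      have harm_g: "harmonic_on g \<H>"
        unfolding g_def by (rule bergman_projection_harmonic(1)[OF cf V l m]) (rule bd)
      note kernel_mass_measurable[OF V(1), of m l, measurable]
      have "(\<integral>\<^sup>+z\<in>\<H>. ennreal (\<bar>g z\<bar> powr p * snd z powr \<alpha>) \<partial>lborel) \<le>
        (\<integral>\<^sup>+z. ennreal (M powr p) * (ennreal_powr (kernel_mass m l V z) p * ennreal (snd z powr \<alpha>) * indicator \<H> z) \<partial>lborel)"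
        by (rule nn_integral_mono) (use gmass in \<open>auto simp: indicator_def\<close>)
      also have "\<dots> = ennreal (M powr p) * (\<integral>\<^sup>+z\<in>\<H>. ennreal_powr (kernel_mass m l V z) p * ennreal (snd z powr \<alpha>) \<partial>lborel)"
        by (rule nn_integral_cmult) measurable
      also have "\<dots> < \<infinity>" using fin unfolding V_def by (simp add: ennreal_mult_less_top)
      finally show ?thesis using harm_g by (simp add: bergman_space_def)
    qed
    then have "bergman_dist p \<alpha> l f \<le> growth_norm l (\<lambda>z. f z - g z)"
      unfolding bergman_dist_def by (rule INF_lower)
    also have "\<dots> \<le> ennreal (K * \<epsilon>)"
      unfolding growth_norm_def
    proof (rule SUP_least)
      fix z :: "'n point" assume z: "z \<in> \<H>"
      then have t: "snd z > 0" by (simp add: upper_half_space_def)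
      have "\<bar>f z - g z\<bar> \<le> K * \<epsilon> * snd z powr (- l)"
        using fg[OF z] K(1) \<epsilon> by (subst (asm) ennreal_le_iff) auto
      then have "\<bar>f z - g z\<bar> * snd z powr l \<le> K * \<epsilon>"
        using t by (simp add: powr_minus_divide pos_le_divide_eq)
      then show "ennreal (\<bar>f z - g z\<bar> * snd z powr l) \<le> ennreal (K * \<epsilon>)" by (rule ennreal_leI)
    qed
    finally show "bergman_dist p \<alpha> l f \<le> ennreal (K * \<epsilon>)" .
  qed
qed

section \<open>Level sets of functions in the Bergman space\<close>

lemma powr_comparable:
  fixes s s' a :: real
  assumes "0 < s" "0 < s'" "s \<le> 2 * s'" "s' \<le> 2 * s"
  shows "s powr a \<le> 2 powr \<bar>a\<bar> * s' powr a"
proof (cases "a \<ge> 0")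
  case True
  have "s powr a \<le> (2 * s') powr a" using assms True by (intro powr_mono2) auto
  then show ?thesis using True assms by (simp add: powr_mult)
next
  case False
  have "s powr a \<le> (1/2 * s') powr a" using assms False by (intro powr_mono2') auto
  also have "\<dots> = (1/2) powr a * s' powr a" by (rule powr_mult)
  also have "(1/2) powr a = 2 powr \<bar>a\<bar>" using False by (simp add: powr_divide powr_minus_divide)
  finally show ?thesis .
qed

text \<open>
  For \<open>p < 1\<close> an integral is not controlled by the integral of the \<open>p\<close>-th
  power in general. It is if the integrand \<open>X\<close> is bounded by that quantity pointwise:
  then \<open>X = X powr (1 - p) * X powr p\<close>, the first factor is bounded by a power of
  \<open>\<integral> X powr p\<close>, and the exponents combine to give a linear bound.
\<close>

lemma small_exponent_integral_bound:
  assumes p: "0 < p" "p \<le> 1" and C: "C > 0"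
    and meas: "(\<lambda>w. ennreal (X w powr p * \<nu> w) * indicator S w) \<in> borel_measurable M"
    and X: "\<And>w. w \<in> S \<Longrightarrow> X w \<ge> 0" and \<nu>: "\<And>w. w \<in> S \<Longrightarrow> \<nu> w \<ge> 0"
    and sup: "\<And>w. w \<in> S \<Longrightarrow> ennreal (X w powr p) \<le> ennreal C * (\<integral>\<^sup>+w\<in>S. ennreal (X w powr p * \<nu> w) \<partial>M)"
  shows "ennreal_powr (\<integral>\<^sup>+w\<in>S. ennreal (X w * \<nu> w) \<partial>M) p \<le> ennreal (C powr (1 - p)) * (\<integral>\<^sup>+w\<in>S. ennreal (X w powr p * \<nu> w) \<partial>M)"
proof (cases "(\<integral>\<^sup>+w\<in>S. ennreal (X w powr p * \<nu> w) \<partial>M) = \<infinity>")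
  case True
  then show ?thesis using C by (simp add: ennreal_mult_top)
next
  case False
  then obtain a where a: "(\<integral>\<^sup>+w\<in>S. ennreal (X w powr p * \<nu> w) \<partial>M) = ennreal a" "a \<ge> 0"
    by (cases "\<integral>\<^sup>+w\<in>S. ennreal (X w powr p * \<nu> w) \<partial>M") auto
  \<comment> \<open>An upper bound for \<open>X powr (1 - p)\<close>.\<close>
  define k where "k = (C * a) powr ((1 - p) / p)"
  have k: "k \<ge> 0" by (simp add: k_def)
  have ptw: "X w \<le> k * X w powr p" if w: "w \<in> S" for w
  proof (cases "X w = 0")
    case False
    then have pos: "X w > 0" using X[OF w] by simp
    have "X w powr p \<le> C * a"
      using sup[OF w] a C by (simp add: ennreal_mult[symmetric])
    then have "(X w powr p) powr ((1 - p) / p) \<le> k"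
      unfolding k_def using p by (intro powr_mono2) auto
    then have "X w powr (1 - p) \<le> k" using p by (simp add: powr_powr)
    then have "X w powr (1 - p) * X w powr p \<le> k * X w powr p" by (intro mult_right_mono) auto
    then show ?thesis using pos by (simp add: powr_add[symmetric])
  qed simp
  have "(\<integral>\<^sup>+w\<in>S. ennreal (X w * \<nu> w) \<partial>M) \<le> (\<integral>\<^sup>+w. ennreal k * (ennreal (X w powr p * \<nu> w) * indicator S w) \<partial>M)"
  proof (rule nn_integral_mono)
    fix w
    show "ennreal (X w * \<nu> w) * indicator S w \<le> ennreal k * (ennreal (X w powr p * \<nu> w) * indicator S w)"
    proof (cases "w \<in> S")
      case True
      have "X w * \<nu> w \<le> k * (X w powr p * \<nu> w)"
        using mult_right_mono[OF ptw[OF True] \<nu>[OF True]] by (simp add: mult.assoc)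
      then show ?thesis using True k \<nu>[OF True] by (simp add: ennreal_mult[symmetric] ennreal_leI)
    qed simp
  qed
  also have "\<dots> = ennreal k * ennreal a"
    by (subst nn_integral_cmult[OF meas]) (simp only: a(1))
  also have "\<dots> = ennreal (k * a)" using k a(2) by (simp add: ennreal_mult)
  finally have "ennreal_powr (\<integral>\<^sup>+w\<in>S. ennreal (X w * \<nu> w) \<partial>M) p \<le> ennreal_powr (ennreal (k * a)) p"
    using p by (intro ennreal_powr_mono) auto
  also have "\<dots> = ennreal ((k * a) powr p)" using k a(2) by (simp add: ennreal_powr_def)
  also have "(k * a) powr p = C powr (1 - p) * a"
  proof (cases "a = 0")
    case False
    have "(k * a) powr p = (C * a) powr (1 - p) * a powr p"
      using k a(2) p by (simp add: powr_mult k_def powr_powr)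
    also have "\<dots> = C powr (1 - p) * (a powr (1 - p) * a powr p)"
      using a(2) C by (simp add: powr_mult)
    also have "a powr (1 - p) * a powr p = a" using a(2) False by (simp add: powr_add[symmetric])
    finally show ?thesis .
  qed (use p in simp)
  finally show ?thesis using a C by (simp add: ennreal_mult)
qed

lemma ennreal_powr_cmult:
  assumes k: "k > 0" shows "ennreal_powr (ennreal k * x) p = ennreal (k powr p) * ennreal_powr x p"
proof (cases x)
  case (real r)
  then show ?thesis using k
    by (simp add: ennreal_powr_def ennreal_mult[symmetric] powr_mult)
next
  case top
  then show ?thesis using k by (simp add: ennreal_powr_def ennreal_mult_top)
qed

lemma abs_powr_half_space_measurable:
  fixes g :: "'n::finite point \<Rightarrow> real"
  assumes g: "continuous_on \<H> g" and p: "0 < p"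
  shows "(\<lambda>w. indicator \<H> w *\<^sub>R \<bar>g w\<bar> powr p) \<in> borel_measurable borel"
  by (rule borel_measurable_continuous_on_indicator[OF upper_half_space_measurable], rule continuous_on_powr')
     (use p in \<open>auto intro!: continuous_intros g\<close>)

abbreviation power_integral :: "real \<Rightarrow> real \<Rightarrow> real \<Rightarrow> ('n::finite point \<Rightarrow> real) \<Rightarrow> 'n::finite point \<Rightarrow> ennreal" where
  "power_integral p b a g z \<equiv> \<integral>\<^sup>+w\<in>\<H>. ennreal (reflected_dist z w powr (- b) * snd w powr a * \<bar>g w\<bar> powr p) \<partial>lborel"

text \<open>
  On the ball about \<open>w\<close> of radius half the height of \<open>w\<close>, the height and
  the distance to the reflection of \<open>z\<close> change at most by a factor of \<open>2\<close>
  in the direction that matters. The weights can thus be moved under the integral in the mean value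
  inequality for \<open>\<bar>g\<bar> powr p\<close>.
\<close>

lemma weighted_submean:
  assumes p: "0 < p" "p \<le> 1" and b: "b \<ge> 0"
  obtains C where "C > 0" "\<And>(g :: 'n::finite point \<Rightarrow> real) z w.
    harmonic_on g \<H> \<Longrightarrow> z \<in> \<H> \<Longrightarrow> w \<in> \<H> \<Longrightarrow>
    ennreal (reflected_dist z w powr (- b) * snd w powr (a + (real CARD('n) + 1)) * \<bar>g w\<bar> powr p) \<le>
    ennreal C * power_integral p b a g z"
proof -
  let ?N = "DIM('n point)"
  have N: "?N = CARD('n) + 1" by simp
  obtain D where D: "D > 0" and mean: "\<And>(g :: 'n point \<Rightarrow> real) S w r.
     harmonic_on g S \<Longrightarrow> cball w r \<subseteq> S \<Longrightarrow> 0 < r \<Longrightarrow>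
       ennreal (\<bar>g w\<bar> powr p) \<le> ennreal (D / r ^ ?N) * (\<integral>\<^sup>+u\<in>ball w r. ennreal (\<bar>g u\<bar> powr p) \<partial>lborel)"
    by (rule harmonic_power_mean_value_inequality[OF p]) blast
  \<comment> \<open>The radius \<open>s / 2\<close> contributes \<open>2 ^ N\<close>, the change of the distances \<open>2 powr b\<close>, that of the heights \<open>2 powr \<bar>a\<bar>\<close>.\<close>
  define E where "E = D * 2 ^ ?N"
  define C where "C = E * (2 powr b * 2 powr \<bar>a\<bar>)"
  have E: "E > 0" using D by (simp add: E_def)
  show thesis
  proof (rule that[of C])
    show "C > 0" using E by (simp add: C_def)
    fix g :: "'n point \<Rightarrow> real" and z w :: "'n point"
    assume harm: "harmonic_on g \<H>" and z: "z \<in> \<H>" and w: "w \<in> \<H>"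
    define s where "s = snd w"
    define r where "r = reflected_dist z w"
    have t: "snd z > 0" and s: "s > 0" using z w by (auto simp: upper_half_space_def s_def)
    have r: "s \<le> r" "r > 0" using reflected_dist_ge[OF t, of w] s by (auto simp: r_def s_def)
    have near: "snd w' \<ge> s / 2 \<and> snd w' \<le> 2 * s \<and> reflected_dist z w' \<le> 2 * r" if "dist w w' \<le> s / 2" for w'
    proof -
      have d: "norm (w - w') \<le> s / 2" using that by (simp add: dist_norm)
      have "\<bar>snd w - snd w'\<bar> \<le> norm (w - w')"
        using norm_snd_le[of "snd (w - w')" "fst (w - w')", unfolded prod.collapse] by simp
      then have 1: "snd w' \<ge> s / 2" "snd w' \<le> 2 * s" using d s unfolding s_def by linarith+
      have "(fst z - fst w', snd z + snd w') = (fst z - fst w, snd z + snd w) + (fst (w - w'), - snd (w - w'))"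
        by simp
      then have "reflected_dist z w' \<le> r + norm (fst (w - w'), - snd (w - w'))"
        unfolding reflected_dist_def r_def by (metis norm_triangle_ineq)
      also have "norm (fst (w - w'), - snd (w - w')) = norm (w - w')" by (simp add: norm_prod_def power2_commute)
      finally show ?thesis using 1 d r(1) s by linarith
    qed
    have sub: "cball w (s / 2) \<subseteq> \<H>"
    proof
      fix w' assume "w' \<in> cball w (s / 2)"
      then have "s / 2 \<le> snd w'" using near[of w'] by simp
      then show "w' \<in> \<H>" using s by (simp add: upper_half_space_def)
    qed
    define \<kappa> where "\<kappa> = r powr (- b) * s powr (a + (real CARD('n) + 1))"
    have \<kappa>: "\<kappa> \<ge> 0" by (simp add: \<kappa>_def)
    define G where "G u = indicator \<H> u *\<^sub>R \<bar>g u\<bar> powr p" for u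
    have [measurable]: "G \<in> borel_measurable borel"
      unfolding G_def[abs_def] by (rule abs_powr_half_space_measurable[OF harmonic_on_imp_continuous_on[OF harm] p(1)])
    have [measurable]: "ball w (s / 2) \<in> sets borel" by simp
    have "(\<lambda>u. ennreal (G u) * indicator (ball w (s / 2)) u) \<in> borel_measurable borel"
      by measurable
    also have "(\<lambda>u. ennreal (G u) * indicator (ball w (s / 2)) u) =
        (\<lambda>u. ennreal (\<bar>g u\<bar> powr p) * indicator (ball w (s / 2)) u)"
      using sub by (auto simp: fun_eq_iff indicator_def subset_iff G_def)
    finally have ball_meas: "(\<lambda>u. ennreal (\<bar>g u\<bar> powr p) * indicator (ball w (s / 2)) u) \<in> borel_measurable lborel" by simp
    have "(\<lambda>u. ennreal (reflected_dist z u powr (- b) * snd u powr a * G u) * indicator \<H> u) \<in> borel_measurable borel"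
      by measurable
    also have "(\<lambda>u. ennreal (reflected_dist z u powr (- b) * snd u powr a * G u) * indicator \<H> u) =
       (\<lambda>u. ennreal (reflected_dist z u powr (- b) * snd u powr a * \<bar>g u\<bar> powr p) * indicator \<H> u)"
      by (auto simp: fun_eq_iff indicator_def G_def)
    finally have H_meas: "(\<lambda>u. ennreal (reflected_dist z u powr (- b) * snd u powr a * \<bar>g u\<bar> powr p) * indicator \<H> u) \<in> borel_measurable lborel" by simp
    have \<kappa>_eq: "\<kappa> * (D / (s / 2) ^ ?N) = E * r powr (- b) * s powr a"
    proof -
      have "s powr (a + (real CARD('n) + 1)) = s powr a * s ^ ?N"
        using s unfolding N powr_add by (simp add: powr_realpow[symmetric] powr_add)
      then show ?thesis using s unfolding \<kappa>_def E_def by (simp add: power_divide)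
    qed
    have "ennreal (\<kappa> * \<bar>g w\<bar> powr p) \<le> ennreal \<kappa> * (ennreal (D / (s / 2) ^ ?N) * (\<integral>\<^sup>+u\<in>ball w (s / 2). ennreal (\<bar>g u\<bar> powr p) \<partial>lborel))"
      unfolding ennreal_mult[OF \<kappa> powr_ge_zero] using s by (intro mult_left_mono mean[OF harm sub]) auto
    also have "\<dots> = ennreal (E * r powr (- b) * s powr a) * (\<integral>\<^sup>+u\<in>ball w (s / 2). ennreal (\<bar>g u\<bar> powr p) \<partial>lborel)"
      unfolding \<kappa>_eq[symmetric] mult.assoc[symmetric] using \<kappa> D s by (subst ennreal_mult[symmetric]) auto
    also have "\<dots> = (\<integral>\<^sup>+u. ennreal (E * r powr (- b) * s powr a) * (ennreal (\<bar>g u\<bar> powr p) * indicator (ball w (s / 2)) u) \<partial>lborel)"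
      by (rule nn_integral_cmult[OF ball_meas, symmetric])
    also have "\<dots> \<le> (\<integral>\<^sup>+u. ennreal C * (ennreal (reflected_dist z u powr (- b) * snd u powr a * \<bar>g u\<bar> powr p) * indicator \<H> u) \<partial>lborel)"
    proof (rule nn_integral_mono)
      fix u
      show "ennreal (E * r powr (- b) * s powr a) * (ennreal (\<bar>g u\<bar> powr p) * indicator (ball w (s / 2)) u) \<le>
         ennreal C * (ennreal (reflected_dist z u powr (- b) * snd u powr a * \<bar>g u\<bar> powr p) * indicator \<H> u)"
      proof (cases "u \<in> ball w (s / 2)")
        case True
        then have u: "s / 2 \<le> snd u" "snd u \<le> 2 * s" "reflected_dist z u \<le> 2 * r" using near[of u] by auto
        have uH: "u \<in> \<H>" using sub True by auto
        have ru: "reflected_dist z u > 0" by (rule reflected_dist_ge(2)[OF t]) (use u s in linarith)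
        have "(2 * r) powr (- b) \<le> reflected_dist z u powr (- b)" using u ru b by (intro powr_mono2') auto
        then have 1: "r powr (- b) \<le> 2 powr b * reflected_dist z u powr (- b)"
          using r by (simp add: powr_mult powr_minus_divide field_simps)
        have 2: "s powr a \<le> 2 powr \<bar>a\<bar> * snd u powr a" by (rule powr_comparable) (use s u in auto)
        have "E * (r powr (- b) * s powr a) * \<bar>g u\<bar> powr p \<le>
            E * ((2 powr b * reflected_dist z u powr (- b)) * (2 powr \<bar>a\<bar> * snd u powr a)) * \<bar>g u\<bar> powr p"
          using E by (intro mult_right_mono mult_left_mono mult_mono 1 2) auto
        also have "\<dots> = C * (reflected_dist z u powr (- b) * snd u powr a * \<bar>g u\<bar> powr p)"
          unfolding C_def by (simp only: mult_ac)
        finally have "ennreal (E * r powr (- b) * s powr a) * ennreal (\<bar>g u\<bar> powr p) \<le>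
           ennreal C * ennreal (reflected_dist z u powr (- b) * snd u powr a * \<bar>g u\<bar> powr p)"
          using E by (subst (1 2) ennreal_mult[symmetric]) (auto simp: C_def mult.assoc intro!: ennreal_leI)
        then show ?thesis by (simp only: indicator_simps(1)[OF True] indicator_simps(1)[OF uH] mult_1_right)
      qed simp
    qed
    also have "\<dots> = ennreal C * power_integral p b a g z"
      by (rule nn_integral_cmult[OF H_meas])
    finally show "ennreal (reflected_dist z w powr (- b) * snd w powr (a + (real CARD('n) + 1)) * \<bar>g w\<bar> powr p) \<le> \<dots>"
      unfolding \<kappa>_def r_def s_def .
  qed
qed

text \<open>
  On the level set, \<open>1 \<le> \<bar>g w\<bar> * snd w powr l / \<delta>\<close>. With \<open>q
  = n + m + 1\<close> this bounds the kernel mass by a multiple of the integral of \<open>X w =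
  (reflected_dist z w) powr (-q) * snd w powr q * \<bar>g w\<bar>\<close> against the measure
  \<open>snd w powr (- (n + 1)) dw\<close>, and \<open>small_exponent_integral_bound\<close>, with
  the pointwise bound of \<open>weighted_submean\<close>, estimates the \<open>p\<close>-th power of
  that integral.
\<close>

lemma level_set_kernel_mass_bound:
  assumes p: "0 < p" "p \<le> 1" and \<delta>: "\<delta> > 0"
  obtains C where "C > 0" "\<And>(g :: 'n::finite point \<Rightarrow> real) z.
    harmonic_on g \<H> \<Longrightarrow> z \<in> \<H> \<Longrightarrow>
    ennreal_powr (kernel_mass m l (level_set \<delta> l g) z) p \<le>
    ennreal C * power_integral p ((real CARD('n) + real (m + 1)) * p) ((real CARD('n) + real (m + 1)) * p - (real CARD('n) + 1)) g z"
proof -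
  let ?q = "real CARD('n) + real (m + 1)" and ?N = "real CARD('n) + 1"
  let ?b = "?q * p"
  let ?a = "?b - ?N"
  obtain C1 where C1: "C1 > 0" "\<And>(g :: 'n point \<Rightarrow> real) z w.
    harmonic_on g \<H> \<Longrightarrow> z \<in> \<H> \<Longrightarrow> w \<in> \<H> \<Longrightarrow>
    ennreal (reflected_dist z w powr (- ?b) * snd w powr (?a + ?N) * \<bar>g w\<bar> powr p) \<le>
    ennreal C1 * power_integral p ?b ?a g z"
    by (rule weighted_submean[OF p, of ?b ?a, where 'n='n]) (use p in auto)
  obtain K where K: "K \<ge> 0" "\<And>z :: 'n point. z \<noteq> 0 \<Longrightarrow> \<bar>poisson_deriv (m + 1) z\<bar> \<le> K * norm z powr (- ?q)"
    using homogeneous_kernel_bound[OF poisson_deriv_homogeneous[of "m + 1"]] by blast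
  define c where "c = 2 ^ (m + 1) / fact m * (K + 1) / \<delta>"
  have c: "c > 0" using K \<delta> by (simp add: c_def)
  show thesis
  proof (rule that[of "c powr p * C1 powr (1 - p)"])
    show "c powr p * C1 powr (1 - p) > 0" using c C1 by simp
    fix g :: "'n point \<Rightarrow> real" and z :: "'n point"
    assume harm: "harmonic_on g \<H>" and z: "z \<in> \<H>"
    have t: "snd z > 0" using z by (simp add: upper_half_space_def)
    define X where "X w = reflected_dist z w powr (- ?q) * snd w powr ?q * \<bar>g w\<bar>" for w
    define \<nu> where "\<nu> w = snd w powr (- ?N)" for w :: "'n point"
    have Xp: "X w powr p * \<nu> w = reflected_dist z w powr (- ?b) * snd w powr ?a * \<bar>g w\<bar> powr p"
      and Xp': "X w powr p = reflected_dist z w powr (- ?b) * snd w powr (?a + ?N) * \<bar>g w\<bar> powr p"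
      if "w \<in> \<H>" for w :: "'n point"
    proof -
      have s: "snd w > 0" using that by (simp add: upper_half_space_def)
      show Xp': "X w powr p = reflected_dist z w powr (- ?b) * snd w powr (?a + ?N) * \<bar>g w\<bar> powr p"
        unfolding X_def by (simp only: powr_mult powr_powr mult_minus_left diff_add_cancel)
      have S: "snd w powr (?a + ?N) * snd w powr (- ?N) = snd w powr ?a"
      proof -
        have "?a + ?N + - ?N = ?a" by simp
        then show ?thesis by (simp only: powr_add[symmetric])
      qed
      have "X w powr p * \<nu> w = reflected_dist z w powr (- ?b) * (snd w powr (?a + ?N) * snd w powr (- ?N)) * \<bar>g w\<bar> powr p"
        unfolding Xp' \<nu>_def by (simp only: mult_ac)
      then show "X w powr p * \<nu> w = reflected_dist z w powr (- ?b) * snd w powr ?a * \<bar>g w\<bar> powr p"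
        unfolding S .
    qed
    have A: "(\<integral>\<^sup>+w\<in>\<H>. ennreal (X w powr p * \<nu> w) \<partial>lborel) =
      power_integral p ?b ?a g z"
      by (rule nn_integral_cong) (use Xp in \<open>auto simp: indicator_def\<close>)
    define G where "G r u = indicator \<H> u *\<^sub>R \<bar>g u\<bar> powr r" for r u
    have G: "G r \<in> borel_measurable borel" if "0 < r" for r
      unfolding G_def[abs_def] by (rule abs_powr_half_space_measurable[OF harmonic_on_imp_continuous_on[OF harm] that])
    note [measurable] = G[OF p(1)] G[of 1, simplified]
    have meas: "(\<lambda>w. ennreal (X w powr p * \<nu> w) * indicator \<H> w) \<in> borel_measurable lborel"
    proof -
      have "(\<lambda>w. ennreal (reflected_dist z w powr (- ?b) * snd w powr ?a * G p w) * indicator \<H> w) \<in> borel_measurable borel"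
        by measurable
      also have "(\<lambda>w. ennreal (reflected_dist z w powr (- ?b) * snd w powr ?a * G p w) * indicator \<H> w) =
         (\<lambda>w. ennreal (X w powr p * \<nu> w) * indicator \<H> w)"
        using Xp by (auto simp: fun_eq_iff indicator_def G_def)
      finally show ?thesis by simp
    qed
    have meas1: "(\<lambda>w. ennreal (X w * \<nu> w) * indicator \<H> w) \<in> borel_measurable lborel"
    proof -
      have "(\<lambda>w. ennreal (reflected_dist z w powr (- ?q) * snd w powr ?q * G 1 w * snd w powr (- ?N)) * indicator \<H> w) \<in> borel_measurable borel"
        by measurable
      also have "(\<lambda>w. ennreal (reflected_dist z w powr (- ?q) * snd w powr ?q * G 1 w * snd w powr (- ?N)) * indicator \<H> w) =
         (\<lambda>w. ennreal (X w * \<nu> w) * indicator \<H> w)"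
        by (auto simp: fun_eq_iff indicator_def X_def \<nu>_def G_def)
      finally show ?thesis by simp
    qed
    have "kernel_mass m l (level_set \<delta> l g) z \<le> (\<integral>\<^sup>+w. ennreal c * (ennreal (X w * \<nu> w) * indicator \<H> w) \<partial>lborel)"
      unfolding kernel_mass_def
    proof (rule nn_integral_mono)
      fix w :: "'n point"
      let ?P = "\<bar>poisson_deriv (m + 1) (z + reflect w)\<bar>"
      show "ennreal (2 ^ (m + 1) / fact m * ?P * snd w powr (real m - l)) * indicator (level_set \<delta> l g) w \<le>
        ennreal c * (ennreal (X w * \<nu> w) * indicator \<H> w)"
      proof (cases "w \<in> level_set \<delta> l g")
        case True
        then have w: "w \<in> \<H>" "snd w > 0" and lev: "\<delta> \<le> \<bar>g w\<bar> * snd w powr l"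
          by (auto simp: level_set_def upper_half_space_def)
        have nz: "z + reflect w \<noteq> 0" using w(2) t by (simp add: add_reflect zero_prod_def)
        have nrm: "norm (z + reflect w) = reflected_dist z w" using w(2) by (simp add: norm_add_reflect)
        have "?P \<le> K * reflected_dist z w powr (- ?q)" using K(2)[OF nz] by (simp only: nrm)
        also have "\<dots> \<le> (K + 1) * reflected_dist z w powr (- ?q)" by (intro mult_right_mono) auto
        finally have P: "?P \<le> (K + 1) * reflected_dist z w powr (- ?q)" .
        have "snd w powr (real m - l) \<le> snd w powr real m * \<bar>g w\<bar> / \<delta>"
        proof -
          have "\<delta> * snd w powr (real m - l) \<le> (\<bar>g w\<bar> * snd w powr l) * snd w powr (real m - l)"
            by (intro mult_right_mono lev) auto
          also have "\<dots> = \<bar>g w\<bar> * snd w powr real m" by (simp add: powr_add[symmetric])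
          finally show ?thesis using \<delta> by (simp add: pos_le_divide_eq mult.commute)
        qed
        also have "snd w powr real m = snd w powr ?q * \<nu> w" unfolding \<nu>_def by (simp add: powr_add[symmetric])
        finally have S: "snd w powr (real m - l) \<le> snd w powr ?q * \<nu> w * \<bar>g w\<bar> / \<delta>" .
        have "2 ^ (m + 1) / fact m * ?P * snd w powr (real m - l) \<le>
           2 ^ (m + 1) / fact m * ((K + 1) * reflected_dist z w powr (- ?q)) * (snd w powr ?q * \<nu> w * \<bar>g w\<bar> / \<delta>)"
          by (intro mult_mono mult_left_mono P S mult_nonneg_nonneg) (use K in auto)
        also have "\<dots> = c * (X w * \<nu> w)" unfolding c_def X_def by simp
        finally have "ennreal (2 ^ (m + 1) / fact m * ?P * snd w powr (real m - l)) \<le> ennreal c * ennreal (X w * \<nu> w)"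
          using c by (subst ennreal_mult[symmetric]) (auto simp: X_def \<nu>_def intro!: ennreal_leI)
        then show ?thesis by (simp only: indicator_simps(1)[OF True] indicator_simps(1)[OF w(1)] mult_1_right)
      qed simp
    qed
    also have "\<dots> = ennreal c * (\<integral>\<^sup>+w\<in>\<H>. ennreal (X w * \<nu> w) \<partial>lborel)"
      by (rule nn_integral_cmult[OF meas1])
    finally have "ennreal_powr (kernel_mass m l (level_set \<delta> l g) z) p \<le>
       ennreal (c powr p) * ennreal_powr (\<integral>\<^sup>+w\<in>\<H>. ennreal (X w * \<nu> w) \<partial>lborel) p"
      unfolding ennreal_powr_cmult[OF c, symmetric] using p by (intro ennreal_powr_mono) auto
    also have "\<dots> \<le> ennreal (c powr p) * (ennreal (C1 powr (1 - p)) * (\<integral>\<^sup>+w\<in>\<H>. ennreal (X w powr p * \<nu> w) \<partial>lborel))"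
    proof (intro mult_left_mono small_exponent_integral_bound[OF p C1(1) meas])
      fix w :: "'n point" assume w: "w \<in> \<H>"
      show "ennreal (X w powr p) \<le> ennreal C1 * (\<integral>\<^sup>+w\<in>\<H>. ennreal (X w powr p * \<nu> w) \<partial>lborel)"
        unfolding A Xp'[OF w] by (rule C1(2)[OF harm z w])
    qed (auto simp: X_def \<nu>_def)
    also have "\<dots> = ennreal (c powr p * C1 powr (1 - p)) * power_integral p ?b ?a g z"
      unfolding A by (simp add: ennreal_mult mult.assoc)
    finally show "ennreal_powr (kernel_mass m l (level_set \<delta> l g) z) p \<le> \<dots>" .
  qed
qed

text \<open>
  After the preceding lemma the exponent \<open>p\<close> sits inside the integral, and Tonelli's
  theorem allows integrating in \<open>z\<close> first. With \<open>b = (n + m + 1) p\<close> this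
  produces the power \<open>n + 1 + \<alpha> - b\<close> of the height of \<open>w\<close>, which
  together with the power \<open>b - (n + 1)\<close> already present leaves \<open>\<alpha>\<close>.
  Convergence needs \<open>b > n + 1 + \<alpha> = l p\<close>.
\<close>

lemma bergman_space_level_integral_finite:
  fixes g :: "'n::finite point \<Rightarrow> real"
  assumes p: "0 < p" "p \<le> 1" and \<alpha>: "\<alpha> > -1" and l: "l = (\<alpha> + real CARD('n) + 1) / p" and m: "real m > l - 1"
    and g: "g \<in> bergman_space p \<alpha>" and \<delta>: "\<delta> > 0"
  shows "level_integral p \<alpha> l m \<delta> g < \<infinity>"
proof -
  let ?b = "(real CARD('n) + real (m + 1)) * p" and ?N = "real CARD('n) + 1"
  let ?a = "?b - ?N"
  have harm: "harmonic_on g \<H>"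
    and fin: "(\<integral>\<^sup>+z\<in>\<H>. ennreal (\<bar>g z\<bar> powr p * snd z powr \<alpha>) \<partial>lborel) < \<infinity>"
    using g by (auto simp: bergman_space_def)
  obtain C where C: "C > 0" "\<And>(g :: 'n point \<Rightarrow> real) z.
    harmonic_on g \<H> \<Longrightarrow> z \<in> \<H> \<Longrightarrow>
    ennreal_powr (kernel_mass m l (level_set \<delta> l g) z) p \<le>
    ennreal C * power_integral p ?b ?a g z"
    by (rule level_set_kernel_mass_bound[OF p \<delta>, where 'n='n and m=m and l=l]) blast
  have b: "?b > ?N + \<alpha>"
  proof -
    have "l * p = \<alpha> + real CARD('n) + 1" using p l by simp
    moreover have "l * p < (real CARD('n) + real (m + 1)) * p" using m p by (intro mult_strict_right_mono) auto
    ultimately show ?thesis by simp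
  qed
  obtain C' where C': "C' > 0" "\<And>w :: 'n point. snd w > 0 \<Longrightarrow>
    (\<integral>\<^sup>+z\<in>\<H>. ennreal (reflected_dist w z powr (- ?b) * snd z powr \<alpha>) \<partial>lborel)
      \<le> ennreal (C' * snd w powr (real CARD('n) + 1 + \<alpha> - ?b))"
    by (rule half_space_kernel_estimate[where 'n='n, of \<alpha> ?b]) (use \<alpha> b in auto)
  define G where "G w = indicator \<H> w *\<^sub>R \<bar>g w\<bar> powr p" for w
  have G [measurable]: "G \<in> borel_measurable borel" unfolding G_def[abs_def]
    by (rule abs_powr_half_space_measurable[OF harmonic_on_imp_continuous_on[OF harm] p(1)])
  have G0: "G w \<ge> 0" for w by (simp add: G_def)
  define h where "h z w = ennreal (reflected_dist z w powr (- ?b) * snd z powr \<alpha>) * indicator \<H> z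
      * (ennreal (C * snd w powr ?a * G w) * indicator \<H> w)" for z w
  have h_meas: "case_prod h \<in> borel_measurable (lborel \<Otimes>\<^sub>M lborel)"
  proof -
    have "(\<lambda>u. ennreal (reflected_dist (fst u) (snd u) powr (- ?b) * snd (fst u) powr \<alpha>) * indicator \<H> (fst u)
      * (ennreal (C * snd (snd u) powr ?a * G (snd u)) * indicator \<H> (snd u))) \<in> borel_measurable borel"
      by measurable
    then show ?thesis unfolding lborel_prod h_def case_prod_unfold by simp
  qed
  have "level_integral p \<alpha> l m \<delta> g
     \<le> (\<integral>\<^sup>+z. \<integral>\<^sup>+w. h z w \<partial>lborel \<partial>lborel)"
  proof (rule nn_integral_mono)
    fix z :: "'n point"
    show "ennreal_powr (kernel_mass m l (level_set \<delta> l g) z) p * ennreal (snd z powr \<alpha>) * indicator \<H> z \<le> (\<integral>\<^sup>+w. h z w \<partial>lborel)"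
    proof (cases "z \<in> \<H>")
      case True
      have meas: "(\<lambda>w. ennreal (reflected_dist z w powr (- ?b) * snd w powr ?a * G w) * indicator \<H> w) \<in> borel_measurable lborel"
        by measurable
      have "ennreal_powr (kernel_mass m l (level_set \<delta> l g) z) p * ennreal (snd z powr \<alpha>) \<le>
         ennreal C * power_integral p ?b ?a g z * ennreal (snd z powr \<alpha>)"
        by (intro mult_right_mono C(2)[OF harm True]) simp
      also have "power_integral p ?b ?a g z =
         (\<integral>\<^sup>+w\<in>\<H>. ennreal (reflected_dist z w powr (- ?b) * snd w powr ?a * G w) \<partial>lborel)"
        by (rule nn_integral_cong) (auto simp: G_def indicator_def)
      also have "ennreal C * \<dots> * ennreal (snd z powr \<alpha>) = ennreal (C * snd z powr \<alpha>) * \<dots>"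
        using C(1) by (simp add: ennreal_mult mult_ac)
      also have "\<dots> = (\<integral>\<^sup>+w. ennreal (C * snd z powr \<alpha>) * (ennreal (reflected_dist z w powr (- ?b) * snd w powr ?a * G w) * indicator \<H> w) \<partial>lborel)"
        by (rule nn_integral_cmult[OF meas, symmetric])
      also have "\<dots> = (\<integral>\<^sup>+w. h z w \<partial>lborel)"
      proof (rule nn_integral_cong)
        fix w
        have "ennreal (C * snd z powr \<alpha>) * ennreal (reflected_dist z w powr (- ?b) * snd w powr ?a * G w) =
          ennreal (reflected_dist z w powr (- ?b) * snd z powr \<alpha>) * ennreal (C * snd w powr ?a * G w)"
          using C(1) G0 by (subst (1 2) ennreal_mult[symmetric]) (auto simp: mult_ac)
        then show "ennreal (C * snd z powr \<alpha>) * (ennreal (reflected_dist z w powr (- ?b) * snd w powr ?a * G w) * indicator \<H> w) = h z w"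
          unfolding h_def indicator_simps(1)[OF True] mult_1_right mult.assoc[symmetric] by (simp only:)
      qed
      finally show ?thesis by (simp only: indicator_simps(1)[OF True] mult_1_right)
    qed simp
  qed
  also have "\<dots> = (\<integral>\<^sup>+w. \<integral>\<^sup>+z. h z w \<partial>lborel \<partial>lborel)"
    by (rule lborel_pair.Fubini'[OF h_meas, symmetric])
  also have "\<dots> \<le> (\<integral>\<^sup>+w. ennreal (C' * C) * (ennreal (G w * snd w powr \<alpha>) * indicator \<H> w) \<partial>lborel)"
  proof (rule nn_integral_mono)
    fix w :: "'n point"
    show "(\<integral>\<^sup>+z. h z w \<partial>lborel) \<le> ennreal (C' * C) * (ennreal (G w * snd w powr \<alpha>) * indicator \<H> w)"
    proof (cases "w \<in> \<H>")
      case True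
      then have s: "snd w > 0" by (simp add: upper_half_space_def)
      have "(\<integral>\<^sup>+z. h z w \<partial>lborel) = (\<integral>\<^sup>+z\<in>\<H>. ennreal (reflected_dist z w powr (- ?b) * snd z powr \<alpha>) \<partial>lborel)
         * (ennreal (C * snd w powr ?a * G w) * indicator \<H> w)"
        unfolding h_def by (rule nn_integral_multc) measurable
      also have "\<dots> \<le> ennreal (C' * snd w powr (real CARD('n) + 1 + \<alpha> - ?b)) * (ennreal (C * snd w powr ?a * G w) * indicator \<H> w)"
        using C'(2)[OF s] unfolding reflected_dist_commute[of _ w] by (intro mult_right_mono) auto
      also have "\<dots> = ennreal (C' * C * G w * (snd w powr (real CARD('n) + 1 + \<alpha> - ?b) * snd w powr ?a))"
        using True C C' G0 by (simp add: ennreal_mult[symmetric] mult_ac)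
      also have "snd w powr (real CARD('n) + 1 + \<alpha> - ?b) * snd w powr ?a = snd w powr \<alpha>"
        by (simp only: powr_add[symmetric]) simp
      also have "ennreal (C' * C * G w * snd w powr \<alpha>) = ennreal (C' * C) * (ennreal (G w * snd w powr \<alpha>) * indicator \<H> w)"
        using True C C' G0 by (simp add: ennreal_mult[symmetric] mult.assoc)
      finally show ?thesis .
    next
      case False
      have "h z w = 0" for z unfolding h_def by (simp only: indicator_simps(2)[OF False] mult_zero_right)
      then show ?thesis by simp
    qed
  qed
  also have "\<dots> = ennreal (C' * C) * (\<integral>\<^sup>+w\<in>\<H>. ennreal (G w * snd w powr \<alpha>) \<partial>lborel)"
    by (rule nn_integral_cmult) measurable
  also have "(\<integral>\<^sup>+w\<in>\<H>. ennreal (G w * snd w powr \<alpha>) \<partial>lborel) = (\<integral>\<^sup>+z\<in>\<H>. ennreal (\<bar>g z\<bar> powr p * snd z powr \<alpha>) \<partial>lborel)"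
    by (rule nn_integral_cong) (auto simp: G_def indicator_def)
  also have "ennreal (C' * C) * \<dots> < \<infinity>" using fin by (simp add: ennreal_mult_less_top)
  finally show ?thesis .
qed

lemma level_dist_eq:
  fixes f :: "'n::finite point \<Rightarrow> real"
  shows "level_dist p \<alpha> l m f = (INF \<epsilon> \<in> {\<epsilon>. \<epsilon> > 0 \<and>
    level_integral p \<alpha> l m \<epsilon> f < \<infinity>}. ennreal \<epsilon>)"
proof -
  have "(\<integral>\<^sup>+z\<in>\<H>. (ennreal_powr (\<integral>\<^sup>+w\<in>level_set \<epsilon> l f. ennreal (\<bar>bergman_kernel m z w\<bar> * snd w powr (real m - l)) \<partial>lborel) p
      * ennreal (snd z powr \<alpha>)) \<partial>lborel) =
    level_integral p \<alpha> l m \<epsilon> f" for \<epsilon>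
  proof (rule nn_integral_cong)
    fix z :: "'n point"
    have sub: "level_set \<epsilon> l f \<subseteq> \<H>" by (auto simp: level_set_def)
    show "ennreal_powr (\<integral>\<^sup>+w\<in>level_set \<epsilon> l f. ennreal (\<bar>bergman_kernel m z w\<bar> * snd w powr (real m - l)) \<partial>lborel) p
      * ennreal (snd z powr \<alpha>) * indicator \<H> z =
      ennreal_powr (kernel_mass m l (level_set \<epsilon> l f) z) p * ennreal (snd z powr \<alpha>) * indicator \<H> z"
    proof (cases "z \<in> \<H>")
      case True
      show ?thesis unfolding kernel_mass_eq[OF sub True] ..
    next
      case False
      show ?thesis by (simp only: indicator_simps(2)[OF False] mult_zero_right)
    qed
  qed
  then show ?thesis unfolding level_dist_def by (simp only:)
qed

theorem theorem7:
  fixes p \<alpha> l :: real and m :: nat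
  assumes "0 < p" and "p \<le> 1" and "\<alpha> > -1"
    and "l = (\<alpha> + real CARD('n::finite) + 1) / p"
    and "real m > max (l - 1) (\<alpha> / p)"
  shows "\<exists>c C. 0 < c \<and> 0 < C \<and>
    (\<forall>f \<in> (growth_space l :: ((real ^ 'n) \<times> real \<Rightarrow> real) set).
       ennreal c * bergman_dist p \<alpha> l f \<le> level_dist p \<alpha> l m f \<and>
       level_dist p \<alpha> l m f \<le> ennreal C * bergman_dist p \<alpha> l f)"
proof -
  have l: "l > 0" using assms(1,3,4) by simp
  have m: "real m > l - 1" using assms(5) by simp
  obtain K where K: "K > 0" "\<And>(f :: 'n point \<Rightarrow> real) \<epsilon>.
    f \<in> growth_space l \<Longrightarrow> \<epsilon> > 0 \<Longrightarrow>
    level_integral p \<alpha> l m \<epsilon> f < \<infinity> \<Longrightarrow>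
    bergman_dist p \<alpha> l f \<le> ennreal (K * \<epsilon>)"
    by (rule bergman_dist_le_level[where 'n='n and \<alpha>=\<alpha>, OF assms(1) l m]) blast
  have lower: "ennreal (1 / K) * bergman_dist p \<alpha> l f \<le> level_dist p \<alpha> l m f"
    if f: "f \<in> growth_space l" for f :: "'n point \<Rightarrow> real"
    unfolding level_dist_eq
  proof (rule INF_greatest)
    fix \<epsilon> assume "\<epsilon> \<in> {\<epsilon>. \<epsilon> > 0 \<and>
      level_integral p \<alpha> l m \<epsilon> f < \<infinity>}"
    then have \<epsilon>: "\<epsilon> > 0" "bergman_dist p \<alpha> l f \<le> ennreal (K * \<epsilon>)" using K(2)[OF f] by auto
    have "ennreal (1 / K) * bergman_dist p \<alpha> l f \<le> ennreal (1 / K) * ennreal (K * \<epsilon>)"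
      by (intro mult_left_mono \<epsilon>) simp
    also have "\<dots> = ennreal \<epsilon>" using K(1) \<epsilon>(1) by (subst ennreal_mult[symmetric]) auto
    finally show "ennreal (1 / K) * bergman_dist p \<alpha> l f \<le> ennreal \<epsilon>" .
  qed
  have upper: "level_dist p \<alpha> l m f \<le> bergman_dist p \<alpha> l f" for f :: "'n point \<Rightarrow> real"
    unfolding bergman_dist_def
  proof (rule INF_greatest)
    fix g :: "'n point \<Rightarrow> real" assume g: "g \<in> bergman_space p \<alpha>"
    define d where "d = enn2real (growth_norm l (\<lambda>z. f z - g z))"
    show "level_dist p \<alpha> l m f \<le> growth_norm l (\<lambda>z. f z - g z)"
    proof (cases "growth_norm l (\<lambda>z. f z - g z) < \<infinity>")
      case True
      have d: "growth_norm l (\<lambda>z. f z - g z) = ennreal d" "d \<ge> 0" using True by (auto simp: d_def)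
      show ?thesis unfolding d(1)
      proof (rule ennreal_le_epsilon)
        fix e :: real assume e: "0 < e"
        have sub: "level_set (d + e) l f \<subseteq> level_set e l g"
        proof
          fix z assume "z \<in> level_set (d + e) l f"
          then have z: "z \<in> \<H>" and lev: "d + e \<le> \<bar>f z\<bar> * snd z powr l" by (auto simp: level_set_def)
          have "\<bar>f z\<bar> * snd z powr l \<le> (\<bar>f z - g z\<bar> + \<bar>g z\<bar>) * snd z powr l"
            by (intro mult_right_mono) auto
          also have "\<dots> \<le> d + \<bar>g z\<bar> * snd z powr l"
            using growth_space_bound(1)[OF True z] by (simp add: distrib_right d_def)
          finally show "z \<in> level_set e l g" using z lev by (simp add: level_set_def)
        qed
        have "level_integral p \<alpha> l m (d + e) f \<le>
          level_integral p \<alpha> l m e g"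
          using assms(1) by (intro nn_integral_mono mult_right_mono ennreal_powr_mono kernel_mass_mono sub) auto
        also have "\<dots> < \<infinity>"
          by (rule bergman_space_level_integral_finite[OF assms(1-4) m g e])
        finally have "level_dist p \<alpha> l m f \<le> ennreal (d + e)"
          unfolding level_dist_eq using d(2) e by (intro INF_lower) auto
        then show "level_dist p \<alpha> l m f \<le> ennreal d + ennreal e" using d(2) e by simp
      qed
    next
      case False
      then show ?thesis by (simp add: less_top[symmetric])
    qed
  qed
  show ?thesis
    by (rule exI[of _ "1 / K"], rule exI[of _ 1]) (use K(1) lower upper in auto)
qed

end
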